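(* Let $N\in\mathbb{N}^+$, let $J=(J_{\imath,\jmath})\in M_{2^N\times N}(\mathbb{S})$ have full slice-rank, let $\mathcal{G}=(G,\pi,x_0)$ be a slice-domain of regularity with $\pi(x_0)\in\mathbb{R}$, and let $\gamma$ be an $N$-part path in $\mathbb{C}$. Denote by $J_\imath\in\mathbb{S}^N$ the $\imath$-th row of $J$. If $$\gamma^{J_\imath}\prec\mathcal{G},\qquad \imath=1,2,\dots,2^N,$$ then $$\gamma^K\prec\mathcal{G},\qquad\forall\ K\in\mathbb{S}^N.$$ Moreover, if $f$ is a slice regular function on $G$ such that $\mathcal{G}$ is a slice-domain of existence of $f$ with respect to $\mathcal{G}$, then for every $K\in\mathbb{S}^N$ $$f(\gamma^K_{\mathcal{G}}(1))=\zeta(K)\,\mathcal{M}(J)^{-1}f(\gamma^J_{\mathcal{G}}(1)),$$ where $$f(\gamma^J_{\mathcal{G}}(1)):=\bigl(f(\gamma^{J_1}_{\mathcal{G}}(1)),f(\gamma^{J_2}_{\mathcal{G}}(1)),\dots,f(\gamma^{J_{2^N}}_{\mathcal{G}}(1))\bigr)^T.$$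
   Context: **Slice topology.** $\mathbb{H}$ is the skew field of quaternions, $\mathbb{S}=\{q\in\mathbb{H}:q^2=-1\}$, and $\mathbb{C}_I=\{x+yI:x,y\in\mathbb{R}\}$ ($I\in\mathbb{S}$) with the Euclidean topology. The slice-topology $\tau_s$ on $\mathbb{H}$ is the quotient topology induced by the natural map $\bigsqcup_{I\in\mathbb{S}}\mathbb{C}_I\to\mathbb{H}$; thus $U$ is slice-open iff $U\cap\mathbb{C}_I$ is open in $\mathbb{C}_I$ for every $I$. The prefix "slice-" (slice-open, slice-path, slice-homeomorphism, ...) refers to $\tau_s$. A path is a continuous map from $[0,1]$. For $I\in\mathbb{S}$ let $P_I:\mathbb{C}\to\mathbb{C}_I$, $P_I(x+yi)=x+yI$. **Slice regular functions.** A function $f$ from an open set of $\mathbb{C}_I$ to $\mathbb{H}$ is holomorphic if it has continuous partial derivatives and $\frac12(\frac{\partial}{\partial x}+I\frac{\partial}{\partial y})f(x+yI)=0$. A function $f:\Omega\to\mathbb{H}$ on a slice-open set $\Omega$ is slice regular if $f|_{\Omega\cap\mathbb{C}_I}$ is holomorphic for every $I\in\mathbb{S}$. **Riemann slice-domains.** A slice-domain over $\mathbb{H}$ is a pair $(G,\pi)$ with $G$ a connected Hausdorff space and $\pi:G\to\mathbb{H}$ a local homeomorphism with respect to the topology of $G$ and $\tau_s$. With a chosen point $x\in G$, $(G,\pi,x)$ is a slice-domain over $\mathbb{H}$ with distinguished point. $G_{\mathbb{R}}:=\pi^{-1}(\mathbb{R})$. A function $f:G\to\mathbb{H}$ is slice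 regular if every point of $G$ has an open neighborhood $U$ such that $\pi|_U$ is a slice-homeomorphism onto a slice-open set $V\subset\mathbb{H}$ and $f\circ(\pi|_U)^{-1}$ is slice regular on $V$. We write $(G_1,\pi_1,x_1)\prec(G_2,\pi_2,x_2)$ if there is a (necessarily unique) continuous map $\varphi:G_1\to G_2$ with $\pi_2\circ\varphi=\pi_1$ and $\varphi(x_1)=x_2$ (the fiber preserving map); in this case, for a function $F$ on $G_2$, $F|_{G_1}:=F\circ\varphi$. **Slice-domains of regularity.** An upper bound of a family of slice-domains with distinguished point is a slice-domain with distinguished point $\mathcal{U}$ such that every member $\mathcal L$ of the family satisfies $\mathcal L\prec\mathcal{U}$; a union of the family is an upper bound $\mathcal{U}$ with $\mathcal{U}\prec\mathcal{U}'$ for every upper bound $\mathcal{U}'$. For $f$ slice regular on $G$, where $\mathcal{G}=(G,\pi,x)$, a slice-domain with distinguished point $\breve{\mathcal{G}}=(\breve G,\breve\pi,\breve x)$ is $\{f\}$-extendible if $\mathcal{G}\prec\breve{\mathcal{G}}$ and there is a slice regular $F$ on $\breve G$ with $F|_G=f$. A slice-domain of existence of $f$ with respect to $\mathcal{G}$ is a union of all $\{f\}$-extendible slice-domains with distinguished point. $\mathcal{G}$ is a slice-domain of regularity if there is a slice regular $f$ on $G$ such that $\mathcal{G}$ itself is a slice-domain of existence of $f$ with respect to $\mathcal{G}$. **Finite-part paths.** An $N$-part path in $\mathbb{C}$ is an $N$-tuple $\gamma=(\gamma_1,\dots,\gamma_N)$ of paths in $\mathbb{C}$ with $\gamma_\imath(1)=\gamma_{\imath+1}(0)\in\mathbb{R}$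 for $1\le\imath\le N-1$. A slice-path in $\mathbb{H}$ is slice preserving if its image lies in some $\mathbb{C}_I$; an $N$-part path in $\mathbb{H}$ is an $N$-tuple of slice preserving paths $\gamma_\imath$ with $\gamma_\imath(1)=\gamma_{\imath+1}(0)\in\mathbb{R}$. A path $\alpha$ in $G$ is slice preserving if $\pi\circ\alpha$ is; an $N$-part path in $G$ is an $N$-tuple of slice preserving paths in $G$ with $\alpha_\imath(1)=\alpha_{\imath+1}(0)\in G_{\mathbb{R}}$. In each case $\gamma(0):=\gamma_1(0)$ and $\gamma(1):=\gamma_N(1)$. For $I=(I_1,\dots,I_N)\in\mathbb{S}^N$ and an $N$-part path $\gamma$ in $\mathbb{C}$, $\gamma^I:=(P_{I_1}(\gamma_1),\dots,P_{I_N}(\gamma_N))$, an $N$-part path in $\mathbb{H}$. An $N$-part path $\delta$ in $\mathbb{H}$ is contained in $\mathcal{G}=(G,\pi,x_0)$, written $\delta\prec\mathcal{G}$, if there is an $N$-part path $\alpha$ in $G$ with $\alpha(0)=x_0$ and $(\pi\circ\alpha_1,\dots,\pi\circ\alpha_N)=\delta$; such $\alpha$ is unique and is denoted $\delta_{\mathcal{G}}$. So $\gamma^I_{\mathcal{G}}:=(\gamma^I)_{\mathcal{G}}$. **Matrices.** For $I=(I_1,\dots,I_N)\in\mathbb{S}^N$ and $m\in\{1,\dots,2^N\}$, with $(m_Nm_{N-1}\cdots m_1)_2$ the binary expansion of $m-1$ and $I_0:=1$, put $I(m):=(I_NI_{N-1})^{m_N}(I_{N-1}I_{N-2})^{m_{N-1}}\cdots(I_1I_0)^{m_1}$,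 and let $\zeta(I):=(I(1),I(2),\dots,I(2^N))$ (a row vector). $M_{m\times n}(A)$ is the set of $m\times n$ matrices with entries in $A$. For $K\in M_{2^l\times l}(\mathbb{S})$ with rows $K_1,\dots,K_{2^l}$, $\mathcal{M}(K)$ is the $2^l\times2^l$ quaternionic matrix whose $\imath$-th row is $\zeta(K_\imath)$. For $J\in M_{2^N\times N}(\mathbb{S})$ and $l\le N$, $J^{(l)}$ is the $2^l\times l$ upper-left submatrix $(J_{\imath,\jmath})_{1\le\imath\le 2^l,\,1\le\jmath\le l}$. $J$ has full slice-rank if $\mathcal{M}(J^{(l)})$ is invertible (two-sided inverse in $M_{2^l}(\mathbb{H})$) for each $l\in\{1,\dots,N\}$. *)

theory Defs
  imports "HOL-Analysis.Analysis" "Jordan_Normal_Form.Matrix"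
begin

section \<open>Quaternions\<close>

datatype quat = Quat (qRe: real) (qI: real) (qJ: real) (qK: real)

lemma quat_eq_iff: "p = q \<longleftrightarrow> qRe p = qRe q \<and> qI p = qI q \<and> qJ p = qJ q \<and> qK p = qK q"
  by (cases p; cases q) simp

instantiation quat :: real_vector
begin

definition "0 = Quat 0 0 0 0"
definition "p + q = Quat (qRe p + qRe q) (qI p + qI q) (qJ p + qJ q) (qK p + qK q)"
definition "- p = Quat (- qRe p) (- qI p) (- qJ p) (- qK p)"
definition "(p::quat) - q = Quat (qRe p - qRe q) (qI p - qI q) (qJ p - qJ q) (qK p - qK q)"
definition "r *\<^sub>R p = Quat (r * qRe p) (r * qI p) (r * qJ p) (r * qK p)"

lemma quat_linear_simps [simp]:
  "qRe 0 = 0" "qI 0 = 0" "qJ 0 = 0" "qK 0 = 0"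
  "qRe (p + q) = qRe p + qRe q" "qI (p + q) = qI p + qI q"
  "qJ (p + q) = qJ p + qJ q" "qK (p + q) = qK p + qK q"
  "qRe (- p) = - qRe p" "qI (- p) = - qI p" "qJ (- p) = - qJ p" "qK (- p) = - qK p"
  "qRe (p - q) = qRe p - qRe q" "qI (p - q) = qI p - qI q"
  "qJ (p - q) = qJ p - qJ q" "qK (p - q) = qK p - qK q"
  "qRe (r *\<^sub>R p) = r * qRe p" "qI (r *\<^sub>R p) = r * qI p"
  "qJ (r *\<^sub>R p) = r * qJ p" "qK (r *\<^sub>R p) = r * qK p"
  by (simp_all add: zero_quat_def plus_quat_def uminus_quat_def minus_quat_def scaleR_quat_def)

instance
  by standard (simp_all add: quat_eq_iff algebra_simps)

end

instantiation quat :: real_inner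
begin

definition "inner p q = qRe p * qRe q + qI p * qI q + qJ p * qJ q + qK p * qK q"
definition "norm (p::quat) = sqrt (inner p p)"
definition "sgn (p::quat) = p /\<^sub>R norm p"
definition "dist (p::quat) q = norm (p - q)"
definition "(uniformity :: (quat \<times> quat) filter) = (INF e\<in>{0<..}. principal {(x, y). dist x y < e})"
definition "open (U :: quat set) \<longleftrightarrow> (\<forall>x\<in>U. eventually (\<lambda>(x', y). x' = x \<longrightarrow> y \<in> U) uniformity)"

instance
proof
  fix p :: quat
  show "0 \<le> inner p p" by (simp add: inner_quat_def)
  show "inner p p = 0 \<longleftrightarrow> p = 0"
    by (simp add: inner_quat_def quat_eq_iff add_nonneg_eq_0_iff)
qed (simp_all add: inner_quat_def norm_quat_def sgn_quat_def dist_quat_def uniformity_quat_def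
        open_quat_def algebra_simps)

end

instantiation quat :: real_normed_div_algebra
begin

definition "1 = Quat 1 0 0 0"

definition "p * q = Quat
  (qRe p * qRe q - qI p * qI q - qJ p * qJ q - qK p * qK q)
  (qRe p * qI q + qI p * qRe q + qJ p * qK q - qK p * qJ q)
  (qRe p * qJ q - qI p * qK q + qJ p * qRe q + qK p * qI q)
  (qRe p * qK q + qI p * qJ q - qJ p * qI q + qK p * qRe q)"

definition "inverse p = Quat (qRe p) (- qI p) (- qJ p) (- qK p) /\<^sub>R ((norm p)\<^sup>2)"

definition "(p::quat) div q = p * inverse q"

lemma quat_mult_simps [simp]:
  "qRe 1 = 1" "qI 1 = 0" "qJ 1 = 0" "qK 1 = 0"
  "qRe (p * q) = qRe p * qRe q - qI p * qI q - qJ p * qJ q - qK p * qK q"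
  "qI (p * q) = qRe p * qI q + qI p * qRe q + qJ p * qK q - qK p * qJ q"
  "qJ (p * q) = qRe p * qJ q - qI p * qK q + qJ p * qRe q + qK p * qI q"
  "qK (p * q) = qRe p * qK q + qI p * qJ q - qJ p * qI q + qK p * qRe q"
  by (simp_all add: one_quat_def times_quat_def)

lemma quat_norm_sq: "(norm (p::quat))\<^sup>2 = (qRe p)\<^sup>2 + (qI p)\<^sup>2 + (qJ p)\<^sup>2 + (qK p)\<^sup>2"
  by (simp add: norm_quat_def inner_quat_def power2_eq_square)

instance
proof
  fix p q r :: quat and a :: real
  show "p * q * r = p * (q * r)"
    by (intro quat_eq_iff[THEN iffD2] conjI; simp add: algebra_simps)
  show "1 * p = p" "p * 1 = p" "(0::quat) \<noteq> 1" "inverse (0::quat) = 0"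
    by (simp_all add: quat_eq_iff inverse_quat_def)
  show "(p + q) * r = p * r + q * r" "p * (q + r) = p * q + p * r"
    by (simp_all add: quat_eq_iff algebra_simps)
  show "(a *\<^sub>R p) * q = a *\<^sub>R (p * q)" "p * (a *\<^sub>R q) = a *\<^sub>R (p * q)"
    by (simp_all add: quat_eq_iff algebra_simps)
  have sc: "(a *\<^sub>R p) * q = a *\<^sub>R (p * q)" "p * (a *\<^sub>R q) = a *\<^sub>R (p * q)"
    for a and p q :: quat
    by (simp_all add: quat_eq_iff algebra_simps)
  have "(norm (p * q))\<^sup>2 = (norm p * norm q)\<^sup>2"
    unfolding power_mult_distrib quat_norm_sq quat_mult_simps
    by (simp add: power2_eq_square algebra_simps)
  then show "norm (p * q) = norm p * norm q"
    by (rule power2_eq_imp_eq) simp_all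
  show "p div q = p * inverse q" by (rule divide_quat_def)
  assume "p \<noteq> 0"
  then have n: "(norm p)\<^sup>2 \<noteq> 0" by simp
  have s: "p * Quat (qRe p) (- qI p) (- qJ p) (- qK p) = (norm p)\<^sup>2 *\<^sub>R 1"
       "Quat (qRe p) (- qI p) (- qJ p) (- qK p) * p = (norm p)\<^sup>2 *\<^sub>R 1"
    unfolding quat_eq_iff quat_norm_sq by (simp_all add: power2_eq_square)
  have one: "inverse ((norm p)\<^sup>2) *\<^sub>R (norm p)\<^sup>2 *\<^sub>R (1::quat) = 1"
    by (simp only: scaleR_scaleR left_inverse[OF n] scaleR_one)
  show "inverse p * p = 1" "p * inverse p = 1"
    unfolding inverse_quat_def sc s by (rule one)+
qed

end


section \<open>The slice topology and slice regular functions\<close>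

definition imag_units :: "quat set" ("\<S>") where
  "\<S> = {q. q\<^sup>2 = -1}"

definition slice_emb :: "quat \<Rightarrow> complex \<Rightarrow> quat" where
  "slice_emb I z = of_real (Re z) + of_real (Im z) * I"

definition slice_plane :: "quat \<Rightarrow> quat set" where
  "slice_plane I = range (slice_emb I)"

definition slice_topology :: "quat topology" where
  "slice_topology =
    topology (\<lambda>U. \<forall>I\<in>\<S>. openin (top_of_set (slice_plane I)) (U \<inter> slice_plane I))"

lemma openin_slice_topology:
  "openin slice_topology U \<longleftrightarrow>
    (\<forall>I\<in>\<S>. openin (top_of_set (slice_plane I)) (U \<inter> slice_plane I))"
proof -
  have "istopology (\<lambda>U. \<forall>I\<in>\<S>. openin (top_of_set (slice_plane I)) (U \<inter> slice_plane I))"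
    unfolding istopology_def
  proof (intro conjI allI impI ballI)
    fix S T I
    assume S: "\<forall>I\<in>\<S>. openin (top_of_set (slice_plane I)) (S \<inter> slice_plane I)"
      and T: "\<forall>I\<in>\<S>. openin (top_of_set (slice_plane I)) (T \<inter> slice_plane I)"
      and I: "I \<in> \<S>"
    have "S \<inter> T \<inter> slice_plane I = (S \<inter> slice_plane I) \<inter> (T \<inter> slice_plane I)" by auto
    then show "openin (top_of_set (slice_plane I)) (S \<inter> T \<inter> slice_plane I)"
      using openin_Int[OF S[rule_format, OF I] T[rule_format, OF I]] by (simp only:)
  next
    fix \<U> I
    assume U: "\<forall>U\<in>\<U>. \<forall>I\<in>\<S>. openin (top_of_set (slice_plane I)) (U \<inter> slice_plane I)"
      and I: "I \<in> \<S>"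
    have "\<Union>\<U> \<inter> slice_plane I = \<Union>((\<lambda>U. U \<inter> slice_plane I) ` \<U>)" by auto
    moreover have "openin (top_of_set (slice_plane I)) (\<Union>((\<lambda>U. U \<inter> slice_plane I) ` \<U>))"
      by (rule openin_Union) (use U I in \<open>auto simp only: image_iff\<close>)
    ultimately show "openin (top_of_set (slice_plane I)) (\<Union>\<U> \<inter> slice_plane I)"
      by (simp only:)
  qed
  then show ?thesis
    by (simp add: slice_topology_def topology_inverse')
qed

lemma Quat_square: "(Quat a b c d)\<^sup>2 = Quat (a\<^sup>2 - b\<^sup>2 - c\<^sup>2 - d\<^sup>2) (2*a*b) (2*a*c) (2*a*d)"
  by (simp add: quat_eq_iff power2_eq_square)

lemma quat_in_slice_plane: "\<exists>I\<in>\<S>. q \<in> slice_plane I"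
proof -
  obtain a b c d where q: "q = Quat a b c d" by (cases q)
  define r where "r = sqrt (b\<^sup>2 + c\<^sup>2 + d\<^sup>2)"
  have r2: "r\<^sup>2 = b\<^sup>2 + c\<^sup>2 + d\<^sup>2" by (simp add: r_def)
  define I where "I = (if r = 0 then Quat 0 1 0 0 else Quat 0 (b/r) (c/r) (d/r))"
  have "(b/r)\<^sup>2 + (c/r)\<^sup>2 + (d/r)\<^sup>2 = 1" if "r \<noteq> 0"
  proof -
    have "(b/r)\<^sup>2 + (c/r)\<^sup>2 + (d/r)\<^sup>2 = (b\<^sup>2 + c\<^sup>2 + d\<^sup>2) / r\<^sup>2"
      by (simp add: power_divide add_divide_distrib)
    moreover have "b\<^sup>2 + c\<^sup>2 + d\<^sup>2 \<noteq> 0" using that r2 by (metis power_not_zero)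
    ultimately show ?thesis unfolding r2 by simp
  qed
  then have "I \<in> \<S>"
    by (auto simp: I_def imag_units_def Quat_square quat_eq_iff)
  moreover have "q = slice_emb I (Complex a r)"
    using r2 by (auto simp: q I_def slice_emb_def of_real_def quat_eq_iff add_nonneg_eq_0_iff)
  ultimately show ?thesis unfolding slice_plane_def by blast
qed

lemma topspace_slice_topology [simp]: "topspace slice_topology = UNIV"
proof -
  have "openin (top_of_set (slice_plane I)) (UNIV \<inter> slice_plane I)" for I
    by (simp only: Int_UNIV_left openin_subtopology_self)
  then have "openin slice_topology UNIV"
    unfolding openin_slice_topology by (intro ballI)
  then show ?thesis
    by (intro top_le openin_subset)
qed

lemma quotient_map_slice_topology:
  "quotient_map (sum_topology (\<lambda>I. top_of_set (slice_plane I)) \<S>) slice_topology snd"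
proof -
  let ?X = "sum_topology (\<lambda>I. top_of_set (slice_plane I)) \<S>"
  have top: "topspace ?X = Sigma \<S> slice_plane"
    unfolding topspace_sum_topology comp_def topspace_euclidean_subtopology ..
  have surj: "snd ` Sigma \<S> slice_plane = UNIV"
    using quat_in_slice_plane by force
  have "openin ?X {x \<in> Sigma \<S> slice_plane. snd x \<in> U} \<longleftrightarrow> openin slice_topology U" for U
  proof -
    have sec: "{q. (I, q) \<in> {x \<in> Sigma \<S> slice_plane. snd x \<in> U}} = U \<inter> slice_plane I"
      if "I \<in> \<S>" for I
      using that by auto
    have sub: "{x \<in> Sigma \<S> slice_plane. snd x \<in> U} \<subseteq> topspace ?X"
      unfolding top by (rule Collect_restrict)
    show ?thesis
      unfolding openin_sum_topology openin_slice_topology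
      using sub[unfolded topspace_sum_topology] by (simp only: sec simp_thms cong: ball_cong)
  qed
  then show ?thesis
    unfolding quotient_map_def top topspace_slice_topology using surj by blast
qed

text \<open>The functions \<open>fx\<close> and \<open>fy\<close> are the partial derivatives of
  \<open>(x, y) \<mapsto> f (x + y I)\<close>.\<close>

definition slice_holomorphic_on :: "quat \<Rightarrow> quat set \<Rightarrow> (quat \<Rightarrow> quat) \<Rightarrow> bool" where
  "slice_holomorphic_on I W f \<longleftrightarrow>
    openin (top_of_set (slice_plane I)) W \<and>
    (\<exists>fx fy. continuous_on W fx \<and> continuous_on W fy \<and>
      (\<forall>x y. slice_emb I (Complex x y) \<in> W \<longrightarrow>
        ((\<lambda>t. f (slice_emb I (Complex t y))) has_vector_derivative
            fx (slice_emb I (Complex x y))) (at x) \<and>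
        ((\<lambda>t. f (slice_emb I (Complex x t))) has_vector_derivative
            fy (slice_emb I (Complex x y))) (at y) \<and>
        (1/2) *\<^sub>R (fx (slice_emb I (Complex x y)) + I * fy (slice_emb I (Complex x y))) = 0))"

definition slice_regular_on :: "quat set \<Rightarrow> (quat \<Rightarrow> quat) \<Rightarrow> bool" where
  "slice_regular_on \<Omega> f \<longleftrightarrow>
    openin slice_topology \<Omega> \<and> (\<forall>I\<in>\<S>. slice_holomorphic_on I (\<Omega> \<inter> slice_plane I) f)"


section \<open>Riemann slice-domains\<close>

text \<open>A slice-domain with distinguished point \<open>(G, \<pi>, x)\<close> is encoded as a triple whose first
  component is the topology of \<open>G\<close> (with carrier \<open>topspace G\<close>); the values of \<open>\<pi>\<close>, and of functions
  on \<open>G\<close>, outside \<open>topspace G\<close> are irrelevant.\<close>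

type_synonym 'a pointed = "'a topology \<times> ('a \<Rightarrow> quat) \<times> 'a"

definition slice_domain :: "'a topology \<Rightarrow> ('a \<Rightarrow> quat) \<Rightarrow> bool" where
  "slice_domain G \<pi> \<longleftrightarrow>
    connected_space G \<and> Hausdorff_space G \<and>
    (\<forall>p\<in>topspace G. \<exists>U. openin G U \<and> p \<in> U \<and> openin slice_topology (\<pi> ` U) \<and>
      homeomorphic_map (subtopology G U) (subtopology slice_topology (\<pi> ` U)) \<pi>)"

fun pointed_slice_domain :: "'a pointed \<Rightarrow> bool" where
  "pointed_slice_domain (G, \<pi>, x) \<longleftrightarrow> slice_domain G \<pi> \<and> x \<in> topspace G"

fun slice_regular :: "'a pointed \<Rightarrow> ('a \<Rightarrow> quat) \<Rightarrow> bool" where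
  "slice_regular (G, \<pi>, x) f \<longleftrightarrow>
    (\<forall>p\<in>topspace G. \<exists>U. openin G U \<and> p \<in> U \<and> openin slice_topology (\<pi> ` U) \<and>
      homeomorphic_map (subtopology G U) (subtopology slice_topology (\<pi> ` U)) \<pi> \<and>
      slice_regular_on (\<pi> ` U) (f \<circ> inv_into U \<pi>))"

fun fiber_preserving :: "'a pointed \<Rightarrow> 'b pointed \<Rightarrow> ('a \<Rightarrow> 'b) \<Rightarrow> bool" where
  "fiber_preserving (G1, \<pi>1, x1) (G2, \<pi>2, x2) \<phi> \<longleftrightarrow>
    continuous_map G1 G2 \<phi> \<and> (\<forall>p\<in>topspace G1. \<pi>2 (\<phi> p) = \<pi>1 p) \<and> \<phi> x1 = x2"

definition dominated :: "'a pointed \<Rightarrow> 'b pointed \<Rightarrow> bool" (infix "\<preceq>\<^sub>s" 50) where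
  "\<G>1 \<preceq>\<^sub>s \<G>2 \<longleftrightarrow> (\<exists>\<phi>. fiber_preserving \<G>1 \<G>2 \<phi>)"

definition upper_bound :: "'a pointed set \<Rightarrow> 'a pointed \<Rightarrow> bool" where
  "upper_bound \<F> \<U> \<longleftrightarrow> pointed_slice_domain \<U> \<and> (\<forall>\<L>\<in>\<F>. \<L> \<preceq>\<^sub>s \<U>)"

definition is_union :: "'a pointed set \<Rightarrow> 'a pointed \<Rightarrow> bool" where
  "is_union \<F> \<U> \<longleftrightarrow> upper_bound \<F> \<U> \<and> (\<forall>\<U>'. upper_bound \<F> \<U>' \<longrightarrow> \<U> \<preceq>\<^sub>s \<U>')"

definition extendible :: "'a pointed \<Rightarrow> ('a \<Rightarrow> quat) \<Rightarrow> 'b pointed \<Rightarrow> bool" where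
  "extendible \<G> f \<G>' \<longleftrightarrow>
    pointed_slice_domain \<G>' \<and>
    (\<exists>\<phi> F. fiber_preserving \<G> \<G>' \<phi> \<and> slice_regular \<G>' F \<and>
      (\<forall>p\<in>topspace (fst \<G>). F (\<phi> p) = f p))"

text \<open>All slice-domains below have carriers in one and the same type \<open>'a\<close>. This loses no
  generality: a nonempty slice-domain contains a copy of a nonempty slice-open set, hence has at
  least continuum many points, and as it is path-connected with unique lifting of paths, it has at
  most continuum many. So as soon as \<open>'a\<close> carries one pointed slice-domain, every pointed
  slice-domain over the quaternions is isomorphic to one with carrier in \<open>'a\<close>.\<close>

definition domain_of_existence :: "'a pointed \<Rightarrow> ('a \<Rightarrow> quat) \<Rightarrow> 'a pointed \<Rightarrow> bool" where
  "domain_of_existence \<G> f \<U> \<longleftrightarrow> is_union {\<L>. extendible \<G> f \<L>} \<U>"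

definition domain_of_regularity :: "'a pointed \<Rightarrow> bool" where
  "domain_of_regularity \<G> \<longleftrightarrow>
    pointed_slice_domain \<G> \<and> (\<exists>f. slice_regular \<G> f \<and> domain_of_existence \<G> f \<G>)"


section \<open>Finite-part paths\<close>

text \<open>An \<open>N\<close>-tuple of paths is a list of length \<open>N\<close> of functions of which only the values on
  \<open>{0..1}\<close> matter.\<close>

definition joined_in :: "'b set \<Rightarrow> (real \<Rightarrow> 'b) list \<Rightarrow> bool" where
  "joined_in R \<gamma> \<longleftrightarrow>
    (\<forall>i. Suc i < length \<gamma> \<longrightarrow> (\<gamma> ! i) 1 = (\<gamma> ! Suc i) 0 \<and> (\<gamma> ! i) 1 \<in> R)"

definition complex_part_path :: "nat \<Rightarrow> (real \<Rightarrow> complex) list \<Rightarrow> bool" where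
  "complex_part_path N \<gamma> \<longleftrightarrow> length \<gamma> = N \<and> (\<forall>c\<in>set \<gamma>. path c) \<and> joined_in \<real> \<gamma>"

definition slice_preserving :: "(real \<Rightarrow> quat) \<Rightarrow> bool" where
  "slice_preserving \<delta> \<longleftrightarrow>
    pathin slice_topology \<delta> \<and> (\<exists>I\<in>\<S>. \<delta> ` {0..1} \<subseteq> slice_plane I)"

definition quat_part_path :: "nat \<Rightarrow> (real \<Rightarrow> quat) list \<Rightarrow> bool" where
  "quat_part_path N \<delta> \<longleftrightarrow> length \<delta> = N \<and> (\<forall>c\<in>set \<delta>. slice_preserving c) \<and> joined_in \<real> \<delta>"

fun domain_part_path :: "'a pointed \<Rightarrow> nat \<Rightarrow> (real \<Rightarrow> 'a) list \<Rightarrow> bool" where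
  "domain_part_path (G, \<pi>, x) N \<alpha> \<longleftrightarrow>
    length \<alpha> = N \<and> (\<forall>c\<in>set \<alpha>. pathin G c \<and> slice_preserving (\<pi> \<circ> c)) \<and>
    joined_in {p \<in> topspace G. \<pi> p \<in> \<real>} \<alpha>"

definition initial_point :: "(real \<Rightarrow> 'b) list \<Rightarrow> 'b" where
  "initial_point \<gamma> = hd \<gamma> 0"

definition end_point :: "(real \<Rightarrow> 'b) list \<Rightarrow> 'b" where
  "end_point \<gamma> = last \<gamma> 1"

definition slice_paths :: "(real \<Rightarrow> complex) list \<Rightarrow> quat vec \<Rightarrow> (real \<Rightarrow> quat) list" where
  "slice_paths \<gamma> I = map (\<lambda>k. slice_emb (vec_index I k) \<circ> (\<gamma> ! k)) [0..<length \<gamma>]"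

fun is_lift :: "'a pointed \<Rightarrow> (real \<Rightarrow> quat) list \<Rightarrow> (real \<Rightarrow> 'a) list \<Rightarrow> bool" where
  "is_lift (G, \<pi>, x) \<delta> \<alpha> \<longleftrightarrow>
    domain_part_path (G, \<pi>, x) (length \<delta>) \<alpha> \<and> initial_point \<alpha> = x \<and>
    (\<forall>k<length \<delta>. \<forall>t\<in>{0..1}. \<pi> ((\<alpha> ! k) t) = (\<delta> ! k) t)"

definition contained_in :: "(real \<Rightarrow> quat) list \<Rightarrow> 'a pointed \<Rightarrow> bool" (infix "\<prec>\<^sub>p" 50) where
  "\<delta> \<prec>\<^sub>p \<G> \<longleftrightarrow> quat_part_path (length \<delta>) \<delta> \<and> (\<exists>\<alpha>. is_lift \<G> \<delta> \<alpha>)"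

text \<open>The lift is unique only up to its values outside \<open>{0..1}\<close>, so it is picked by choice.\<close>

definition path_lift :: "'a pointed \<Rightarrow> (real \<Rightarrow> quat) list \<Rightarrow> (real \<Rightarrow> 'a) list" where
  "path_lift \<G> \<delta> = (SOME \<alpha>. is_lift \<G> \<delta> \<alpha>)"


section \<open>Slice-rank\<close>

text \<open>Vectors and matrices are indexed from \<open>0\<close>: \<open>I\<^sub>k\<close> is entry \<open>k - 1\<close> of the vector \<open>I\<close>.\<close>

definition unit_entry :: "quat vec \<Rightarrow> nat \<Rightarrow> quat" where
  "unit_entry I k = (if k = 0 then 1 else vec_index I (k - 1))"

text \<open>For \<open>k \<ge> 1\<close>, the number \<open>(m - 1) div 2 ^ (k - 1) mod 2\<close> is the binary digit \<open>m\<^sub>k\<close> of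
  \<open>m - 1 = (m\<^sub>N \<dots> m\<^sub>1)\<^sub>2\<close>; the factors are multiplied in order of decreasing \<open>k\<close>.\<close>

definition unit_word :: "quat vec \<Rightarrow> nat \<Rightarrow> quat" where
  "unit_word I m = prod_list
    (map (\<lambda>k. (unit_entry I k * unit_entry I (k - 1)) ^ ((m - 1) div 2 ^ (k - 1) mod 2))
      (rev [1..<Suc (dim_vec I)]))"

definition \<zeta> :: "quat vec \<Rightarrow> quat vec" where
  "\<zeta> I = Matrix.vec (2 ^ dim_vec I) (\<lambda>j. unit_word I (Suc j))"

definition zeta_matrix :: "quat mat \<Rightarrow> quat mat" where
  "zeta_matrix K = mat_of_rows (2 ^ dim_col K) (map \<zeta> (Matrix.rows K))"

definition upper_left :: "quat mat \<Rightarrow> nat \<Rightarrow> quat mat" where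
  "upper_left J l = Matrix.mat (2 ^ l) l (\<lambda>(i, j). J $$ (i, j))"

definition full_slice_rank :: "quat mat \<Rightarrow> bool" where
  "full_slice_rank J \<longleftrightarrow> (\<forall>l\<in>{1..dim_col J}. invertible_mat (zeta_matrix (upper_left J l)))"

definition mat_inv :: "quat mat \<Rightarrow> quat mat" where
  "mat_inv A = (THE B. inverts_mat A B \<and> inverts_mat B A)"

definition unit_vecs_of :: "nat \<Rightarrow> quat vec set" where
  "unit_vecs_of N = {K \<in> carrier_vec N. \<forall>k<N. vec_index K k \<in> \<S>}"

definition unit_mats :: "nat \<Rightarrow> nat \<Rightarrow> quat mat set" where
  "unit_mats m n = {J \<in> carrier_mat m n. elements_mat J \<subseteq> \<S>}"

end

theory Submission
  imports Defs "HOL-Complex_Analysis.Complex_Analysis"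
begin

text \<open>
  If \<open>G\<close> is the domain of existence of \<open>f\<close>, then every path of germs of slice regular functions that
  starts at a germ of \<open>f\<close> lifts to \<open>G\<close>: the germs of \<open>f\<close> together with small connected neighbourhoods
  of the germs on the path form an extendible slice-domain, which \<open>G\<close> therefore dominates. The new
  points can be named by elements of the carrier type of \<open>G\<close>, because there are at most continuum
  many of them. So it suffices to continue \<open>f\<close> analytically along \<open>\<gamma>\<^sup>K\<close>, which is done one part at a
  time: along the part \<open>n\<close>, the continuation is \<open>\<zeta>(K) \<M>(J)\<^sup>-\<^sup>1 F(z)\<close>, where \<open>F\<close> is the vector of the
  values of \<open>f\<close> near \<open>\<gamma>\<^sup>J\<close>. It is holomorphic on the slice of \<open>K\<^sub>n\<close>, it extends to the other slices
  by the representation formula, and at the real initial point of the part it agrees with \<open>f\<close> on a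
  real interval by the formula for the previous part, hence as a germ.
\<close>

section \<open>Slices and holomorphy\<close>

text \<open>A formula for the values at the joints would not pass to the next part, because
  continuation needs germs. So the induction over the parts proves an identity near the end point,
  \<open>f = zeta(K) c(z)\<close>, whose coefficient vector \<open>c\<close> is the same for all K.
  This uniformity closes the induction. Applied to the rows of J, the identity says that the lifts
  along these rows start the next part with the vector \<open>F = M c'\<close> on a real interval;
  therefore \<open>zeta(K) M^-1 F = zeta(K) c'\<close>, which is f at the joint of K. Here
  \<open>c'\<close> is \<open>c\<close> padded with zeros: one more unit doubles the number of
  words, but the old words keep their indices. The matrix M at level n is built from the first
  \<open>2^n\<close> rows of J cut to n units, which explains why invertibility is asked for every
  upper-left block and not only for J. The slices meet only in the real axis, so agreement passes
  between them only there. A slice-open set around a real point need not contain discs of one common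
  radius in all slices; agreement is therefore spread over slice-connected slice-open sets, not over
  balls.\<close>

lemma imag_units_iff: "I \<in> \<S> \<longleftrightarrow> qRe I = 0 \<and> (qI I)\<^sup>2 + (qJ I)\<^sup>2 + (qK I)\<^sup>2 = 1"
proof -
  obtain a b c d where I: "I = Quat a b c d" by (cases I)
  have "a = 0" if "a\<^sup>2 - b\<^sup>2 - c\<^sup>2 - d\<^sup>2 = -1" "a * b = 0" "a * c = 0" "a * d = 0"
  proof (rule ccontr)
    assume "a \<noteq> 0"
    with that have "a\<^sup>2 = -1" by simp
    then show False using zero_le_power2[of a] by linarith
  qed
  then show ?thesis by (auto simp: I imag_units_def Quat_square quat_eq_iff)
qed

lemma imag_unit_square: "I \<in> \<S> \<Longrightarrow> I * I = -1"
  by (simp add: imag_units_def power2_eq_square)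

lemma imag_unit_square_left: "I \<in> \<S> \<Longrightarrow> I * (I * q) = - q"
  by (simp add: imag_unit_square mult.assoc[symmetric])

lemma inner_imag_unit: assumes "I \<in> \<S>" shows "inner I I = 1" "inner 1 I = 0"
  using assms by (simp_all add: imag_units_iff inner_quat_def power2_eq_square)

lemma exists_imag_unit: obtains I where "I \<in> \<S>"
  using quat_in_slice_plane by blast

lemma quat_of_real_simps [simp]:
  "qRe (of_real x) = x" "qI (of_real x) = 0" "qJ (of_real x) = 0" "qK (of_real x) = 0"
  by (simp_all add: of_real_def)

lemma of_real_mult_quat: "of_real x * q = x *\<^sub>R (q :: quat)"
  by (simp add: scaleR_conv_of_real)

lemma slice_emb_of_real [simp]: "slice_emb I (of_real x) = of_real x"
  by (simp add: slice_emb_def)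

lemma slice_emb_uminus: "slice_emb (- I) z = slice_emb I (cnj z)"
  by (simp add: slice_emb_def)

lemma continuous_on_slice_emb [continuous_intros]:
  "continuous_on A f \<Longrightarrow> continuous_on A (\<lambda>x. slice_emb I (f x))"
  unfolding slice_emb_def by (intro continuous_intros)

text \<open>As 1 and I are orthonormal, inner products recover the coordinates on the slice. The
  formula makes sense on all quaternions, so continuity is immediate.\<close>

definition slice_coord :: "quat \<Rightarrow> quat \<Rightarrow> complex" where
  "slice_coord I q = Complex (inner 1 q) (inner I q)"

lemma slice_coord_slice_emb: assumes "I \<in> \<S>" shows "slice_coord I (slice_emb I z) = z"
  using inner_imag_unit[OF assms] inner_imag_unit(2)[OF assms, unfolded inner_commute[of 1]]
  by (simp add: slice_coord_def slice_emb_def inner_add_right of_real_mult_quat complex_eq_iff)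
     (simp add: of_real_def dot_square_norm)

lemma slice_emb_slice_coord: "I \<in> \<S> \<Longrightarrow> q \<in> slice_plane I \<Longrightarrow> slice_emb I (slice_coord I q) = q"
  unfolding slice_plane_def by (auto simp: slice_coord_slice_emb)

lemma continuous_on_slice_coord: "continuous_on A (slice_coord I)"
  unfolding slice_coord_def Complex_eq by (intro continuous_intros)

lemma slice_emb_in_slice_plane [simp]: "slice_emb I z \<in> slice_plane I"
  by (simp add: slice_plane_def)

lemma quat_slice_cases: obtains I z where "I \<in> \<S>" "q = slice_emb I z"
  using quat_in_slice_plane[of q] by (auto simp: slice_plane_def)

lemma qRe_slice_emb: "I \<in> \<S> \<Longrightarrow> qRe (slice_emb I z) = Re z"
  by (simp add: slice_emb_def imag_units_iff)

text \<open>Comparing imaginary parts and norms gives equal or opposite \<open>Im z\<close>. So a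
  point has only the double name \<open>x + y L = x + (-y) (-L)\<close>, unless it is real and lies
  on every slice. Well-definedness questions about slices reduce to these cases.\<close>

lemma slice_emb_eqD:
  assumes L: "L \<in> \<S>" "L' \<in> \<S>" and eq: "slice_emb L z = slice_emb L' z'"
  shows "z = z' \<and> (Im z = 0 \<or> L = L') \<or> z' = cnj z \<and> L' = - L"
proof -
  have re: "Re z = Re z'" using eq by (metis L qRe_slice_emb)
  then have "of_real (Im z) * L = of_real (Im z') * L'"
    using eq by (simp add: slice_emb_def)
  then have im: "Im z *\<^sub>R L = Im z' *\<^sub>R L'" by (simp add: scaleR_conv_of_real)
  have "norm L = 1" "norm L' = 1"
    using inner_imag_unit(1) L by (simp_all add: norm_eq_1)
  then have "\<bar>Im z\<bar> = \<bar>Im z'\<bar>" using arg_cong[OF im, of norm] by simp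
  then consider "Im z = 0" "Im z' = 0" | "Im z \<noteq> 0" "Im z' = Im z" | "Im z \<noteq> 0" "Im z' = - Im z"
    by linarith
  then show ?thesis
  proof cases
    case 3
    then have "Im z *\<^sub>R L = Im z *\<^sub>R (- L')" using im by simp
    then have "L = - L'" using 3 by (metis real_vector.scale_cancel_left)
    with 3 re show ?thesis by (auto simp: complex_eq_iff)
  qed (use re im in \<open>auto simp: complex_eq_iff\<close>)
qed

lemma slice_emb_eq_iff: "L \<in> \<S> \<Longrightarrow> slice_emb L z = slice_emb L z' \<longleftrightarrow> z = z'"
  by (metis slice_coord_slice_emb)

lemma slice_emb_Reals_iff: "L \<in> \<S> \<Longrightarrow> slice_emb L z \<in> \<real> \<longleftrightarrow> z \<in> \<real>"
proof
  assume L: "L \<in> \<S>" and "slice_emb L z \<in> \<real>"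
  then obtain r where "slice_emb L z = slice_emb L (of_real r)"
    by (metis Reals_cases slice_emb_of_real)
  then show "z \<in> \<real>" using slice_emb_eq_iff[OF L] by (metis Reals_of_real)
qed (auto elim!: Reals_cases)

text \<open>\<open>slice_emb I\<close> is a homeomorphism onto the slice with inverse
  \<open>slice_coord I\<close>. From here on openness is checked in the complex plane, one
  coordinate for all slices.\<close>

lemma openin_slice_iff: "openin slice_topology U \<longleftrightarrow> (\<forall>I\<in>\<S>. open (slice_emb I -` U))"
proof -
  have "openin (top_of_set (slice_plane I)) (U \<inter> slice_plane I) \<longleftrightarrow> open (slice_emb I -` U)"
    if I: "I \<in> \<S>" for I
  proof
    assume "openin (top_of_set (slice_plane I)) (U \<inter> slice_plane I)"
    then obtain T where "open T" "U \<inter> slice_plane I = slice_plane I \<inter> T"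
      by (auto simp: openin_open)
    then have "slice_emb I -` U = slice_emb I -` T" using slice_emb_in_slice_plane[of I] by blast
    then show "open (slice_emb I -` U)"
      using \<open>open T\<close> open_vimage[OF \<open>open T\<close>] continuous_on_slice_emb[OF continuous_on_id] by metis
  next
    assume "open (slice_emb I -` U)"
    then have "openin (top_of_set (slice_plane I)) (slice_plane I \<inter> slice_coord I -` (slice_emb I -` U))"
      by (rule continuous_openin_preimage_gen[OF continuous_on_slice_coord])
    also have "slice_plane I \<inter> slice_coord I -` (slice_emb I -` U) = U \<inter> slice_plane I"
      using slice_emb_slice_coord[OF I] by auto
    finally show "openin (top_of_set (slice_plane I)) (U \<inter> slice_plane I)" .
  qed
  then show ?thesis by (simp add: openin_slice_topology)
qed

lemma continuous_map_slice_emb: "I \<in> \<S> \<Longrightarrow> continuous_map euclidean slice_topology (slice_emb I)"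
  by (auto simp: continuous_map_def openin_slice_iff vimage_def)

lemma open_imp_openin_slice: "open U \<Longrightarrow> openin slice_topology U"
  unfolding openin_slice_iff using open_vimage continuous_on_slice_emb[OF continuous_on_id] by blast

section \<open>Cauchy-Riemann functions in one complex coordinate\<close>

definition CR_on :: "quat \<Rightarrow> complex set \<Rightarrow> (complex \<Rightarrow> quat) \<Rightarrow> bool" where
  "CR_on I D g \<longleftrightarrow> open D \<and> (\<exists>gx gy. continuous_on D gx \<and> continuous_on D gy \<and>
    (\<forall>z\<in>D. ((\<lambda>t. g (Complex t (Im z))) has_vector_derivative gx z) (at (Re z)) \<and>
           ((\<lambda>t. g (Complex (Re z) t)) has_vector_derivative gy z) (at (Im z)) \<and>
           gx z + I * gy z = 0))"

lemma CR_onI: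
  assumes "open D" "continuous_on D gx" "continuous_on D gy"
    "\<And>z. z \<in> D \<Longrightarrow> ((\<lambda>t. g (Complex t (Im z))) has_vector_derivative gx z) (at (Re z))"
    "\<And>z. z \<in> D \<Longrightarrow> ((\<lambda>t. g (Complex (Re z) t)) has_vector_derivative gy z) (at (Im z))"
    "\<And>z. z \<in> D \<Longrightarrow> gx z + I * gy z = 0"
  shows "CR_on I D g"
  using assms unfolding CR_on_def by blast

text \<open>Partial derivatives that depend neither on the domain nor on the witnesses in
  \<open>CR_on\<close>, so that they fit together on a union of two domains.\<close>

definition pdx :: "(complex \<Rightarrow> quat) \<Rightarrow> complex \<Rightarrow> quat" where
  "pdx g z = vector_derivative (\<lambda>t. g (Complex t (Im z))) (at (Re z))"

definition pdy :: "(complex \<Rightarrow> quat) \<Rightarrow> complex \<Rightarrow> quat" where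
  "pdy g z = vector_derivative (\<lambda>t. g (Complex (Re z) t)) (at (Im z))"

lemma CR_onD:
  assumes "CR_on I D g"
  shows "open D" "continuous_on D (pdx g)" "continuous_on D (pdy g)"
    "\<And>z. z \<in> D \<Longrightarrow> ((\<lambda>t. g (Complex t (Im z))) has_vector_derivative pdx g z) (at (Re z))"
    "\<And>z. z \<in> D \<Longrightarrow> ((\<lambda>t. g (Complex (Re z) t)) has_vector_derivative pdy g z) (at (Im z))"
    "\<And>z. z \<in> D \<Longrightarrow> pdx g z + I * pdy g z = 0"
proof -
  obtain hx hy where h: "open D" "continuous_on D hx" "continuous_on D hy"
    "\<And>z. z \<in> D \<Longrightarrow> ((\<lambda>t. g (Complex t (Im z))) has_vector_derivative hx z) (at (Re z))"
    "\<And>z. z \<in> D \<Longrightarrow> ((\<lambda>t. g (Complex (Re z) t)) has_vector_derivative hy z) (at (Im z))"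
    "\<And>z. z \<in> D \<Longrightarrow> hx z + I * hy z = 0" using assms unfolding CR_on_def by blast
  have eq: "pdx g z = hx z" "pdy g z = hy z" if "z \<in> D" for z
    using vector_derivative_at h(4,5)[OF that] by (auto simp: pdx_def pdy_def)
  show "open D" "continuous_on D (pdx g)" "continuous_on D (pdy g)"
    using h(1) continuous_on_eq[OF h(2) eq(1)[symmetric]] continuous_on_eq[OF h(3) eq(2)[symmetric]] by simp_all
  fix z assume z: "z \<in> D"
  show "((\<lambda>t. g (Complex t (Im z))) has_vector_derivative pdx g z) (at (Re z))"
    "((\<lambda>t. g (Complex (Re z) t)) has_vector_derivative pdy g z) (at (Im z))"
    "pdx g z + I * pdy g z = 0"
    using h(4-6)[OF z] by (simp_all add: eq[OF z])
qed

lemma CR_on_open: "CR_on I D g \<Longrightarrow> open D"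
  by (simp add: CR_on_def)

lemma slice_holomorphic_on_iff:
  assumes I: "I \<in> \<S>" and W: "W \<subseteq> slice_plane I"
    and op: "openin (top_of_set (slice_plane I)) W" "open (slice_emb I -` W)"
  shows "slice_holomorphic_on I W f \<longleftrightarrow> CR_on I (slice_emb I -` W) (f \<circ> slice_emb I)"
proof
  assume "slice_holomorphic_on I W f"
  then obtain fx fy where c: "continuous_on W fx" "continuous_on W fy" and
    d: "\<And>x y. slice_emb I (Complex x y) \<in> W \<Longrightarrow>
        ((\<lambda>t. f (slice_emb I (Complex t y))) has_vector_derivative
            fx (slice_emb I (Complex x y))) (at x) \<and>
        ((\<lambda>t. f (slice_emb I (Complex x t))) has_vector_derivative
            fy (slice_emb I (Complex x y))) (at y) \<and>
        (1/2) *\<^sub>R (fx (slice_emb I (Complex x y)) + I * fy (slice_emb I (Complex x y))) = 0"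
    unfolding slice_holomorphic_on_def by blast
  show "CR_on I (slice_emb I -` W) (f \<circ> slice_emb I)"
    by (rule CR_onI[where gx = "\<lambda>z. fx (slice_emb I z)" and gy = "\<lambda>z. fy (slice_emb I z)"])
      (use d[of "Re z" "Im z" for z] in \<open>auto intro!: op(2) continuous_on_compose2[OF c(1)]
        continuous_on_compose2[OF c(2)] continuous_on_slice_emb continuous_on_id\<close>)
next
  assume "CR_on I (slice_emb I -` W) (f \<circ> slice_emb I)"
  note c = CR_onD(2,3)[OF this] and d = CR_onD(4-6)[OF this]
  let ?gx = "pdx (f \<circ> slice_emb I)" and ?gy = "pdy (f \<circ> slice_emb I)"
  have sub: "slice_coord I ` W \<subseteq> slice_emb I -` W"
    using W slice_emb_slice_coord[OF I] by auto
  have "continuous_on W (?gx \<circ> slice_coord I)" "continuous_on W (?gy \<circ> slice_coord I)"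
    using sub c by (auto simp: comp_def intro!: continuous_on_compose2[OF _ continuous_on_slice_coord])
  moreover have "\<And>x y. slice_emb I (Complex x y) \<in> W \<Longrightarrow>
        ((\<lambda>t. f (slice_emb I (Complex t y))) has_vector_derivative
            (?gx \<circ> slice_coord I) (slice_emb I (Complex x y))) (at x) \<and>
        ((\<lambda>t. f (slice_emb I (Complex x t))) has_vector_derivative
            (?gy \<circ> slice_coord I) (slice_emb I (Complex x y))) (at y) \<and>
        (1/2) *\<^sub>R ((?gx \<circ> slice_coord I) (slice_emb I (Complex x y)) + I * (?gy \<circ> slice_coord I) (slice_emb I (Complex x y))) = 0"
    using d[of "Complex _ _"] by (auto simp: slice_coord_slice_emb[OF I] comp_def)
  ultimately show "slice_holomorphic_on I W f"
    unfolding slice_holomorphic_on_def using op(1) by blast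
qed

lemma slice_regular_on_iff:
  "slice_regular_on \<Omega> f \<longleftrightarrow> openin slice_topology \<Omega> \<and> (\<forall>I\<in>\<S>. CR_on I (slice_emb I -` \<Omega>) (f \<circ> slice_emb I))"
proof -
  have "slice_holomorphic_on I (\<Omega> \<inter> slice_plane I) f \<longleftrightarrow> CR_on I (slice_emb I -` \<Omega>) (f \<circ> slice_emb I)"
    if "openin slice_topology \<Omega>" "I \<in> \<S>" for I
  proof -
    have "slice_emb I -` (\<Omega> \<inter> slice_plane I) = slice_emb I -` \<Omega>" by auto
    then show ?thesis
      using slice_holomorphic_on_iff[OF that(2), of "\<Omega> \<inter> slice_plane I" f] that
      by (simp add: openin_slice_iff openin_slice_topology[THEN iffD1, rule_format])
  qed
  then show ?thesis by (auto simp: slice_regular_on_def)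
qed

lemma Complex_section_open:
  assumes "open D" "z \<in> D"
  shows "eventually (\<lambda>t. Complex t (Im z) \<in> D) (nhds (Re z))"
    "eventually (\<lambda>t. Complex (Re z) t \<in> D) (nhds (Im z))"
proof -
  have "continuous_on UNIV (\<lambda>t. Complex t (Im z))" "continuous_on UNIV (\<lambda>t. Complex (Re z) t)"
    unfolding Complex_eq by (intro continuous_intros)+
  then have op: "open ((\<lambda>t. Complex t (Im z)) -` D)" "open ((\<lambda>t. Complex (Re z) t) -` D)"
    using open_vimage[OF assms(1)] by blast+
  show "eventually (\<lambda>t. Complex t (Im z) \<in> D) (nhds (Re z))"
    "eventually (\<lambda>t. Complex (Re z) t \<in> D) (nhds (Im z))"
    using eventually_nhds_in_open[OF op(1), of "Re z"] eventually_nhds_in_open[OF op(2), of "Im z"] assms(2)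
    by simp_all
qed

lemma CR_on_subset: "CR_on I D g \<Longrightarrow> open D' \<Longrightarrow> D' \<subseteq> D \<Longrightarrow> CR_on I D' g"
  unfolding CR_on_def by (meson continuous_on_subset subsetD)

lemma CR_on_cong:
  assumes "CR_on I D g" and eq: "\<And>z. z \<in> D \<Longrightarrow> g z = h z"
  shows "CR_on I D h"
proof -
  note D = CR_onD(1)[OF assms(1)] and c = CR_onD(2,3)[OF assms(1)] and d = CR_onD(4,5)[OF assms(1)] and e = CR_onD(6)[OF assms(1)]
  have "((\<lambda>t. h (Complex t (Im z))) has_vector_derivative pdx g z) (at (Re z))"
    "((\<lambda>t. h (Complex (Re z) t)) has_vector_derivative pdy g z) (at (Im z))" if z: "z \<in> D" for z
    using has_vector_derivative_cong_ev[where S = UNIV and x = "Re z" and f = "\<lambda>t. g (Complex t (Im z))" and g = "\<lambda>t. h (Complex t (Im z))"]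
      has_vector_derivative_cong_ev[where S = UNIV and x = "Im z" and f = "\<lambda>t. g (Complex (Re z) t)" and g = "\<lambda>t. h (Complex (Re z) t)"]
      d[OF z] eq z eventually_mono[OF Complex_section_open(1)[OF D z]]
      eventually_mono[OF Complex_section_open(2)[OF D z]]
    by (simp_all add: complex.collapse eventually_mono)
  then show ?thesis by (intro CR_onI[OF D c _ _ e])
qed

lemma CR_on_diff:
  assumes "CR_on I D g" "CR_on I D h" shows "CR_on I D (\<lambda>z. g z - h z)"
proof -
  note g = CR_onD[OF assms(1)] and h = CR_onD(2-6)[OF assms(2)]
  show ?thesis
  proof (rule CR_onI[where gx = "\<lambda>z. pdx g z - pdx h z" and gy = "\<lambda>z. pdy g z - pdy h z"])
    fix z assume z: "z \<in> D"
    show "pdx g z - pdx h z + I * (pdy g z - pdy h z) = 0"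
      using arg_cong2[OF g(6)[OF z] h(5)[OF z], of minus] by (simp add: algebra_simps)
  qed (use g h in \<open>auto intro!: continuous_intros has_vector_derivative_diff\<close>)
qed

text \<open>Multiplying the equation of \<open>F i\<close> by \<open>a i\<close> from the left and
  moving the unit across with \<open>a i * u i = I * a i\<close> gives the equation for I. The
  summands may come from different slices; this is why all of them are read in the same complex
  coordinate.\<close>

lemma CR_on_intertwined_sum:
  assumes "finite A" "open D" and F: "\<And>i. i \<in> A \<Longrightarrow> CR_on (u i) D (F i)"
    and tw: "\<And>i. i \<in> A \<Longrightarrow> a i * u i = I * a i"
  shows "CR_on I D (\<lambda>z. \<Sum>i\<in>A. a i * F i z)"
proof -
  note c = CR_onD(2,3)[OF F] and d = CR_onD(4,5)[OF F] and e = CR_onD(6)[OF F]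
  show ?thesis
  proof (rule CR_onI[where gx = "\<lambda>z. \<Sum>i\<in>A. a i * pdx (F i) z" and gy = "\<lambda>z. \<Sum>i\<in>A. a i * pdy (F i) z"])
    fix z assume z: "z \<in> D"
    have "a i * pdx (F i) z + I * (a i * pdy (F i) z) = 0" if "i \<in> A" for i
    proof -
      have "a i * (pdx (F i) z + u i * pdy (F i) z) = 0" using e[OF that z] by simp
      then show ?thesis using tw[OF that] by (simp add: distrib_left mult.assoc[symmetric])
    qed
    then have "(\<Sum>i\<in>A. a i * pdx (F i) z + I * (a i * pdy (F i) z)) = 0" by (intro sum.neutral ballI)
    then show "(\<Sum>i\<in>A. a i * pdx (F i) z) + I * (\<Sum>i\<in>A. a i * pdy (F i) z) = 0"
      by (simp add: sum.distrib sum_distrib_left)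
    show "((\<lambda>t. \<Sum>i\<in>A. a i * F i (Complex t (Im z))) has_vector_derivative (\<Sum>i\<in>A. a i * pdx (F i) z)) (at (Re z))"
      "((\<lambda>t. \<Sum>i\<in>A. a i * F i (Complex (Re z) t)) has_vector_derivative (\<Sum>i\<in>A. a i * pdy (F i) z)) (at (Im z))"
      using d z by (auto intro!: has_vector_derivative_sum has_vector_derivative_mult_right)
  qed (use assms(2) c in \<open>auto intro!: continuous_intros\<close>)
qed

text \<open>One partial derivative at the point together with a continuous other one gives the total
  derivative. The criterion wants a product neighbourhood with convex second factor, hence the box
  inside D.\<close>

lemma CR_on_has_derivative:
  assumes "open D" "continuous_on D gy" "z \<in> D"
    and gx: "((\<lambda>t. g (Complex t (Im z))) has_vector_derivative gx) (at (Re z))"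
    and gy: "\<And>z. z \<in> D \<Longrightarrow> ((\<lambda>t. g (Complex (Re z) t)) has_vector_derivative gy z) (at (Im z))"
  shows "(g has_derivative (\<lambda>h. Re h *\<^sub>R gx + Im h *\<^sub>R (gy z :: quat))) (at z)"
proof -
  have cC: "continuous_on UNIV (\<lambda>p. Complex (fst p) (snd p))"
    unfolding Complex_eq by (intro continuous_intros)
  let ?P = "(\<lambda>p. Complex (fst p) (snd p)) -` D"
  have "open ?P" using open_vimage[OF \<open>open D\<close> cC] .
  moreover have "(Re z, Im z) \<in> ?P" using \<open>z \<in> D\<close> by simp
  ultimately obtain X Y0 where XY0: "open X" "open Y0" "(Re z, Im z) \<in> X \<times> Y0" "X \<times> Y0 \<subseteq> ?P"
    by (rule open_prod_elim)
  then obtain e where e: "e > 0" "ball (Im z) e \<subseteq> Y0" by (auto elim: openE)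
  define Y where "Y = ball (Im z) e"
  have XY: "open X" "open Y" "Re z \<in> X" "Im z \<in> Y" "convex Y" "X \<times> Y \<subseteq> ?P"
    using XY0 e unfolding Y_def by auto
  have "((\<lambda>(x, y). g (Complex x y)) has_derivative
      (\<lambda>(tx, ty). tx *\<^sub>R gx + blinfun_apply (blinfun_scaleR_left (gy (Complex (Re z) (Im z)))) ty)) (at (Re z, Im z) within X \<times> Y)"
  proof (rule has_derivative_partialsI[where fx = "\<lambda>tx. tx *\<^sub>R gx" and fy = "\<lambda>x y. blinfun_scaleR_left (gy (Complex x y))"])
    show "((\<lambda>x. g (Complex x (Im z))) has_derivative (\<lambda>tx. tx *\<^sub>R gx)) (at (Re z) within X)"
      using gx unfolding has_vector_derivative_def by (rule has_derivative_at_withinI)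
    fix x y assume "x \<in> X" "y \<in> Y"
    then have "Complex x y \<in> D" using XY by auto
    from gy[OF this]
    show "((\<lambda>y. g (Complex x y)) has_derivative blinfun_apply (blinfun_scaleR_left (gy (Complex x y)))) (at y within Y)"
      unfolding has_vector_derivative_def by (simp add: has_derivative_at_withinI)
  next
    have "continuous_on ?P (\<lambda>p. gy (Complex (fst p) (snd p)))"
      by (rule continuous_on_compose2[OF assms(2) continuous_on_subset[OF cC]]) auto
    then have "continuous_on (X \<times> Y) (\<lambda>(x, y). blinfun_scaleR_left (gy (Complex x y)))"
      unfolding case_prod_beta
      using XY by (intro bounded_linear.continuous_on[OF bounded_linear_blinfun_scaleR_left]) (auto intro: continuous_on_subset)
    then show "continuous (at (Re z, Im z) within X \<times> Y) (\<lambda>(x, y). blinfun_scaleR_left (gy (Complex x y)))"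
      using XY by (simp add: continuous_on_eq_continuous_within)
  qed (use XY in auto)
  then have "((\<lambda>(x, y). g (Complex x y)) has_derivative
      (\<lambda>(tx, ty). tx *\<^sub>R gx + ty *\<^sub>R gy z)) (at (Re z, Im z))"
    using XY by (simp add: at_within_open[OF _ open_Times])
  moreover have "((\<lambda>w. (Re w, Im w)) has_derivative (\<lambda>h. (Re h, Im h))) (at z)"
    by (intro derivative_intros has_derivative_ident)
  ultimately have "((\<lambda>w. (\<lambda>(x, y). g (Complex x y)) (Re w, Im w)) has_derivative
      (\<lambda>h. (\<lambda>(tx, ty). tx *\<^sub>R gx + ty *\<^sub>R gy z) (Re h, Im h))) (at z)"
    using has_derivative_compose by blast
  then show ?thesis by simp
qed

text \<open>For a fixed \<open>w\<close> the functional \<open>q \<mapsto> \<langle>w, q\<rangle> - i \<langle>w, I q\<rangle>\<close> turns left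
  multiplication by \<open>I\<close> into multiplication by \<open>i\<close>, hence \<open>g\<close> into a holomorphic function.\<close>

lemma CR_on_identity:
  assumes I: "I \<in> \<S>" and g: "CR_on I D g" and D: "connected D" and U: "U \<subseteq> D" "\<xi> \<in> D" "\<xi> islimpt U"
    and zero: "\<And>z. z \<in> U \<Longrightarrow> g z = 0" and z: "z \<in> D"
  shows "g z = 0"
proof -
  note g = CR_onD[OF g]
  let ?gx = "pdx g" and ?gy = "pdy g"
  define l where "l w q = Complex (inner w q) (- inner w (I * q))" for w q
  have bl: "bounded_linear (l w)" for w
  proof -
    have inner: "bounded_linear (\<lambda>q. complex_of_real (inner w (f q)))" if "bounded_linear f" for f :: "quat \<Rightarrow> quat"
      by (rule bounded_linear_compose[OF bounded_linear_of_real bounded_linear_compose[OF bounded_linear_inner_right that]])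
    have "bounded_linear (\<lambda>q. complex_of_real (inner w q) + \<i> * - complex_of_real (inner w (I * q)))"
      by (rule bounded_linear_add[OF inner[OF bounded_linear_ident]
            bounded_linear_const_mult[OF bounded_linear_minus[OF inner[OF bounded_linear_mult_right]]]])
    moreover have "l w = (\<lambda>q. complex_of_real (inner w q) + \<i> * - complex_of_real (inner w (I * q)))"
      by (rule ext) (simp add: l_def Complex_eq)
    ultimately show ?thesis by simp
  qed
  have lI: "l w (I * q) = \<i> * l w q" for w q
    by (simp add: l_def imag_unit_square_left[OF I] complex_eq_iff)
  have hol: "(\<lambda>z. l w (g z)) holomorphic_on D" for w
  proof -
    interpret l: bounded_linear "l w" by (rule bl)
    have "((\<lambda>z. l w (g z)) has_field_derivative (- \<i> * l w (?gy z))) (at z)" if z: "z \<in> D" for z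
    proof -
      have "(g has_derivative (\<lambda>h. Re h *\<^sub>R ?gx z + Im h *\<^sub>R ?gy z)) (at z)"
        using CR_on_has_derivative g z by blast
      then have "((\<lambda>z. l w (g z)) has_derivative (\<lambda>h. l w (Re h *\<^sub>R ?gx z + Im h *\<^sub>R ?gy z))) (at z)"
        by (rule l.has_derivative)
      moreover have "l w (Re h *\<^sub>R ?gx z + Im h *\<^sub>R ?gy z) = (- \<i> * l w (?gy z)) * h" for h
      proof -
        \<comment> \<open>With the Cauchy-Riemann equation the real differential becomes
          multiplication by one complex number.\<close>
        have gxz: "?gx z = - (I * ?gy z)" using g(6)[OF z] by (simp add: eq_neg_iff_add_eq_0)
        show ?thesis unfolding gxz l.add l.scaleR l.neg lI by (simp add: complex_eq_iff algebra_simps)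
      qed
      ultimately show ?thesis unfolding has_field_derivative_def by (simp only:)
    qed
    then show ?thesis using g(1) holomorphic_on_open by blast
  qed
  \<comment> \<open>The functional is chosen after the point: for \<open>w = g z\<close> the real
    part of \<open>l w (g z)\<close> is the squared norm of \<open>g z\<close>.\<close>
  have "l (g z) (g z) = 0"
    by (rule analytic_continuation[OF hol g(1) D U _ z]) (simp add: zero l_def complex_eq_iff)
  then show ?thesis by (simp add: l_def complex_eq_iff)
qed

section \<open>Extension and identity principles for slice regular functions\<close>

text \<open>I and -I span the same slice with conjugate coordinates: the sign that the chain rule
  puts on the y-derivative cancels the sign of the unit.\<close>

lemma CR_on_cnj:
  assumes "CR_on I D g" shows "CR_on (- I) (cnj -` D) (\<lambda>z. g (cnj z))"
proof -
  note g = CR_onD[OF assms]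
  show ?thesis
  proof (rule CR_onI[where gx = "\<lambda>z. pdx g (cnj z)" and gy = "\<lambda>z. - pdy g (cnj z)"])
    show "open (cnj -` D)" using g(1) by (intro open_vimage continuous_intros) auto
    show "continuous_on (cnj -` D) (\<lambda>z. pdx g (cnj z))" "continuous_on (cnj -` D) (\<lambda>z. - pdy g (cnj z))"
      by (auto intro!: continuous_intros continuous_on_compose2[OF g(2)] continuous_on_compose2[OF g(3)])
  next
    fix z assume "z \<in> cnj -` D"
    then have z: "cnj z \<in> D" by simp
    show "((\<lambda>t. g (cnj (Complex t (Im z)))) has_vector_derivative pdx g (cnj z)) (at (Re z))"
      using g(4)[OF z] by (simp add: cnj.code)
    show "pdx g (cnj z) + - I * - pdy g (cnj z) = 0" using g(6)[OF z] by simp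
    have "((\<lambda>t. - t) has_vector_derivative - 1) (at (Im z))"
      by (auto intro!: derivative_eq_intros)
    from vector_diff_chain_at[OF this, of "\<lambda>t. g (Complex (Re z) t)" "pdy g (cnj z)"] g(5)[OF z]
    show "((\<lambda>t. g (cnj (Complex (Re z) t))) has_vector_derivative - pdy g (cnj z)) (at (Im z))"
      by (simp add: cnj.code comp_def)
  qed
qed

lemma CR_on_Un:
  assumes "CR_on I D g" "CR_on I D' g" shows "CR_on I (D \<union> D') g"
proof -
  note * = CR_onD[OF assms(1)] CR_onD[OF assms(2)]
  show ?thesis
    by (rule CR_onI[where gx = "pdx g" and gy = "pdy g"]) (use * in \<open>auto intro: continuous_on_open_Un\<close>)
qed

text \<open>The extension is given by the representation formula
  \<open>h (x + y L) = (g z + g \<bar>z) / 2 + L I (g \<bar>z - g z) / 2\<close> with \<open>z = x + i y\<close>.\<close>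

lemma slice_extension:
  assumes I: "I \<in> \<S>" and g: "CR_on I D g" and sym: "\<And>z. z \<in> D \<Longrightarrow> cnj z \<in> D"
  shows "\<exists>W h. slice_regular_on W h \<and> (\<forall>z\<in>D. slice_emb I z \<in> W \<and> h (slice_emb I z) = g z)"
proof -
  \<comment> \<open>These coefficients sum to 1 over b, and they intertwine I (for
    \<open>True\<close>) and -I (for \<open>False\<close>) with L. The corresponding functions are
    \<open>g\<close>, holomorphic for I, and \<open>g\<close> after conjugation, holomorphic for
    -I.\<close>
  define a where "a L b = (1/2) *\<^sub>R (if b then 1 - L * I else 1 + L * I)" for L b
  define E where "E L z = (\<Sum>b\<in>UNIV. a L b * (if b then g z else g (cnj z)))" for L z
  have E: "E L z = a L True * g z + a L False * g (cnj z)" for L z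
    by (simp add: E_def UNIV_bool)
  define W where "W = {slice_emb L z | L z. L \<in> \<S> \<and> z \<in> D}"
  define h where "h q = (let (L, z) = SOME (L, z). L \<in> \<S> \<and> slice_emb L z = q in E L z)" for q
  \<comment> \<open>\<open>h\<close> picks an arbitrary name of a point, so the formula must agree
    on all of them: at a real point both values of g coincide and the coefficients sum to 1;
    otherwise replacing L by -L exchanges the two summands.\<close>
  have E_indep: "E L z = E L' z'" if "L \<in> \<S>" "L' \<in> \<S>" "slice_emb L z = slice_emb L' z'" for L L' z z'
  proof -
    have "a M True * w + a M False * w = w" for M w
    proof -
      have "a M True + a M False = 1" by (simp add: a_def quat_eq_iff field_simps)
      then show ?thesis by (metis distrib_right mult_1)
    qed
    moreover have "cnj z = z" if "Im z = 0" using that by (simp add: complex_eq_iff)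
    ultimately have "Im z = 0 \<Longrightarrow> E L z = E L' z" unfolding E by simp
    moreover have "E L z = E (- L) (cnj z)" by (simp add: E a_def)
    ultimately show ?thesis using slice_emb_eqD[OF that] by auto
  qed
  have h: "h (slice_emb L z) = E L z" if L: "L \<in> \<S>" for L z
  proof -
    have "case (SOME (L', z'). L' \<in> \<S> \<and> slice_emb L' z' = slice_emb L z) of
        (L', z') \<Rightarrow> L' \<in> \<S> \<and> slice_emb L' z' = slice_emb L z"
      by (rule someI[of _ "(L, z)"]) (simp add: L)
    moreover obtain L' z' where p: "(SOME (L', z'). L' \<in> \<S> \<and> slice_emb L' z' = slice_emb L z) = (L', z')"
      by (rule prod.exhaust)
    ultimately have "L' \<in> \<S>" "slice_emb L' z' = slice_emb L z" by simp_all
    then show ?thesis unfolding h_def p using E_indep[OF _ L] by simp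
  qed
  \<comment> \<open>By the symmetry of D, the set W has the same preimage D in every slice.\<close>
  have W: "slice_emb L -` W = D" if L: "L \<in> \<S>" for L
  proof (intro equalityI subsetI)
    fix z assume "z \<in> slice_emb L -` W"
    then obtain M w where M: "M \<in> \<S>" "w \<in> D" "slice_emb M w = slice_emb L z" by (auto simp: W_def)
    then show "z \<in> D" using slice_emb_eqD[OF M(1) L M(3)] sym by auto
  qed (use L in \<open>auto simp: W_def\<close>)
  have "cnj -` D = D"
  proof (intro equalityI subsetI)
    fix z assume "z \<in> cnj -` D"
    then show "z \<in> D" using sym[of "cnj z"] by simp
  qed (simp add: sym)
  then have gc: "CR_on (- I) D (\<lambda>z. g (cnj z))" using CR_on_cnj[OF g] by simp
  have tw: "a L b * (if b then I else - I) = L * a L b" if L: "L \<in> \<S>" for L b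
    using imag_unit_square[OF I] imag_unit_square_left[OF L]
    by (simp add: a_def algebra_simps mult.assoc)
  have "CR_on L D (E L)" if L: "L \<in> \<S>" for L
    unfolding E_def
    by (rule CR_on_intertwined_sum[where u = "\<lambda>b. if b then I else - I", OF _ CR_on_open[OF g] _ tw[OF L]])
       (use g gc in auto)
  then have "slice_regular_on W h"
    unfolding slice_regular_on_iff openin_slice_iff
    using W CR_on_open[OF g] h by (auto simp: comp_def)
  moreover have "slice_emb I z \<in> W" if "z \<in> D" for z
    using that I by (auto simp: W_def)
  moreover have "h (slice_emb I z) = g z" for z
    unfolding h[OF I] E by (simp add: a_def imag_unit_square[OF I])
  ultimately show ?thesis by blast
qed

text \<open>Locally the symmetry required by \<open>slice_extension\<close> can be arranged: a disc
  with real centre is symmetric, and a disc of radius at most \<open>\<bar>Im z\<bar>\<close> is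
  disjoint from its mirror image, on which g may be replaced by 0.\<close>

lemma CR_on_ball_slice_extension:
  assumes I: "I \<in> \<S>" and g: "CR_on I D g" and z: "z \<in> D"
  obtains W h e where "slice_regular_on W h" "e > 0" "\<And>w. w \<in> ball z e \<Longrightarrow> slice_emb I w \<in> W"
    "\<And>w. w \<in> ball z e \<Longrightarrow> h (slice_emb I w) = g w"
proof (cases "Im z = 0")
  case True
  obtain e where e: "e > 0" "ball z e \<subseteq> D" using CR_on_open[OF g] z by (auto elim: openE)
  have c: "CR_on I (ball z e) g" using CR_on_subset[OF g] e by simp
  have s: "cnj w \<in> ball z e" if "w \<in> ball z e" for w
  proof -
    have "cnj z = z" using True by (simp add: complex_eq_iff)
    then have "dist z (cnj w) = dist z w" by (metis complex_cnj_diff complex_mod_cnj dist_norm)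
    with that show ?thesis by simp
  qed
  obtain W h where "slice_regular_on W h" "\<forall>w\<in>ball z e. slice_emb I w \<in> W \<and> h (slice_emb I w) = g w"
    using slice_extension[OF I c s] by blast
  with e(1) show ?thesis by (intro that[of W h e]) auto
next
  case False
  obtain e0 where e0: "e0 > 0" "ball z e0 \<subseteq> D" using CR_on_open[OF g] z by (auto elim: openE)
  define e where "e = min e0 \<bar>Im z\<bar>"
  have e: "e > 0" "ball z e \<subseteq> D" using e0 False by (auto simp: e_def)
  have sgn: "sgn (Im w) = sgn (Im z)" if "w \<in> ball z e" for w
  proof -
    have "\<bar>Im z - Im w\<bar> < \<bar>Im z\<bar>"
      using abs_Im_le_cmod[of "z - w"] that by (simp add: e_def dist_norm)
    then show ?thesis by (auto simp: sgn_if abs_if split: if_splits)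
  qed
  define D1 where "D1 = ball z e"
  define D' where "D' = D1 \<union> cnj -` D1"
  define g' where "g' w = (if w \<in> D1 then g w else 0)" for w
  have D1: "open D1" "CR_on I D1 g" using CR_on_subset[OF g _ e(2)] by (auto simp: D1_def)
  have oc: "open (cnj -` D1)" using D1(1) by (intro open_vimage continuous_intros) auto
  have disj: "w \<notin> D1" if "w \<in> cnj -` D1" for w
    using sgn[of w] sgn[of "cnj w"] that False by (auto simp: D1_def sgn_if split: if_splits)
  have g'1: "CR_on I D1 g'" by (rule CR_on_cong[OF D1(2)]) (simp add: g'_def)
  have "CR_on I (cnj -` D1) (\<lambda>w. 0)"
    using oc by (intro CR_onI[where gx = "\<lambda>_. 0" and gy = "\<lambda>_. 0"]) (auto intro!: derivative_eq_intros)
  then have g'2: "CR_on I (cnj -` D1) g'"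
    by (rule CR_on_cong) (use disj in \<open>simp add: g'_def\<close>)
  have c: "CR_on I D' g'" unfolding D'_def by (rule CR_on_Un[OF g'1 g'2])
  have s: "cnj w \<in> D'" if "w \<in> D'" for w using that by (auto simp: D'_def)
  obtain W h where "slice_regular_on W h" "\<forall>w\<in>D'. slice_emb I w \<in> W \<and> h (slice_emb I w) = g' w"
    using slice_extension[OF I c s] by blast
  then show ?thesis
    by (intro that[of W h e] e) (auto simp: D'_def D1_def g'_def)
qed

section \<open>Identity principle in the slice topology\<close>

lemma slice_regular_on_subset:
  "slice_regular_on W h \<Longrightarrow> openin slice_topology V \<Longrightarrow> V \<subseteq> W \<Longrightarrow> slice_regular_on V h"
  unfolding slice_regular_on_iff openin_slice_iff by (meson CR_on_subset vimage_mono)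

lemma slice_regular_on_cong:
  "slice_regular_on W h \<Longrightarrow> (\<And>q. q \<in> W \<Longrightarrow> h q = h' q) \<Longrightarrow> slice_regular_on W h'"
  unfolding slice_regular_on_iff using CR_on_cong by fastforce

lemma slice_regular_on_openin: "slice_regular_on W h \<Longrightarrow> openin slice_topology W"
  by (simp add: slice_regular_on_def)

text \<open>Local connectedness. A disc in one slice is not slice-open when it meets the real axis,
  so V is the whole component of q in W. It is slice-open because a disc in a slice inside W is
  connected and thus stays in the component of its centre.\<close>

lemma slice_connected_nbhd:
  assumes W: "openin slice_topology W" and q: "q \<in> W"
  obtains V where "openin slice_topology V" "q \<in> V" "V \<subseteq> W" "connectedin slice_topology V"
proof -
  let ?X = "subtopology slice_topology W"
  let ?V = "connected_component_of_set ?X q"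
  have con: "connectedin ?X ?V" by (rule connectedin_connected_component_of)
  then have V: "?V \<subseteq> W" "connectedin slice_topology ?V"
    by (auto simp: connectedin_subtopology)
  have "open (slice_emb L -` ?V)" if L: "L \<in> \<S>" for L
  proof (rule Topological_Spaces.openI)
    fix z assume z: "z \<in> slice_emb L -` ?V"
    then have "z \<in> slice_emb L -` W" using V by auto
    moreover have "open (slice_emb L -` W)" using W L by (simp add: openin_slice_iff)
    ultimately obtain e where e: "e > 0" "ball z e \<subseteq> slice_emb L -` W" by (auto elim: openE)
    have "connectedin slice_topology (slice_emb L ` ball z e)"
      by (rule connectedin_continuous_map_image[OF continuous_map_slice_emb[OF L]])
         (simp add: connected_ball)
    then have "connectedin ?X (slice_emb L ` ball z e)"
      using e by (auto simp: connectedin_subtopology)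
    then have "slice_emb L ` ball z e \<subseteq> connected_component_of_set ?X (slice_emb L z)"
      using e by (intro connected_component_of_maximal) auto
    moreover have "connected_component_of_set ?X (slice_emb L z) = ?V"
      using z q V(1) connected_component_of_eq[of ?X q "slice_emb L z"] by auto
    ultimately show "\<exists>T. open T \<and> z \<in> T \<and> T \<subseteq> slice_emb L -` ?V"
      using e by (intro exI[of _ "ball z e"]) auto
  qed
  then have "openin slice_topology ?V" by (simp add: openin_slice_iff)
  moreover have "q \<in> ?V" using q by (simp add: connected_component_of_refl)
  ultimately show ?thesis using that V by blast
qed

text \<open>A real interval lies in every slice and accumulates at x, so the one-variable identity
  theorem applies in the slice of L.\<close>

lemma slice_regular_eventually_eqI:
  assumes "slice_regular_on V h1" "slice_regular_on V h2" and L: "L \<in> \<S>" and V: "of_real x \<in> V"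
    and ev: "eventually (\<lambda>s. h1 (of_real s) = h2 (of_real s)) (nhds x)"
  shows "eventually (\<lambda>w. h1 (slice_emb L w) = h2 (slice_emb L w)) (nhds (of_real x))"
proof -
  have CR: "CR_on L (slice_emb L -` V) (\<lambda>w. h1 (slice_emb L w) - h2 (slice_emb L w))"
    using assms(1,2) L unfolding slice_regular_on_iff comp_def by (intro CR_on_diff) auto
  have "of_real x \<in> slice_emb L -` V" using V by simp
  then obtain e1 where e1: "e1 > 0" "ball (of_real x) e1 \<subseteq> slice_emb L -` V"
    using CR_on_open[OF CR] by (meson openE)
  obtain e2 where e2: "e2 > 0" "\<And>s. dist s x < e2 \<Longrightarrow> h1 (of_real s) = h2 (of_real s)"
    using ev by (auto simp: eventually_nhds_metric)
  define e where "e = min e1 e2"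
  have e: "e > 0" using e1 e2 by (simp add: e_def)
  have "complex_of_real x islimpt of_real ` ball x e"
    unfolding islimpt_approachable
  proof (intro allI impI)
    fix d :: real assume "d > 0"
    then show "\<exists>y\<in>complex_of_real ` ball x e. y \<noteq> of_real x \<and> dist y (of_real x) < d"
      using e by (intro bexI[of _ "of_real (x + min d e / 2)"] imageI)
        (auto simp: dist_real_def simp flip: of_real_add)
  qed
  moreover have "ball (of_real x) e \<subseteq> slice_emb L -` V" using e1(2) by (auto simp: e_def)
  moreover have "of_real ` ball x e \<subseteq> ball (complex_of_real x) e" by auto
  moreover have "h1 (slice_emb L w) - h2 (slice_emb L w) = 0" if "w \<in> of_real ` ball x e" for w
    using that e2(2) by (auto simp: e_def dist_commute)
  ultimately have "h1 (slice_emb L w) - h2 (slice_emb L w) = 0" if "w \<in> ball (of_real x) e" for w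
    using CR_on_identity[OF L CR_on_subset[OF CR open_ball] connected_ball] e that
    by (metis (no_types, lifting) centre_in_ball)
  then show ?thesis
    using e by (auto simp: eventually_nhds_metric dist_commute intro!: exI[of _ e])
qed

text \<open>Agreement near a point is tested inside one slice. Two names of a nonreal point differ
  by conjugation; at a real point the passage from one slice to another goes through the real
  axis.\<close>

lemma slice_regular_eventually_eq_transfer:
  assumes h: "slice_regular_on V h1" "slice_regular_on V h2" and L: "L \<in> \<S>" "L' \<in> \<S>"
    and V: "slice_emb L z \<in> V" and eq: "slice_emb L z = slice_emb L' z'"
    and ev: "eventually (\<lambda>w. h1 (slice_emb L w) = h2 (slice_emb L w)) (nhds z)"
  shows "eventually (\<lambda>w. h1 (slice_emb L' w) = h2 (slice_emb L' w)) (nhds z')"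
proof -
  consider "z = z'" "L = L'" | "z' = cnj z" "L' = - L" | "z = z'" "Im z = 0"
    using slice_emb_eqD[OF L eq] by auto
  then show ?thesis
  proof cases
    case 2
    have "filterlim cnj (nhds z) (nhds (cnj z))"
      using tendsto_cnj[OF filterlim_ident, of "cnj z"] by simp
    from filterlim_iff[THEN iffD1, rule_format, OF this ev]
    show ?thesis using 2 by (simp add: slice_emb_uminus)
  next
    case 3
    then have z: "z = of_real (Re z)" by (simp add: complex_eq_iff)
    have "filterlim complex_of_real (nhds (of_real (Re z))) (nhds (Re z))"
      using tendsto_of_real[OF filterlim_ident, of "Re z", where 'a = complex] by simp
    from filterlim_iff[THEN iffD1, rule_format, OF this, of "\<lambda>w. h1 (slice_emb L w) = h2 (slice_emb L w)"] ev
    have "eventually (\<lambda>s. h1 (of_real s) = h2 (of_real s)) (nhds (Re z))" using z by (metis (mono_tags, lifting) eventually_mono slice_emb_of_real)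
    moreover have "of_real (Re z) \<in> V" using V by (subst (asm) z) simp
    ultimately show ?thesis
      using slice_regular_eventually_eqI[OF h L(2)] 3 z by metis
  qed (use ev in simp)
qed

text \<open>The set A of points near which both functions agree within a slice is clopen in V. The
  transfer lemma makes membership independent of the slice, so both openness claims can be checked
  slice by slice: A is open by its definition, and if agreement held near one point of a disc, the
  identity theorem would carry it to the centre.\<close>

lemma slice_identity:
  assumes h: "slice_regular_on V h1" "slice_regular_on V h2" and con: "connectedin slice_topology V"
    and L: "L \<in> \<S>" and V: "slice_emb L z \<in> V"
    and ev: "eventually (\<lambda>w. h1 (slice_emb L w) = h2 (slice_emb L w)) (nhds z)" and q: "q \<in> V"
  shows "h1 q = h2 q"
proof -
  define P where "P M w \<longleftrightarrow> eventually (\<lambda>w. h1 (slice_emb M w) = h2 (slice_emb M w)) (nhds w)" for M w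
  define A where "A = {slice_emb M w | M w. M \<in> \<S> \<and> slice_emb M w \<in> V \<and> P M w}"
  have A: "slice_emb M w \<in> A \<longleftrightarrow> slice_emb M w \<in> V \<and> P M w" if "M \<in> \<S>" for M w
    unfolding A_def P_def using slice_regular_eventually_eq_transfer[OF h] that by fastforce
  have opV: "open (slice_emb M -` V)" if "M \<in> \<S>" for M
    using slice_regular_on_openin[OF h(1)] that by (simp add: openin_slice_iff)
  have oA: "openin slice_topology A"
    unfolding openin_slice_iff
  proof (intro ballI)
    fix M assume M: "M \<in> \<S>"
    have "open {w. P M w}"
      unfolding P_def open_subopen[of "{w. _ w}"] using eventually_nhds by (smt (verit, ccfv_threshold) mem_Collect_eq subsetI)
    then have "open (slice_emb M -` V \<inter> {w. P M w})" using opV[OF M] by blast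
    moreover have "slice_emb M -` A = slice_emb M -` V \<inter> {w. P M w}" using A[OF M] by auto
    ultimately show "open (slice_emb M -` A)" by simp
  qed
  have oB: "openin slice_topology (V - A)"
    unfolding openin_slice_iff
  proof (intro ballI Topological_Spaces.openI)
    fix M w assume M: "M \<in> \<S>" and "w \<in> slice_emb M -` (V - A)"
    then have w: "slice_emb M w \<in> V" "\<not> P M w" using A[OF M] by auto
    then obtain e where e: "e > 0" "ball w e \<subseteq> slice_emb M -` V" using opV[OF M] by (auto elim: openE)
    have CR: "CR_on M (slice_emb M -` V) (\<lambda>w. h1 (slice_emb M w) - h2 (slice_emb M w))"
      using h M unfolding slice_regular_on_iff comp_def by (intro CR_on_diff) auto
    have "\<not> P M v" if v: "v \<in> ball w e" for v
    proof
      assume "P M v"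
      then obtain d where d: "d > 0" "\<And>u. dist u v < d \<Longrightarrow> h1 (slice_emb M u) = h2 (slice_emb M u)"
        by (auto simp: P_def eventually_nhds_metric)
      have "v islimpt (ball v d \<inter> ball w e)"
        using v d(1) by (intro interior_limit_point) auto
      moreover have "h1 (slice_emb M u) - h2 (slice_emb M u) = 0" if "u \<in> ball v d \<inter> ball w e" for u
        using d(2)[of u] that by (simp add: dist_commute)
      ultimately have "h1 (slice_emb M u) - h2 (slice_emb M u) = 0" if "u \<in> ball w e" for u
        using CR_on_identity[OF M CR_on_subset[OF CR open_ball e(2)] connected_ball Int_lower2 v] that
        by blast
      then have "P M w" unfolding P_def eventually_nhds_metric
        using e(1) by (auto simp: dist_commute intro!: exI[of _ e])
      with w show False by simp
    qed
    then show "\<exists>T. open T \<and> w \<in> T \<and> T \<subseteq> slice_emb M -` (V - A)"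
      using e A[OF M] by (intro exI[of _ "ball w e"]) auto
  qed
  have "A \<inter> V \<noteq> {}" using A[OF L] V ev unfolding P_def by blast
  then have "(V - A) \<inter> V = {}"
    using con oA oB unfolding connectedin by (metis (no_types, lifting) Diff_disjoint Int_Diff Int_commute Un_Diff_cancel inf_bot_left sup_ge2)
  then have "q \<in> A" using q by auto
  then show ?thesis unfolding A_def P_def by (auto dest: eventually_nhds_x_imp_x)
qed

lemma slice_regular_germ_eq:
  assumes "slice_regular_on W1 h1" "slice_regular_on W2 h2" and L: "L \<in> \<S>"
    and "slice_emb L z \<in> W1" "slice_emb L z \<in> W2"
    and ev: "eventually (\<lambda>w. h1 (slice_emb L w) = h2 (slice_emb L w)) (nhds z)"
  obtains V where "openin slice_topology V" "slice_emb L z \<in> V" "V \<subseteq> W1" "V \<subseteq> W2"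
    "\<And>q. q \<in> V \<Longrightarrow> h1 q = h2 q"
proof -
  have "openin slice_topology (W1 \<inter> W2)" using assms slice_regular_on_openin by blast
  then obtain V where V: "openin slice_topology V" "slice_emb L z \<in> V" "V \<subseteq> W1 \<inter> W2" "connectedin slice_topology V"
    using slice_connected_nbhd assms by (metis IntI)
  then have "slice_regular_on V h1" "slice_regular_on V h2"
    using assms slice_regular_on_subset by blast+
  then show ?thesis using slice_identity[OF _ _ V(4) L V(2) ev] that V by blast
qed

section \<open>Germs of slice regular functions\<close>

text \<open>The class consists of arbitrary functions; regularity enters only with the carrier of
  \<open>germ_topology\<close>. The base point is stored so that \<open>fst\<close> is the
  projection.\<close>

definition germ :: "quat \<Rightarrow> (quat \<Rightarrow> quat) \<Rightarrow> quat \<times> (quat \<Rightarrow> quat) set" where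
  "germ q h = (q, {h'. \<exists>W. openin slice_topology W \<and> q \<in> W \<and> (\<forall>w\<in>W. h' w = h w)})"

definition germ_value :: "quat \<times> (quat \<Rightarrow> quat) set \<Rightarrow> quat" where
  "germ_value e = (SOME h. h \<in> snd e) (fst e)"

text \<open>This is the etale space of the sheaf of slice regular functions.\<close>

definition germ_topology :: "(quat \<times> (quat \<Rightarrow> quat) set) topology" where
  "germ_topology = topology (\<lambda>U. U \<subseteq> {germ q h | q h W. slice_regular_on W h \<and> q \<in> W} \<and>
    (\<forall>q h. germ q h \<in> U \<longrightarrow> (\<exists>W. openin slice_topology W \<and> q \<in> W \<and> (\<forall>w\<in>W. germ w h \<in> U))))"

lemma fst_germ [simp]: "fst (germ q h) = q"
  by (simp add: germ_def)

lemma germ_eqI: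
  assumes "openin slice_topology W" "q \<in> W" "\<And>w. w \<in> W \<Longrightarrow> h w = h' w"
  shows "germ q h = germ q h'"
proof -
  have sub: "snd (germ q f) \<subseteq> snd (germ q f')" if "\<And>w. w \<in> W \<Longrightarrow> f w = f' w" for f f'
  proof
    fix g assume "g \<in> snd (germ q f)"
    then obtain V where "openin slice_topology V" "q \<in> V" "\<forall>w\<in>V. g w = f w" by (auto simp: germ_def)
    then show "g \<in> snd (germ q f')"
      using assms that by (auto simp: germ_def intro!: exI[of _ "V \<inter> W"])
  qed
  have "snd (germ q h) = snd (germ q h')" using sub[of h h'] sub[of h' h] assms(3) by auto
  then show ?thesis by (simp add: prod_eq_iff)
qed

lemma germ_eqE:
  assumes "germ q h = germ q' h'"
  obtains W where "openin slice_topology W" "q \<in> W" "q' = q" "\<And>w. w \<in> W \<Longrightarrow> h w = h' w"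
proof -
  have "openin slice_topology UNIV" by (metis openin_topspace topspace_slice_topology)
  then have "h \<in> snd (germ q h)" by (auto simp: germ_def)
  then have "h \<in> snd (germ q' h')" using assms by simp
  moreover have "q' = q" using assms by (metis fst_germ)
  ultimately show ?thesis using that by (auto simp: germ_def)
qed

lemma germ_value_germ [simp]: "germ_value (germ q h) = h q"
proof -
  have "openin slice_topology UNIV" by (metis openin_topspace topspace_slice_topology)
  then have "h \<in> snd (germ q h)" by (auto simp: germ_def)
  then have "(SOME h'. h' \<in> snd (germ q h)) \<in> snd (germ q h)" by (metis someI)
  then show ?thesis by (auto simp: germ_value_def germ_def)
qed

lemma openin_germ_topology:
  "openin germ_topology U \<longleftrightarrow> U \<subseteq> {germ q h | q h W. slice_regular_on W h \<and> q \<in> W} \<and>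
    (\<forall>q h. germ q h \<in> U \<longrightarrow> (\<exists>W. openin slice_topology W \<and> q \<in> W \<and> (\<forall>w\<in>W. germ w h \<in> U)))"
proof -
  have "istopology (\<lambda>U. U \<subseteq> {germ q h | q h W. slice_regular_on W h \<and> q \<in> W} \<and>
    (\<forall>q h. germ q h \<in> U \<longrightarrow> (\<exists>W. openin slice_topology W \<and> q \<in> W \<and> (\<forall>w\<in>W. germ w h \<in> U))))"
    (is "istopology (\<lambda>U. U \<subseteq> ?R \<and> ?P U)")
    unfolding istopology_def
  proof (intro conjI allI impI)
    fix S T q h
    assume "S \<subseteq> ?R \<and> ?P S" "T \<subseteq> ?R \<and> ?P T" and "germ q h \<in> S \<inter> T"
    then obtain V W where "openin slice_topology V" "q \<in> V" "\<forall>w\<in>V. germ w h \<in> S"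
      "openin slice_topology W" "q \<in> W" "\<forall>w\<in>W. germ w h \<in> T" by blast
    then show "\<exists>W. openin slice_topology W \<and> q \<in> W \<and> (\<forall>w\<in>W. germ w h \<in> S \<inter> T)"
      by (intro exI[of _ "V \<inter> W"]) auto
  next
    fix \<U> q h assume "\<forall>U\<in>\<U>. U \<subseteq> ?R \<and> ?P U" "germ q h \<in> \<Union>\<U>"
    then show "\<exists>W. openin slice_topology W \<and> q \<in> W \<and> (\<forall>w\<in>W. germ w h \<in> \<Union>\<U>)"
      by (meson UnionE UnionI)
  qed blast+
  then show ?thesis by (simp add: germ_topology_def topology_inverse')
qed

lemma openin_germ_sheet:
  assumes "slice_regular_on V h" shows "openin germ_topology ((\<lambda>w. germ w h) ` V)"
  unfolding openin_germ_topology
proof (intro conjI allI impI)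
  show "(\<lambda>w. germ w h) ` V \<subseteq> {germ q h |q h W. slice_regular_on W h \<and> q \<in> W}"
    using assms by blast
  fix q h' assume "germ q h' \<in> (\<lambda>w. germ w h) ` V"
  then obtain w where "w \<in> V" "germ q h' = germ w h" by auto
  then obtain W where W: "openin slice_topology W" "q \<in> W" "q \<in> V" "\<And>w. w \<in> W \<Longrightarrow> h' w = h w"
    by (metis germ_eqE)
  have "germ w h' = germ w h" if "w \<in> W" for w
    using germ_eqI[OF W(1) that] W(4) by blast
  then show "\<exists>W. openin slice_topology W \<and> q \<in> W \<and> (\<forall>w\<in>W. germ w h' \<in> (\<lambda>w. germ w h) ` V)"
    using W slice_regular_on_openin[OF assms] by (intro exI[of _ "W \<inter> V"]) auto
qed

lemma topspace_germ_topology: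
  "topspace germ_topology = {germ q h | q h W. slice_regular_on W h \<and> q \<in> W}"
proof
  show "topspace germ_topology \<subseteq> {germ q h | q h W. slice_regular_on W h \<and> q \<in> W}"
    using openin_germ_topology openin_topspace by blast
next
  show "{germ q h | q h W. slice_regular_on W h \<and> q \<in> W} \<subseteq> topspace germ_topology"
    using openin_germ_sheet[THEN openin_subset] by fastforce
qed

lemma germ_in_topspace: "slice_regular_on W h \<Longrightarrow> q \<in> W \<Longrightarrow> germ q h \<in> topspace germ_topology"
  unfolding topspace_germ_topology by blast

lemma germ_topspaceE:
  assumes "e \<in> topspace germ_topology"
  obtains q h W where "slice_regular_on W h" "q \<in> W" "e = germ q h"
  using assms unfolding topspace_germ_topology by blast

lemma openin_germ_preimage:
  assumes "openin germ_topology U" shows "openin slice_topology {w. germ w h \<in> U}"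
proof (subst openin_subopen, intro ballI)
  fix q assume "q \<in> {w. germ w h \<in> U}"
  then obtain W where "openin slice_topology W" "q \<in> W" "\<forall>w\<in>W. germ w h \<in> U"
    using assms unfolding openin_germ_topology by blast
  then show "\<exists>T. openin slice_topology T \<and> q \<in> T \<and> T \<subseteq> {w. germ w h \<in> U}"
    by blast
qed

lemma continuous_map_germ:
  assumes "slice_regular_on V h"
  shows "continuous_map (subtopology slice_topology V) germ_topology (\<lambda>w. germ w h)"
proof -
  have "openin (subtopology slice_topology V) {w \<in> V. germ w h \<in> U}" if "openin germ_topology U" for U
    using openin_germ_preimage[OF that, of h] by (auto simp: openin_subtopology intro!: exI)
  then show ?thesis using germ_in_topspace[OF assms] by (auto simp: continuous_map_def)
qed

lemma continuous_map_fst_germ: "continuous_map germ_topology slice_topology fst"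
proof -
  have "openin germ_topology {e \<in> topspace germ_topology. fst e \<in> U}" if U: "openin slice_topology U" for U
  proof (subst openin_subopen, intro ballI)
    fix e assume e: "e \<in> {e \<in> topspace germ_topology. fst e \<in> U}"
    then obtain q h W where q: "slice_regular_on W h" "q \<in> W" "e = germ q h" by (auto elim: germ_topspaceE)
    have reg: "slice_regular_on (W \<inter> U) h"
      using slice_regular_on_subset[OF q(1)] U slice_regular_on_openin[OF q(1)] by blast
    show "\<exists>T. openin germ_topology T \<and> e \<in> T \<and> T \<subseteq> {e \<in> topspace germ_topology. fst e \<in> U}"
      using openin_germ_sheet[OF reg] germ_in_topspace[OF reg] q e by (intro exI[of _ "(\<lambda>w. germ w h) ` (W \<inter> U)"]) auto
  qed
  then show ?thesis by (auto simp: continuous_map_def)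
qed

lemma homeomorphic_maps_germ:
  assumes V: "slice_regular_on V h"
  shows "homeomorphic_maps (subtopology germ_topology ((\<lambda>w. germ w h) ` V)) (subtopology slice_topology V)
    fst (\<lambda>w. germ w h)"
  unfolding homeomorphic_maps_def
proof (intro conjI ballI)
  show "continuous_map (subtopology germ_topology ((\<lambda>w. germ w h) ` V)) (subtopology slice_topology V) fst"
    using continuous_map_from_subtopology[OF continuous_map_fst_germ]
    by (auto simp: continuous_map_in_subtopology)
  show "continuous_map (subtopology slice_topology V) (subtopology germ_topology ((\<lambda>w. germ w h) ` V)) (\<lambda>w. germ w h)"
    using continuous_map_germ[OF V] by (auto simp: continuous_map_in_subtopology)
qed auto

text \<open>Germs over different points are separated by their base points, as the slice topology
  refines the Euclidean one. Over the same point, take sheets over one slice-connected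
  neighbourhood: if they had a common germ, the identity principle would make the functions equal
  there.\<close>

lemma Hausdorff_germ_topology: "Hausdorff_space germ_topology"
  unfolding Hausdorff_space_def
proof (intro allI impI, elim conjE)
  fix e1 e2 assume "e1 \<in> topspace germ_topology" "e2 \<in> topspace germ_topology" and ne: "e1 \<noteq> e2"
  then obtain q1 h1 W1 q2 h2 W2 where
    e1: "slice_regular_on W1 h1" "q1 \<in> W1" "e1 = germ q1 h1" and
    e2: "slice_regular_on W2 h2" "q2 \<in> W2" "e2 = germ q2 h2"
    by (metis germ_topspaceE)
  have o: "openin slice_topology W1" "openin slice_topology W2"
    using e1 e2 slice_regular_on_openin by auto
  have "\<exists>V1 V2. openin slice_topology V1 \<and> openin slice_topology V2 \<and> V1 \<subseteq> W1 \<and> V2 \<subseteq> W2 \<and>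
      q1 \<in> V1 \<and> q2 \<in> V2 \<and> (\<forall>w\<in>V1. \<forall>v\<in>V2. germ w h1 \<noteq> germ v h2)"
  proof (cases "q1 = q2")
    case False
    then obtain U1 U2 where U: "open U1" "open U2" "q1 \<in> U1" "q2 \<in> U2" "U1 \<inter> U2 = {}"
      using hausdorff[of q1 q2] by blast
    have "germ w h1 \<noteq> germ v h2" if "w \<in> U1" "v \<in> U2" for w v
      using that U(5) by (metis disjoint_iff fst_germ)
    moreover have "openin slice_topology (W1 \<inter> U1)" "openin slice_topology (W2 \<inter> U2)"
      using o U open_imp_openin_slice by blast+
    ultimately show ?thesis
      using e1(2) e2(2) U(3,4)
      by - (rule exI[where x = "W1 \<inter> U1"], rule exI[where x = "W2 \<inter> U2"], simp)
  next
    case True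
    obtain V where V: "openin slice_topology V" "q1 \<in> V" "V \<subseteq> W1 \<inter> W2" "connectedin slice_topology V"
      using slice_connected_nbhd[of "W1 \<inter> W2" q1] o e1 e2 True by (metis IntI openin_Int)
    have reg: "slice_regular_on V h1" "slice_regular_on V h2"
      using e1 e2 V slice_regular_on_subset by blast+
    have "germ w h1 \<noteq> germ v h2" if w: "w \<in> V" for w v
    proof
      assume "germ w h1 = germ v h2"
      then obtain W where W: "openin slice_topology W" "w \<in> W" "\<And>u. u \<in> W \<Longrightarrow> h1 u = h2 u"
        by (metis germ_eqE)
      obtain L z where L: "L \<in> \<S>" "w = slice_emb L z" by (rule quat_slice_cases)
      have "open (slice_emb L -` W)" using W L by (simp add: openin_slice_iff)
      then have "eventually (\<lambda>u. u \<in> slice_emb L -` W) (nhds z)"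
        using W(2) L by (intro eventually_nhds_in_open) auto
      then have "eventually (\<lambda>u. h1 (slice_emb L u) = h2 (slice_emb L u)) (nhds z)"
        by eventually_elim (use W(3) in auto)
      then have "h1 u = h2 u" if "u \<in> V" for u
        using slice_identity[OF reg V(4) L(1) _ _ that] w L by blast
      then have "e1 = e2" using germ_eqI[OF V(1,2)] True e1 e2 by metis
      with ne show False by simp
    qed
    then show ?thesis using V True by blast
  qed
  then obtain V1 V2 where V: "openin slice_topology V1" "openin slice_topology V2" "V1 \<subseteq> W1" "V2 \<subseteq> W2"
      "q1 \<in> V1" "q2 \<in> V2" "\<forall>w\<in>V1. \<forall>v\<in>V2. germ w h1 \<noteq> germ v h2" by blast
  then have "slice_regular_on V1 h1" "slice_regular_on V2 h2"
    using e1 e2 slice_regular_on_subset by blast+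
  then have o: "openin germ_topology ((\<lambda>w. germ w h1) ` V1)" "openin germ_topology ((\<lambda>w. germ w h2) ` V2)"
    using openin_germ_sheet by blast+
  have "e1 \<in> (\<lambda>w. germ w h1) ` V1" "e2 \<in> (\<lambda>w. germ w h2) ` V2"
    "disjnt ((\<lambda>w. germ w h1) ` V1) ((\<lambda>w. germ w h2) ` V2)"
    using V(5,6) e1(3) e2(3) V(7) unfolding disjnt_iff by (simp, simp, metis (no_types, lifting) imageE)
  with o show "\<exists>U V. openin germ_topology U \<and> openin germ_topology V \<and> e1 \<in> U \<and> e2 \<in> V \<and> disjnt U V"
    by blast
qed

text \<open>The set of agreement is open by local injectivity of p and closed by the Hausdorff
  property. It serves for paths in G and also for showing that G and a set of germs are inverse to
  each other.\<close>

lemma lift_unique: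
  assumes X: "connected_space X" and E: "Hausdorff_space E"
    and inj: "\<And>e. e \<in> topspace E \<Longrightarrow> \<exists>U. openin E U \<and> e \<in> U \<and> inj_on p U"
    and g: "continuous_map X E g1" "continuous_map X E g2"
    and p: "\<And>x. x \<in> topspace X \<Longrightarrow> p (g1 x) = p (g2 x)"
    and x0: "x0 \<in> topspace X" "g1 x0 = g2 x0" and x: "x \<in> topspace X"
  shows "g1 x = g2 x"
proof -
  let ?A = "{x \<in> topspace X. g1 x = g2 x}"
  have "openin X ?A"
  proof (subst openin_subopen, intro ballI)
    fix y assume y: "y \<in> ?A"
    then have "g1 y \<in> topspace E" using continuous_map_image_subset_topspace[OF g(1)] by blast
    then obtain U where U: "openin E U" "g1 y \<in> U" "inj_on p U" using inj by blast
    have "openin X ({x \<in> topspace X. g1 x \<in> U} \<inter> {x \<in> topspace X. g2 x \<in> U})"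
      using U(1) g by (auto simp: continuous_map_def)
    then show "\<exists>T. openin X T \<and> y \<in> T \<and> T \<subseteq> ?A"
      using y U p by (intro exI[of _ "{x \<in> topspace X. g1 x \<in> U} \<inter> {x \<in> topspace X. g2 x \<in> U}"])
        (auto dest: inj_onD)
  qed
  moreover have "closedin X ?A" by (rule closedin_continuous_maps_eq[OF E g])
  ultimately have "?A = topspace X" using X x0 unfolding connected_space_clopen_in by blast
  with x show ?thesis by blast
qed

lemma germ_topology_locally_injective:
  assumes "e \<in> topspace germ_topology"
  shows "\<exists>U. openin germ_topology U \<and> e \<in> U \<and> inj_on fst U"
  using assms
proof (rule germ_topspaceE)
  fix q h W assume "slice_regular_on W h" "q \<in> W" "e = germ q h"
  then show ?thesis
    using openin_germ_sheet by (intro exI[of _ "(\<lambda>w. germ w h) ` W"]) (auto simp: inj_on_def)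
qed

lemma slice_domain_locally_injective:
  assumes "slice_domain G \<pi>" "p \<in> topspace G"
  shows "\<exists>U. openin G U \<and> p \<in> U \<and> inj_on \<pi> U"
proof -
  obtain U where U: "openin G U" "p \<in> U" "homeomorphic_map (subtopology G U) (subtopology slice_topology (\<pi> ` U)) \<pi>"
    using assms unfolding slice_domain_def by blast
  then have "inj_on \<pi> U"
    using openin_subset[OF U(1)] by (auto simp: homeomorphic_eq_everything_map Int_absorb1)
  with U show ?thesis by blast
qed

lemma pathin_slice_emb:
  assumes "L \<in> \<S>" "path c" shows "pathin slice_topology (slice_emb L \<circ> c)"
  unfolding pathin_def
  by (rule continuous_map_compose[OF _ continuous_map_slice_emb[OF assms(1)]])
     (use assms(2) in \<open>simp add: path_def\<close>)

text \<open>Near t the germs are those of the single function \<open>h t\<close> along the path, so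
  continuity of the path of base points suffices.\<close>

lemma pathin_germ:
  assumes \<delta>: "pathin slice_topology \<delta>"
    and reg: "\<And>t. t \<in> {0..1} \<Longrightarrow> \<exists>W. slice_regular_on W (h t) \<and> \<delta> t \<in> W"
    and loc: "\<And>t. t \<in> {0..1} \<Longrightarrow> \<exists>T. open T \<and> t \<in> T \<and> (\<forall>s\<in>T \<inter> {0..1}. germ (\<delta> s) (h s) = germ (\<delta> s) (h t))"
  shows "pathin germ_topology (\<lambda>t. germ (\<delta> t) (h t))"
proof -
  let ?I = "top_of_set {0..1::real}"
  have "openin ?I {t \<in> {0..1}. germ (\<delta> t) (h t) \<in> U}" if U: "openin germ_topology U" for U
  proof (subst openin_subopen, intro ballI)
    fix t assume "t \<in> {t \<in> {0..1}. germ (\<delta> t) (h t) \<in> U}"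
    then have t: "t \<in> {0..1}" "germ (\<delta> t) (h t) \<in> U" by simp_all
    from loc[OF t(1)] obtain T where T: "open T" "t \<in> T"
      "\<forall>s\<in>T \<inter> {0..1}. germ (\<delta> s) (h s) = germ (\<delta> s) (h t)" by blast
    have "openin ?I {s \<in> topspace ?I. \<delta> s \<in> {w. germ w (h t) \<in> U}}"
      by (rule openin_continuous_map_preimage[OF \<delta>[unfolded pathin_def] openin_germ_preimage[OF U]])
    then have "openin ?I {s \<in> {0..1}. germ (\<delta> s) (h t) \<in> U}" by simp
    moreover have "openin ?I (T \<inter> {0..1})"
      using openin_open_Int[OF T(1), of "{0..1}"] by (simp only: Int_commute)
    ultimately have "openin ?I ({s \<in> {0..1}. germ (\<delta> s) (h t) \<in> U} \<inter> (T \<inter> {0..1}))"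
      by (rule openin_Int)
    moreover have "t \<in> {s \<in> {0..1}. germ (\<delta> s) (h t) \<in> U} \<inter> (T \<inter> {0..1})" using t T by blast
    moreover have "{s \<in> {0..1}. germ (\<delta> s) (h t) \<in> U} \<inter> (T \<inter> {0..1}) \<subseteq> {t \<in> {0..1}. germ (\<delta> t) (h t) \<in> U}"
    proof
      fix s assume s: "s \<in> {s \<in> {0..1}. germ (\<delta> s) (h t) \<in> U} \<inter> (T \<inter> {0..1})"
      then show "s \<in> {t \<in> {0..1}. germ (\<delta> t) (h t) \<in> U}" using T(3)[rule_format, of s] by simp
    qed
    ultimately show "\<exists>S. openin ?I S \<and> t \<in> S \<and> S \<subseteq> {t \<in> {0..1}. germ (\<delta> t) (h t) \<in> U}"
      by blast
  qed
  moreover have "germ (\<delta> t) (h t) \<in> topspace germ_topology" if "t \<in> {0..1}" for t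
    using reg[OF that] germ_in_topspace by blast
  ultimately show ?thesis by (auto simp: pathin_def continuous_map_def)
qed

section \<open>Maximality of a domain of existence\<close>

lemma lepoll_iff_ordLeq: "A \<lesssim> B \<longleftrightarrow> (card_of A, card_of B) \<in> ordLeq"
  unfolding lepoll_def by (rule card_of_ordLeq)

lemma UNION_lepoll_infinite:
  assumes "infinite B" "I \<lesssim> B" "\<And>i. i \<in> I \<Longrightarrow> A i \<lesssim> B" shows "(\<Union>i\<in>I. A i) \<lesssim> B"
  using card_of_UNION_ordLeq_infinite[of B I A] assms unfolding lepoll_iff_ordLeq by blast

lemma Un_lepoll_infinite:
  assumes "infinite B" "A \<lesssim> B" "A' \<lesssim> B" shows "A \<union> A' \<lesssim> B"
proof -
  have "(\<Union>b\<in>UNIV. if b then A else A') \<lesssim> B"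
    by (rule UNION_lepoll_infinite) (use assms in \<open>auto intro: finite_lepoll_infinite\<close>)
  then show ?thesis by (simp add: UNIV_bool Un_commute)
qed

lemma quat_lepoll_real: "(UNIV :: quat set) \<lesssim> (UNIV :: real set)"
proof -
  have inf: "infinite (UNIV :: real set)" by (rule infinite_UNIV_char_0)
  have times: "A \<times> B \<lesssim> (UNIV :: real set)" if "A \<lesssim> (UNIV :: real set)" "B \<lesssim> (UNIV :: real set)" for A :: "real set" and B :: "'z set"
  proof -
    have "(UNIV :: real set) \<times> (UNIV :: real set) \<lesssim> (UNIV :: real set)"
      using card_of_Times_same_infinite[OF inf] unfolding lepoll_iff_ordLeq
      by (rule ordIso_imp_ordLeq)
    then show ?thesis using lepoll_trans[OF times_lepoll_mono[OF that]] by blast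
  qed
  have "(UNIV :: quat set) \<lesssim> (UNIV :: real set) \<times> (UNIV :: real set) \<times> (UNIV :: real set) \<times> (UNIV :: real set)"
    unfolding lepoll_def
    by (rule exI[of _ "\<lambda>q. (qRe q, qI q, qJ q, qK q)"]) (auto simp: inj_on_def quat_eq_iff)
  also have "\<dots> \<lesssim> (UNIV :: real set)" by (intro times lepoll_refl)
  finally show ?thesis .
qed

section \<open>Charts and the germs of a slice regular function\<close>

definition chart :: "'a topology \<Rightarrow> ('a \<Rightarrow> quat) \<Rightarrow> ('a \<Rightarrow> quat) \<Rightarrow> 'a set \<Rightarrow> bool" where
  "chart G \<pi> f U \<longleftrightarrow> openin G U \<and> openin slice_topology (\<pi> ` U) \<and>
    homeomorphic_map (subtopology G U) (subtopology slice_topology (\<pi> ` U)) \<pi> \<and>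
    slice_regular_on (\<pi> ` U) (f \<circ> inv_into U \<pi>)"

lemma chartD:
  assumes "chart G \<pi> f U"
  shows "openin G U" "openin slice_topology (\<pi> ` U)" "inj_on \<pi> U" "U \<subseteq> topspace G"
    "slice_regular_on (\<pi> ` U) (f \<circ> inv_into U \<pi>)"
    "homeomorphic_map (subtopology G U) (subtopology slice_topology (\<pi> ` U)) \<pi>"
proof -
  show "openin G U" "openin slice_topology (\<pi> ` U)" "slice_regular_on (\<pi> ` U) (f \<circ> inv_into U \<pi>)"
    "homeomorphic_map (subtopology G U) (subtopology slice_topology (\<pi> ` U)) \<pi>"
    using assms by (auto simp: chart_def)
  then show "U \<subseteq> topspace G" "inj_on \<pi> U"
    by (auto simp: homeomorphic_eq_everything_map Int_absorb1 openin_subset dest: openin_subset)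
qed

lemma chart_openin_image:
  assumes U: "chart G \<pi> f U" and V: "openin G V" "V \<subseteq> U"
  shows "openin slice_topology (\<pi> ` V)"
proof -
  have "openin (subtopology G U) V" using V chartD(1)[OF U] by (simp add: openin_open_subtopology)
  then have "openin (subtopology slice_topology (\<pi> ` U)) (\<pi> ` V)"
    using chartD(6)[OF U] by (auto simp: homeomorphic_eq_everything_map open_map_def)
  then show ?thesis using chartD(2)[OF U] by (simp add: openin_open_subtopology)
qed

lemma chart_openin_preimage:
  assumes U: "chart G \<pi> f U" and W: "openin slice_topology W"
  shows "openin G {p \<in> U. \<pi> p \<in> W}"
proof -
  have "continuous_map (subtopology G U) slice_topology \<pi>"
    using chartD(6)[OF U] by (auto simp: homeomorphic_eq_everything_map continuous_map_in_subtopology)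
  then have "openin (subtopology G U) {p \<in> topspace (subtopology G U). \<pi> p \<in> W}"
    using W by (rule openin_continuous_map_preimage)
  moreover have "{p \<in> topspace (subtopology G U). \<pi> p \<in> W} = {p \<in> U. \<pi> p \<in> W}"
    using chartD(4)[OF U] by auto
  ultimately have "openin (subtopology G U) {p \<in> U. \<pi> p \<in> W}" by (simp only:)
  then show ?thesis using chartD(1)[OF U] by (simp only: openin_open_subtopology)
qed

locale regular_slice_function =
  fixes G :: "'a topology" and \<pi> :: "'a \<Rightarrow> quat" and x0 :: 'a and f :: "'a \<Rightarrow> quat"
  assumes pointed: "pointed_slice_domain (G, \<pi>, x0)" and regular: "slice_regular (G, \<pi>, x0) f"
begin

lemma slice_domain: "slice_domain G \<pi>" and x0: "x0 \<in> topspace G"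
  and connected: "connected_space G" and Hausdorff: "Hausdorff_space G"
  using pointed by (simp_all add: slice_domain_def)

text \<open>A function of a quaternion that represents f near p. It depends on the chosen chart, but
  its germ at \<open>\<pi> p\<close> does not.\<close>

definition local_rep :: "'a \<Rightarrow> quat \<Rightarrow> quat" where
  "local_rep p = f \<circ> inv_into (SOME U. chart G \<pi> f U \<and> p \<in> U) \<pi>"

definition germ_at :: "'a \<Rightarrow> quat \<times> (quat \<Rightarrow> quat) set" where
  "germ_at p = germ (\<pi> p) (local_rep p)"

lemma fst_germ_at [simp]: "fst (germ_at p) = \<pi> p"
  by (simp add: germ_at_def)

lemma chart_exists: assumes "p \<in> topspace G" shows "\<exists>U. chart G \<pi> f U \<and> p \<in> U"
  using regular assms by (auto simp: chart_def)

lemma local_rep_chart: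
  assumes "p \<in> topspace G"
  obtains U where "chart G \<pi> f U" "p \<in> U" "local_rep p = f \<circ> inv_into U \<pi>"
  using someI_ex[OF chart_exists[OF assms]] that by (auto simp: local_rep_def)

text \<open>Both local inverses of the projection return the same point over the image of the
  intersection of the two charts.\<close>

lemma germ_chart:
  assumes U: "chart G \<pi> f U" "chart G \<pi> f U'" and p: "p \<in> U" "p \<in> U'"
  shows "germ (\<pi> p) (f \<circ> inv_into U \<pi>) = germ (\<pi> p) (f \<circ> inv_into U' \<pi>)"
proof (rule germ_eqI)
  show "openin slice_topology (\<pi> ` (U \<inter> U'))"
    using chartD(1)[OF U(1)] chartD(1)[OF U(2)] by (intro chart_openin_image[OF U(1)]) auto
  show "\<pi> p \<in> \<pi> ` (U \<inter> U')" using p by blast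
  fix w assume "w \<in> \<pi> ` (U \<inter> U')"
  then show "(f \<circ> inv_into U \<pi>) w = (f \<circ> inv_into U' \<pi>) w"
    using chartD(3)[OF U(1)] chartD(3)[OF U(2)] by (auto simp: inv_into_f_f)
qed

lemma germ_at_chart:
  assumes "chart G \<pi> f U" "p \<in> U" shows "germ_at p = germ (\<pi> p) (f \<circ> inv_into U \<pi>)"
proof -
  have "p \<in> topspace G" using assms chartD(4) by blast
  then obtain U' where U': "chart G \<pi> f U'" "p \<in> U'" "local_rep p = f \<circ> inv_into U' \<pi>"
    by (rule local_rep_chart)
  show ?thesis unfolding germ_at_def U'(3) by (rule germ_chart[OF U'(1) assms(1) U'(2) assms(2)])
qed

lemma local_rep_regular:
  assumes "p \<in> topspace G" shows "\<exists>W. slice_regular_on W (local_rep p) \<and> \<pi> p \<in> W"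
  using local_rep_chart[OF assms] chartD(5) by (metis imageI)

lemma germ_at_in_topspace: "p \<in> topspace G \<Longrightarrow> germ_at p \<in> topspace germ_topology"
  using local_rep_regular germ_in_topspace by (metis germ_at_def)

lemma germ_at_locally:
  assumes "p \<in> topspace G"
  shows "\<exists>U. openin G U \<and> p \<in> U \<and> (\<forall>p'\<in>U. germ_at p' = germ (\<pi> p') (local_rep p))"
  using local_rep_chart[OF assms] germ_at_chart chartD(1) by metis

lemma germ_value_germ_at: assumes "p \<in> topspace G" shows "germ_value (germ_at p) = f p"
proof -
  obtain U where "chart G \<pi> f U" "p \<in> U" "local_rep p = f \<circ> inv_into U \<pi>"
    by (rule local_rep_chart[OF assms])
  then show ?thesis using chartD(3)[of G \<pi> f U] by (simp add: germ_at_def inv_into_f_f)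
qed

lemma continuous_map_germ_at: "continuous_map G germ_topology germ_at"
proof -
  have "openin G {p \<in> topspace G. germ_at p \<in> S}" if S: "openin germ_topology S" for S
  proof (subst openin_subopen, intro ballI)
    fix p assume p: "p \<in> {p \<in> topspace G. germ_at p \<in> S}"
    then obtain U where U: "chart G \<pi> f U" "p \<in> U" using chart_exists by blast
    let ?T = "{p \<in> U. \<pi> p \<in> {w. germ w (f \<circ> inv_into U \<pi>) \<in> S}}"
    have "openin G ?T" by (rule chart_openin_preimage[OF U(1) openin_germ_preimage[OF S]])
    moreover have "?T = {p \<in> U. germ_at p \<in> S}" using germ_at_chart[OF U(1)] by auto
    ultimately show "\<exists>T. openin G T \<and> p \<in> T \<and> T \<subseteq> {p \<in> topspace G. germ_at p \<in> S}"
      using p U chartD(4)[OF U(1)] by (intro exI[of _ ?T]) auto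
  qed
  then show ?thesis using germ_at_in_topspace by (auto simp: continuous_map_def)
qed

lemma openin_germ_at_image: "openin germ_topology (germ_at ` topspace G)"
proof (subst openin_subopen, intro ballI)
  fix e assume "e \<in> germ_at ` topspace G"
  then obtain p where p: "p \<in> topspace G" "e = germ_at p" by blast
  then obtain U where U: "chart G \<pi> f U" "p \<in> U" using chart_exists by blast
  have "openin germ_topology ((\<lambda>w. germ w (f \<circ> inv_into U \<pi>)) ` \<pi> ` U)"
    by (rule openin_germ_sheet[OF chartD(5)[OF U(1)]])
  moreover have "(\<lambda>w. germ w (f \<circ> inv_into U \<pi>)) ` \<pi> ` U = germ_at ` U"
    using germ_at_chart[OF U(1)] by (auto simp: image_image)
  ultimately show "\<exists>T. openin germ_topology T \<and> e \<in> T \<and> T \<subseteq> germ_at ` topspace G"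
    using p U chartD(4)[OF U(1)] by (intro exI[of _ "germ_at ` U"]) auto
qed

lemma continuous_map_projection: "continuous_map G slice_topology \<pi>"
  using continuous_map_compose[OF continuous_map_germ_at continuous_map_fst_germ]
  by (rule continuous_map_eq) simp

text \<open>A chart around \<open>x0\<close> contains a copy of a short segment in one slice. This
  is the room for naming new germs by elements of the carrier type.\<close>

lemma real_lepoll: "(UNIV :: real set) \<lesssim> (UNIV :: 'a set)"
proof -
  obtain U where U: "chart G \<pi> f U" "x0 \<in> U" using chart_exists[OF x0] by blast
  obtain L z where L: "L \<in> \<S>" "\<pi> x0 = slice_emb L z" by (rule quat_slice_cases)
  have "open (slice_emb L -` (\<pi> ` U))" using chartD(2)[OF U(1)] L by (simp add: openin_slice_iff)
  moreover have "z \<in> slice_emb L -` (\<pi> ` U)" using U L by (metis imageI vimageI)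
  ultimately obtain e where e: "e > 0" "ball z e \<subseteq> slice_emb L -` (\<pi> ` U)" by (meson openE)
  have "(UNIV :: real set) \<lesssim> {0<..<e}"
    using open_interval_eqpoll_reals e(1) eqpoll_imp_lepoll eqpoll_sym by blast
  also have "\<dots> \<lesssim> (UNIV :: 'a set)"
    unfolding lepoll_def
  proof (intro exI conjI)
    let ?g = "\<lambda>t. inv_into U \<pi> (slice_emb L (z + of_real t))"
    show "inj_on ?g {0<..<e}"
    proof (rule inj_onI)
      fix s t assume st: "s \<in> {0<..<e}" "t \<in> {0<..<e}" "?g s = ?g t"
      have "slice_emb L (z + of_real u) \<in> \<pi> ` U" if "u \<in> {0<..<e}" for u
      proof -
        have "z + of_real u \<in> ball z e" using that by (simp add: dist_norm)
        with e(2) show ?thesis by blast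
      qed
      then have "slice_emb L (z + of_real s) = slice_emb L (z + of_real t)"
        using st by (metis f_inv_into_f)
      then show "s = t" using slice_emb_eq_iff[OF L(1)] by simp
    qed
  qed simp
  finally show ?thesis .
qed

end

section \<open>Lifting paths of germs to a domain of existence\<close>

locale maximal_slice_function = regular_slice_function +
  assumes maximal: "domain_of_existence (G, \<pi>, x0) f (G, \<pi>, x0)"
begin

text \<open>\<open>domain_of_existence\<close> compares only slice-domains over the carrier type of
  G, so E is moved there along an injection and given the transported topology. With the base point
  as projection and evaluation of germs as function, the copy is extendible. Maximality then yields
  a fiber preserving map from the copy back to G.\<close>

lemma germ_extension:
  assumes open_E: "openin germ_topology E" and con_E: "connectedin germ_topology E"
    and sub: "germ_at ` topspace G \<subseteq> E" and card: "E \<lesssim> (UNIV :: 'a set)"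
  obtains \<psi> where "continuous_map (subtopology germ_topology E) G \<psi>" "\<psi> (germ_at x0) = x0"
    "\<And>e. e \<in> E \<Longrightarrow> \<pi> (\<psi> e) = fst e"
proof -
  obtain \<iota> :: "_ \<Rightarrow> 'a" where \<iota>: "inj_on \<iota> E" using card by (auto simp: lepoll_def)
  define \<kappa> where "\<kappa> = inv_into E \<iota>"
  have \<kappa>\<iota>: "\<kappa> (\<iota> e) = e" if "e \<in> E" for e using that \<iota> by (simp add: \<kappa>_def)
  define X where "X = pullback_topology (\<iota> ` E) \<kappa> germ_topology"
  let ?E = "subtopology germ_topology E"
  have topE: "topspace ?E = E" using openin_subset[OF open_E] by auto
  have topX: "topspace X = \<iota> ` E"
    using \<kappa>\<iota> openin_subset[OF open_E] by (auto simp: X_def topspace_pullback_topology)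
  have c\<iota>: "continuous_map ?E X \<iota>"
    unfolding X_def
  proof (rule continuous_map_pullback')
    have "continuous_map ?E germ_topology id" by (rule continuous_map_from_subtopology) simp
    then show "continuous_map ?E germ_topology (\<kappa> \<circ> \<iota>)"
      by (rule continuous_map_eq) (simp add: topE \<kappa>\<iota>)
  qed (use topE in auto)
  have c\<kappa>: "continuous_map X ?E \<kappa>"
    using continuous_map_pullback[OF continuous_map_id, of "\<iota> ` E" \<kappa> germ_topology] \<kappa>\<iota> topX
    by (auto simp: continuous_map_in_subtopology X_def)
  have hm: "homeomorphic_maps ?E X \<iota> \<kappa>"
    unfolding homeomorphic_maps_def using c\<iota> c\<kappa> \<kappa>\<iota> by (auto simp: topE topX)
  let ?p = "fst \<circ> \<kappa>" and ?F = "germ_value \<circ> \<kappa>"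
  have charts: "\<exists>U. chart X ?p ?F U \<and> \<iota> e \<in> U" if e: "e \<in> E" for e
  proof -
    obtain q h W where q: "slice_regular_on W h" "q \<in> W" "e = germ q h"
      using e openin_subset[OF open_E] by (blast elim: germ_topspaceE)
    \<comment> \<open>Shrinking W to the points whose germ lies in E keeps the sheet inside
      E.\<close>
    define V where "V = W \<inter> {w. germ w h \<in> E}"
    have "openin slice_topology V"
      unfolding V_def using slice_regular_on_openin[OF q(1)] openin_germ_preimage[OF open_E] by blast
    then have V: "slice_regular_on V h" using slice_regular_on_subset[OF q(1)] by (simp add: V_def)
    define N where "N = (\<lambda>w. germ w h) ` V"
    have N: "openin germ_topology N" "N \<subseteq> E" using openin_germ_sheet[OF V] by (auto simp: N_def V_def)
    have \<kappa>N: "\<kappa> ` \<iota> ` N = N" using \<kappa>\<iota> N(2) by (force simp: image_image)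
    have pN: "?p ` \<iota> ` N = V" unfolding image_comp[symmetric] \<kappa>N by (force simp: N_def)
    have "openin X (\<iota> ` N)"
      unfolding X_def openin_pullback_topology using N \<kappa>\<iota> by (intro exI[of _ N]) auto
    moreover have "homeomorphic_map (subtopology X (\<iota> ` N)) (subtopology slice_topology V) ?p"
    proof (rule homeomorphic_map_compose)
      have "homeomorphic_map X ?E \<kappa>" using hm homeomorphic_maps_map by blast
      moreover have "\<kappa> ` (topspace X \<inter> \<iota> ` N) = topspace ?E \<inter> N"
        using \<kappa>N N(2) topX topE by (simp add: Int_absorb1 Int_absorb2 image_mono)
      ultimately have "homeomorphic_map (subtopology X (\<iota> ` N)) (subtopology ?E N) \<kappa>"
        by (rule homeomorphic_map_subtopologies)
      then show "homeomorphic_map (subtopology X (\<iota> ` N)) (subtopology germ_topology N) \<kappa>"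
        using N(2) by (simp add: subtopology_subtopology Int_absorb1)
      show "homeomorphic_map (subtopology germ_topology N) (subtopology slice_topology V) fst"
        using homeomorphic_maps_germ[OF V] homeomorphic_maps_map unfolding N_def by blast
    qed
    moreover have "slice_regular_on V (?F \<circ> inv_into (\<iota> ` N) ?p)"
    proof (rule slice_regular_on_cong[OF V])
      fix w assume w: "w \<in> V"
      then have wN: "germ w h \<in> N" by (simp add: N_def)
      have "inj_on ?p (\<iota> ` N)"
      proof -
        have "\<kappa> (\<iota> (germ v h)) = germ v h" if "v \<in> V" for v
          using N(2) that by (intro \<kappa>\<iota>) (auto simp: N_def)
        then show ?thesis by (auto simp: inj_on_def N_def)
      qed
      then have "inv_into (\<iota> ` N) ?p (?p (\<iota> (germ w h))) = \<iota> (germ w h)"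
        using wN by (intro inv_into_f_f) auto
      moreover have "\<kappa> (\<iota> (germ w h)) = germ w h" using wN N(2) \<kappa>\<iota> by blast
      ultimately show "h w = (?F \<circ> inv_into (\<iota> ` N) ?p) w" by simp
    qed
    moreover have "\<iota> e \<in> \<iota> ` N" using q e by (auto simp: N_def V_def)
    ultimately show ?thesis
      using slice_regular_on_openin[OF V] pN unfolding chart_def by metis
  qed
  have hs: "?E homeomorphic_space X" using hm homeomorphic_space_def by blast
  have "connected_space X" "Hausdorff_space X"
    using homeomorphic_connected_space[OF hs] homeomorphic_Hausdorff_space[OF hs]
      connected_space_subtopology[OF con_E] Hausdorff_space_subtopology[OF Hausdorff_germ_topology]
    by blast+
  moreover have x0E: "germ_at x0 \<in> E" using sub x0 by blast
  ultimately have pX: "pointed_slice_domain (X, ?p, \<iota> (germ_at x0))"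
    using charts unfolding pointed_slice_domain.simps slice_domain_def topX chart_def by blast
  have rX: "slice_regular (X, ?p, \<iota> (germ_at x0)) ?F"
    using charts unfolding slice_regular.simps topX chart_def by blast
  have "extendible (G, \<pi>, x0) f (X, ?p, \<iota> (germ_at x0))"
    unfolding extendible_def
  proof (intro conjI exI)
    show "fiber_preserving (G, \<pi>, x0) (X, ?p, \<iota> (germ_at x0)) (\<iota> \<circ> germ_at)"
    proof -
      have "continuous_map G ?E germ_at"
        using continuous_map_germ_at sub by (auto simp: continuous_map_in_subtopology)
      then have "continuous_map G X (\<iota> \<circ> germ_at)" by (rule continuous_map_compose[OF _ c\<iota>])
      then show ?thesis using \<kappa>\<iota> sub by (simp add: image_subset_iff)
    qed
    show "\<forall>p\<in>topspace (fst (G, \<pi>, x0)). ?F ((\<iota> \<circ> germ_at) p) = f p"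
      using \<kappa>\<iota> sub germ_value_germ_at by (simp add: image_subset_iff)
  qed (rule pX rX)+
  then have "(X, ?p, \<iota> (germ_at x0)) \<preceq>\<^sub>s (G, \<pi>, x0)"
    using maximal by (simp add: domain_of_existence_def is_union_def upper_bound_def)
  then obtain \<phi> where \<phi>: "continuous_map X G \<phi>" "\<And>y. y \<in> topspace X \<Longrightarrow> \<pi> (\<phi> y) = ?p y"
    "\<phi> (\<iota> (germ_at x0)) = x0"
    by (auto simp: dominated_def)
  show ?thesis
  proof (rule that[of "\<phi> \<circ> \<iota>"])
    show "continuous_map ?E G (\<phi> \<circ> \<iota>)" by (rule continuous_map_compose[OF c\<iota> \<phi>(1)])
  qed (use \<phi> topX \<kappa>\<iota> in auto)
qed

text \<open>Once E contains the path, the map \<open>\<psi>\<close> from E to G and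
  \<open>germ_at\<close> are inverse to each other. So the germs on the path are germs of f already,
  and \<open>\<psi>\<close> carries the path into G.\<close>

lemma germ_path_lifts:
  assumes \<Phi>: "pathin germ_topology \<Phi>" and p: "p \<in> topspace G" "\<Phi> 0 = germ_at p"
  shows "\<exists>\<alpha>. pathin G \<alpha> \<and> \<alpha> 0 = p \<and> (\<forall>t\<in>{0..1}. germ_at (\<alpha> t) = \<Phi> t)"
proof -
  have inf: "infinite (UNIV :: 'a set)"
    using real_lepoll infinite_UNIV_char_0[where 'a = real] inj_on_finite unfolding lepoll_def by blast
  \<comment> \<open>A sheet is the image of a set of quaternions, hence it has at most continuum
    many germs; E needs one sheet for each t in the unit interval.\<close>
  have quat: "A \<lesssim> (UNIV :: 'a set)" for A :: "quat set"
    using lepoll_trans[OF lepoll_trans[OF subset_imp_lepoll[OF subset_UNIV] quat_lepoll_real] real_lepoll] .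
  have "\<exists>N. openin germ_topology N \<and> connectedin germ_topology N \<and> \<Phi> t \<in> N \<and> N \<lesssim> (UNIV :: 'a set)"
    if t: "t \<in> {0..1}" for t
  proof -
    have "\<Phi> t \<in> topspace germ_topology"
      using continuous_map_image_subset_topspace[OF \<Phi>[unfolded pathin_def]] t by auto
    then obtain q h W where q: "slice_regular_on W h" "q \<in> W" "\<Phi> t = germ q h" by (rule germ_topspaceE)
    obtain V where V: "openin slice_topology V" "q \<in> V" "V \<subseteq> W" "connectedin slice_topology V"
      using slice_connected_nbhd[OF slice_regular_on_openin[OF q(1)] q(2)] .
    have reg: "slice_regular_on V h" using slice_regular_on_subset[OF q(1) V(1,3)] .
    have "connectedin germ_topology ((\<lambda>w. germ w h) ` V)"
      by (rule connectedin_continuous_map_image[OF continuous_map_germ[OF reg]])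
         (use V in \<open>simp add: connectedin_subtopology\<close>)
    moreover have "(\<lambda>w. germ w h) ` V \<lesssim> (UNIV :: 'a set)"
      using lepoll_trans[OF image_lepoll quat] .
    ultimately show ?thesis using openin_germ_sheet[OF reg] V(2) q(3) by blast
  qed
  then obtain N where N: "\<And>t. t \<in> {0..1} \<Longrightarrow> openin germ_topology (N t)"
    "\<And>t. t \<in> {0..1} \<Longrightarrow> connectedin germ_topology (N t)" "\<And>t. t \<in> {0..1} \<Longrightarrow> \<Phi> t \<in> N t"
    "\<And>t. t \<in> {0..1} \<Longrightarrow> N t \<lesssim> (UNIV :: 'a set)"
    by metis
  define E where "E = germ_at ` topspace G \<union> (\<Union>t\<in>{0..1}. N t)"
  have open_E: "openin germ_topology E"
    unfolding E_def using openin_germ_at_image N(1) by blast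
  have con_E: "connectedin germ_topology E"
  proof -
    have con_G: "connectedin germ_topology (germ_at ` topspace G)"
      using connectedin_continuous_map_image[OF continuous_map_germ_at] connected
      by (simp add: connectedin_topspace)
    have con_\<Phi>: "connectedin germ_topology (\<Phi> ` {0..1})"
      by (rule connectedin_path_image[OF \<Phi>])
    \<comment> \<open>Each sheet is tied to the germs of f by the whole path, which starts at
      \<open>germ_at p\<close>.\<close>
    have con: "connectedin germ_topology (germ_at ` topspace G \<union> (\<Phi> ` {0..1} \<union> N t))" if t: "t \<in> {0..1}" for t
    proof -
      have "\<Phi> t \<in> \<Phi> ` {0..1} \<inter> N t" using N(3)[OF t] t by blast
      then have "connectedin germ_topology (\<Phi> ` {0..1} \<union> N t)"
        using connectedin_Un[OF con_\<Phi> N(2)[OF t]] by blast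
      moreover have "\<Phi> 0 \<in> germ_at ` topspace G \<inter> (\<Phi> ` {0..1} \<union> N t)"
        using p by (simp add: p(2)[symmetric]) (simp add: p(2))
      ultimately show ?thesis using connectedin_Un[OF con_G] by blast
    qed
    have "E = (\<Union>t\<in>{0..1}. germ_at ` topspace G \<union> (\<Phi> ` {0..1} \<union> N t))"
      using N(3) by (auto simp: E_def)
    moreover have "connectedin germ_topology \<dots>"
      using con p(1) by (intro connectedin_Union) auto
    ultimately show ?thesis by simp
  qed
  have "germ_at ` topspace G \<lesssim> (UNIV :: 'a set)"
    using lepoll_trans[OF image_lepoll subset_imp_lepoll[OF subset_UNIV]] .
  moreover have "{0..1::real} \<lesssim> (UNIV :: 'a set)"
    using lepoll_trans[OF subset_imp_lepoll[OF subset_UNIV] real_lepoll] .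
  ultimately have card: "E \<lesssim> (UNIV :: 'a set)"
    unfolding E_def using N(4) by (intro Un_lepoll_infinite UNION_lepoll_infinite inf) auto
  obtain \<psi> where \<psi>: "continuous_map (subtopology germ_topology E) G \<psi>" "\<psi> (germ_at x0) = x0"
    "\<And>e. e \<in> E \<Longrightarrow> \<pi> (\<psi> e) = fst e"
    using germ_extension[OF open_E con_E _ card] by (auto simp: E_def)
  have GE: "germ_at q \<in> E" if "q \<in> topspace G" for q using that by (simp add: E_def)
  have topE: "topspace (subtopology germ_topology E) = E" using openin_subset[OF open_E] by auto
  have cG: "continuous_map G (subtopology germ_topology E) germ_at"
    using continuous_map_germ_at GE by (auto simp: continuous_map_in_subtopology)
  \<comment> \<open>Each of the two composites is a lift of the projection that fixes the base
    point, and so is the identity; uniqueness of lifts compares them.\<close>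
  have \<psi>_germ: "(\<psi> \<circ> germ_at) q = id q" if "q \<in> topspace G" for q
    by (rule lift_unique[OF connected Hausdorff slice_domain_locally_injective[OF slice_domain]
          continuous_map_compose[OF cG \<psi>(1)] continuous_map_id _ x0])
       (use \<psi> GE that in auto)
  have germ_x0: "germ_at x0 \<in> topspace (subtopology germ_topology E)" using GE[OF x0] topE by simp
  have germ_\<psi>: "(germ_at \<circ> \<psi>) e = id e" if "e \<in> E" for e
    by (rule lift_unique[OF connected_space_subtopology[OF con_E] Hausdorff_germ_topology
          germ_topology_locally_injective continuous_map_compose[OF \<psi>(1) continuous_map_germ_at]
          continuous_map_from_subtopology[OF continuous_map_id] _ germ_x0])
       (use \<psi> that topE in auto)
  have \<Phi>E: "\<Phi> t \<in> E" if "t \<in> {0..1}" for t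
    unfolding E_def using N(3)[OF that] that by blast
  then have "pathin (subtopology germ_topology E) \<Phi>"
    using \<Phi> by (simp add: pathin_subtopology)
  then have "pathin G (\<psi> \<circ> \<Phi>)" by (rule pathin_compose[OF _ \<psi>(1)])
  moreover have "(\<psi> \<circ> \<Phi>) 0 = p" using \<psi>_germ[OF p(1)] p(2) by simp
  moreover have "germ_at ((\<psi> \<circ> \<Phi>) t) = \<Phi> t" if "t \<in> {0..1}" for t
    using germ_\<psi>[OF \<Phi>E[OF that]] by simp
  ultimately show ?thesis by blast
qed

end

section \<open>Continuation along finite-part paths\<close>

text \<open>The entry \<open>I(j + 1)\<close> of \<open>zeta(I)\<close> for the units
  \<open>K 0, ..., K (n - 1)\<close>, by recursion on the top binary digit of j. In this form an
  index below \<open>2 ^ n\<close> visibly does not feel the unit \<open>K n\<close>.\<close>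

primrec slice_word :: "(nat \<Rightarrow> quat) \<Rightarrow> nat \<Rightarrow> nat \<Rightarrow> quat" where
  "slice_word K 0 j = 1"
| "slice_word K (Suc n) j = (if j < 2 ^ n then slice_word K n j
     else K n * (if n = 0 then 1 else K (n - 1)) * slice_word K n (j - 2 ^ n))"

lemma slice_word_cong: "(\<And>k. k < n \<Longrightarrow> K k = K' k) \<Longrightarrow> slice_word K n j = slice_word K' n j"
  by (induction n arbitrary: j) auto

text \<open>As the signs do not depend on \<open>K\<close>, the combination \<open>\<zeta>(K) \<M>(J)\<^sup>-\<^sup>1 F\<close> of functions \<open>F\<^sub>i\<close> that are
  holomorphic with respect to the last units of the rows of \<open>J\<close> is holomorphic with respect to the
  last unit of \<open>K\<close>.\<close>

lemma slice_word_mult_last: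
  "\<exists>s :: nat \<Rightarrow> real. (\<forall>j. s j * s j = 1) \<and> (\<forall>K. (\<forall>k<Suc n. K k \<in> \<S>) \<longrightarrow>
     (\<forall>j<2 ^ Suc n. K n * slice_word K (Suc n) j = s j *\<^sub>R slice_word K (Suc n) (2 ^ Suc n - 1 - j)))"
proof (induction n)
  case 0
  show ?case
  proof (intro exI[of _ "\<lambda>j. if j = 0 then 1 else - 1"] conjI allI impI)
    fix K :: "nat \<Rightarrow> quat" and j :: nat
    assume "\<forall>k<Suc 0. K k \<in> \<S>" "j < 2 ^ Suc 0"
    then have "K 0 * K 0 = -1" "j = 0 \<or> j = 1" by (auto intro: imag_unit_square)
    then show "K 0 * slice_word K (Suc 0) j = (if j = 0 then 1 else - 1) *\<^sub>R slice_word K (Suc 0) (2 ^ Suc 0 - 1 - j)"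
      by auto
  qed auto
next
  case (Suc n)
  then obtain s :: "nat \<Rightarrow> real" where s: "\<And>j. s j * s j = 1" and
    IH: "\<And>K j. (\<forall>k<Suc n. K k \<in> \<S>) \<Longrightarrow> j < 2 ^ Suc n \<Longrightarrow>
      K n * slice_word K (Suc n) j = s j *\<^sub>R slice_word K (Suc n) (2 ^ Suc n - 1 - j)" by blast
  define d :: nat where "d = 2 ^ Suc n"
  have dd: "2 ^ Suc (Suc n) = 2 * d" by (simp add: d_def)
  \<comment> \<open>Multiplication by the last unit flips all binary digits of the index. With top
    digit 0, the new word is rewritten by the relation for \<open>d - 1 - j\<close>, whose sign
    moves across because it squares to 1. With top digit 1, the square of the unit contributes the
    minus sign.\<close>
  define s' where "s' j = (if j < d then s (d - 1 - j) else - s (j - d))" for j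
  have word: "slice_word K (Suc (Suc n)) j = (if j < d then slice_word K (Suc n) j
     else K (Suc n) * (K n * slice_word K (Suc n) (j - d)))" for K j
    by (subst slice_word.simps(2)) (simp add: d_def mult.assoc del: slice_word.simps)
  show ?case
  proof (intro exI[of _ s'] conjI allI impI)
    show "s' j * s' j = 1" for j by (simp add: s'_def s)
    fix K :: "nat \<Rightarrow> quat" and j :: nat
    assume K: "\<forall>k<Suc (Suc n). K k \<in> \<S>" and "j < 2 ^ Suc (Suc n)"
    then have j: "j < 2 * d" by (simp only: dd)
    have IH': "K n * slice_word K (Suc n) i = s i *\<^sub>R slice_word K (Suc n) (d - 1 - i)" if "i < d" for i
      using IH[of K i] K that unfolding d_def by simp
    show "K (Suc n) * slice_word K (Suc (Suc n)) j = s' j *\<^sub>R slice_word K (Suc (Suc n)) (2 ^ Suc (Suc n) - 1 - j)"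
    proof (cases "j < d")
      case True
      define i where "i = d - 1 - j"
      have i: "i < d" "d - 1 - i = j" "2 * d - 1 - j = d + i" using True by (auto simp: i_def)
      have "slice_word K (Suc (Suc n)) (d + i) = s i *\<^sub>R (K (Suc n) * slice_word K (Suc n) j)"
        unfolding word using IH'[OF i(1)] i(2) by (simp del: slice_word.simps)
      moreover have "s' j = s i" using True by (simp add: s'_def i_def)
      ultimately show ?thesis
        unfolding dd i(3) word[of K j] using True s[of i] by (simp del: slice_word.simps)
    next
      case False
      define i where "i = j - d"
      have i: "i < d" "2 * d - 1 - j = d - 1 - i" "d - 1 - i < d" using False j by (auto simp: i_def)
      have "K (Suc n) \<in> \<S>" using K by simp
      then have "K (Suc n) * slice_word K (Suc (Suc n)) j = - (K n * slice_word K (Suc n) i)"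
        unfolding word using False by (simp add: i_def imag_unit_square_left del: slice_word.simps)
      then show ?thesis
        unfolding dd i(2) word[of K "d - 1 - i"] IH'[OF i(1)] using False i(3)
        by (simp add: s'_def i_def del: slice_word.simps)
    qed
  qed
qed

text \<open>B is the inverse of \<open>M(J^(n))\<close>, written entrywise. The product
  \<open>B M\<close> gives \<open>word_coefficients_row\<close>; the product \<open>M B\<close>
  cancels M in \<open>word_coefficients_intertwine\<close>.\<close>

definition inverse_word_matrix :: "(nat \<Rightarrow> nat \<Rightarrow> quat) \<Rightarrow> nat \<Rightarrow> (nat \<Rightarrow> nat \<Rightarrow> quat) \<Rightarrow> bool" where
  "inverse_word_matrix J n B \<longleftrightarrow>
    (\<forall>j<2 ^ n. \<forall>k<2 ^ n. (\<Sum>i<2 ^ n. B j i * slice_word (J i) n k) = (if j = k then 1 else 0)) \<and>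
    (\<forall>i<2 ^ n. \<forall>k<2 ^ n. (\<Sum>j<2 ^ n. slice_word (J i) n j * B j k) = (if i = k then 1 else 0))"

lemma sum_mult_delta:
  fixes g :: "nat \<Rightarrow> quat"
  shows "k < d \<Longrightarrow> (\<Sum>j<d. g j * (if j = k then 1 else 0)) = g k"
  by (simp add: if_distrib cong: if_cong)

lemma word_coefficients_row:
  assumes B: "inverse_word_matrix J n B" and k: "k < 2 ^ n"
  shows "(\<Sum>i<2 ^ n. (\<Sum>j<2 ^ n. slice_word K n j * B j i) * slice_word (J i) n k) = slice_word K n k"
proof -
  have "(\<Sum>i<2 ^ n. (\<Sum>j<2 ^ n. slice_word K n j * B j i) * slice_word (J i) n k) =
      (\<Sum>i<2 ^ n. \<Sum>j<2 ^ n. slice_word K n j * (B j i * slice_word (J i) n k))"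
    by (simp add: sum_distrib_right mult.assoc)
  also have "\<dots> = (\<Sum>j<2 ^ n. slice_word K n j * (\<Sum>i<2 ^ n. B j i * slice_word (J i) n k))"
    by (subst sum.swap) (simp add: sum_distrib_left)
  also have "\<dots> = (\<Sum>j<2 ^ n. slice_word K n j * (if j = k then 1 else 0))"
    using B k unfolding inverse_word_matrix_def by (intro sum.cong) auto
  finally show ?thesis using sum_mult_delta[OF k] by simp
qed

text \<open>Let D be the diagonal matrix of the last units of the rows and P the signed permutation
  of \<open>slice_word_mult_last\<close>. Then \<open>D M = M P\<close> and
  \<open>K_n zeta(K) = zeta(K) P\<close> with the same P. For \<open>a = zeta(K) B\<close> this
  gives \<open>a D M = a M P = zeta(K) P = K_n a M\<close>, and M cancels. The result is the
  hypothesis of \<open>CR_on_intertwined_sum\<close>.\<close>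

lemma word_coefficients_intertwine:
  assumes B: "inverse_word_matrix J (Suc n) B"
    and J: "\<And>i k. i < 2 ^ Suc n \<Longrightarrow> k < Suc n \<Longrightarrow> J i k \<in> \<S>" and K: "\<And>k. k < Suc n \<Longrightarrow> K k \<in> \<S>"
    and i: "i < 2 ^ Suc n"
  shows "(\<Sum>j<2 ^ Suc n. slice_word K (Suc n) j * B j i) * J i n =
    K n * (\<Sum>j<2 ^ Suc n. slice_word K (Suc n) j * B j i)"
proof -
  define d :: nat where "d = 2 ^ Suc n"
  define w where "w K j = slice_word K (Suc n) j" for K j
  obtain s :: "nat \<Rightarrow> real" where s: "\<And>K j. \<forall>k<Suc n. K k \<in> \<S> \<Longrightarrow> j < d \<Longrightarrow> K n * w K j = s j *\<^sub>R w K (d - 1 - j)"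
    using slice_word_mult_last[of n] unfolding d_def w_def by blast
  have MB: "(\<Sum>j<d. w (J i) j * B j k) = (if i = k then 1 else 0)" if "i < d" "k < d" for i k
    using B that unfolding inverse_word_matrix_def d_def w_def by blast
  define a where "a i = (\<Sum>j<d. w K j * B j i)" for i
  have aM: "(\<Sum>i<d. a i * w (J i) k) = w K k" if k: "k < d" for k
    using word_coefficients_row[OF B, of k K] k unfolding a_def w_def d_def .
  have aDM: "(\<Sum>i<d. a i * (J i n * w (J i) k)) = K n * w K k" if k: "k < d" for k
  proof -
    have "(\<Sum>i<d. a i * (J i n * w (J i) k)) = (\<Sum>i<d. s k *\<^sub>R (a i * w (J i) (d - 1 - k)))"
      using s[OF _ k] J by (intro sum.cong refl) (simp add: d_def)
    also have "\<dots> = s k *\<^sub>R w K (d - 1 - k)"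
      using aM[of "d - 1 - k"] k by (simp add: scaleR_sum_right[symmetric])
    finally show ?thesis using s[of K k] K k by simp
  qed
  have "a i * J i n = (\<Sum>i'<d. a i' * J i' n * (if i' = i then 1 else 0))"
    using sum_mult_delta[of i d "\<lambda>i'. a i' * J i' n"] \<open>i < 2 ^ Suc n\<close> by (simp add: d_def)
  also have "\<dots> = (\<Sum>i'<d. a i' * J i' n * (\<Sum>k<d. w (J i') k * B k i))"
    using MB i by (intro sum.cong) (auto simp: d_def)
  also have "\<dots> = (\<Sum>k<d. \<Sum>i'<d. a i' * (J i' n * w (J i') k) * B k i)"
    by (subst sum.swap) (simp add: sum_distrib_left mult.assoc)
  also have "\<dots> = (\<Sum>k<d. K n * w K k * B k i)"
    using aDM by (intro sum.cong) (simp_all add: sum_distrib_right[symmetric])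
  also have "\<dots> = K n * a i" by (simp add: a_def sum_distrib_left mult.assoc)
  finally show ?thesis unfolding a_def w_def d_def .
qed

lemma germ_eq_slice_eventually:
  assumes "L \<in> \<S>" "germ (slice_emb L z) h = germ (slice_emb L z) h'"
  shows "eventually (\<lambda>w. h (slice_emb L w) = h' (slice_emb L w)) (nhds z)"
proof -
  obtain W where W: "openin slice_topology W" "slice_emb L z \<in> W" "\<And>w. w \<in> W \<Longrightarrow> h w = h' w"
    using germ_eqE[OF assms(2)] by metis
  then have "eventually (\<lambda>w. w \<in> slice_emb L -` W) (nhds z)"
    using assms(1) by (intro eventually_nhds_in_open) (auto simp: openin_slice_iff)
  then show ?thesis by eventually_elim (use W(3) in auto)
qed

lemma slice_eventually_imp_germ_eq:
  assumes "slice_regular_on W1 h1" "slice_regular_on W2 h2" "L \<in> \<S>"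
    "slice_emb L z \<in> W1" "slice_emb L z \<in> W2"
    "eventually (\<lambda>w. h1 (slice_emb L w) = h2 (slice_emb L w)) (nhds z)"
  shows "germ (slice_emb L z) h1 = germ (slice_emb L z) h2"
  using slice_regular_germ_eq[OF assms] germ_eqI by metis

text \<open>An interval suffices at a real point, and this is how consecutive parts are glued: at a
  joint the identities for different slices can be compared on the real axis only.\<close>

lemma real_eventually_imp_germ_eq:
  assumes h: "slice_regular_on W1 h1" "slice_regular_on W2 h2" and W: "of_real r \<in> W1" "of_real r \<in> W2"
    and ev: "eventually (\<lambda>s. h1 (of_real s) = h2 (of_real s)) (nhds r)"
  shows "germ (of_real r) h1 = germ (of_real r) h2"
proof -
  obtain L where L: "L \<in> \<S>" by (rule exists_imag_unit)
  have o: "openin slice_topology (W1 \<inter> W2)" using h slice_regular_on_openin by blast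
  have "slice_regular_on (W1 \<inter> W2) h1" "slice_regular_on (W1 \<inter> W2) h2"
    using h slice_regular_on_subset[OF _ o] by auto
  from slice_regular_eventually_eqI[OF this L _ ev] W
  have "eventually (\<lambda>w. h1 (slice_emb L w) = h2 (slice_emb L w)) (nhds (of_real r))" by simp
  from slice_eventually_imp_germ_eq[OF h L _ _ this] W show ?thesis by simp
qed

context maximal_slice_function
begin

text \<open>One part of the path. The combination of the representatives along the
  \<open>\<alpha> i\<close> is holomorphic for M by the intertwining hypothesis; its local
  extensions to the other slices form a path of germs that starts at the germ of f at p, and this
  path lifts. The conclusion is an identity near \<open>c 1\<close> because the next part starts
  from it.\<close>

lemma combined_continuation:
  assumes c: "path c" "c 0 = of_real r" and L: "\<And>i. i < d \<Longrightarrow> L i \<in> \<S>" and M: "M \<in> \<S>"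
    and \<alpha>: "\<And>i. i < d \<Longrightarrow> pathin G (\<alpha> i)"
    and \<alpha>\<pi>: "\<And>i t. i < d \<Longrightarrow> t \<in> {0..1} \<Longrightarrow> \<pi> (\<alpha> i t) = slice_emb (L i) (c t)"
    and a: "\<And>i. i < (d::nat) \<Longrightarrow> a i * L i = M * a i"
    and p: "p \<in> topspace G" "\<pi> p = of_real r"
    and real: "eventually (\<lambda>s. local_rep p (of_real s) = (\<Sum>i<d. a i * local_rep (\<alpha> i 0) (of_real s))) (nhds r)"
  shows "\<exists>\<beta>. pathin G \<beta> \<and> \<beta> 0 = p \<and> (\<forall>t\<in>{0..1}. \<pi> (\<beta> t) = slice_emb M (c t)) \<and>
    eventually (\<lambda>z. local_rep (\<beta> 1) (slice_emb M z) = (\<Sum>i<d. a i * local_rep (\<alpha> i 1) (slice_emb (L i) z))) (nhds (c 1))"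
proof -
  define F where "F t z = (\<Sum>i<d. a i * local_rep (\<alpha> i t) (slice_emb (L i) z))" for t z
  have \<alpha>G: "\<alpha> i t \<in> topspace G" if "i < d" "t \<in> {0..1}" for i t
    using continuous_map_image_subset_topspace[OF \<alpha>[OF that(1), unfolded pathin_def]] that(2) by auto
  have "\<exists>W h e. slice_regular_on W h \<and> e > 0 \<and>
    (\<forall>w\<in>ball (c t) e. slice_emb M w \<in> W \<and> h (slice_emb M w) = F t w)" if t: "t \<in> {0..1}" for t
  proof -
    have "\<exists>W. slice_regular_on W (local_rep (\<alpha> i t)) \<and> slice_emb (L i) (c t) \<in> W" if "i < d" for i
      using local_rep_regular[OF \<alpha>G[OF that t]] \<alpha>\<pi>[OF that t] by simp
    then obtain W where W: "\<And>i. i < d \<Longrightarrow> slice_regular_on (W i) (local_rep (\<alpha> i t))"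
      "\<And>i. i < d \<Longrightarrow> slice_emb (L i) (c t) \<in> W i" by metis
    \<comment> \<open>All representatives are defined on D when read in the common complex
      coordinate.\<close>
    define D where "D = (\<Inter>i<d. slice_emb (L i) -` W i)"
    have "open (slice_emb (L i) -` W i)" if "i < d" for i
      using slice_regular_on_openin[OF W(1)[OF that]] L[OF that] openin_slice_iff by blast
    then have D: "open D" unfolding D_def by (intro open_INT) auto
    have "CR_on (L i) D (\<lambda>z. local_rep (\<alpha> i t) (slice_emb (L i) z))" if "i < d" for i
    proof (rule CR_on_subset[OF _ D])
      show "CR_on (L i) (slice_emb (L i) -` W i) (\<lambda>z. local_rep (\<alpha> i t) (slice_emb (L i) z))"
        using W(1)[OF that] L[OF that] by (simp add: slice_regular_on_iff comp_def)
    qed (use that in \<open>auto simp: D_def\<close>)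
    then have "CR_on M D (F t)"
      unfolding F_def using a by (intro CR_on_intertwined_sum[where u = L] D) auto
    moreover have "c t \<in> D" using W(2) by (auto simp: D_def)
    ultimately obtain W h e where "slice_regular_on W h" "e > 0" "\<And>w. w \<in> ball (c t) e \<Longrightarrow> slice_emb M w \<in> W"
      "\<And>w. w \<in> ball (c t) e \<Longrightarrow> h (slice_emb M w) = F t w"
      using CR_on_ball_slice_extension[OF M] by metis
    then show ?thesis by blast
  qed
  then obtain W h e where h: "\<And>t. t \<in> {0..1} \<Longrightarrow> slice_regular_on (W t) (h t)"
    "\<And>t. t \<in> {0..1} \<Longrightarrow> e t > (0::real)"
    "\<And>t. t \<in> {0..1} \<Longrightarrow> \<forall>w\<in>ball (c t) (e t). slice_emb M w \<in> W t \<and> h t (slice_emb M w) = F t w"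
    by metis
  have hF: "eventually (\<lambda>w. h t (slice_emb M w) = F t w) (nhds z)" if "t \<in> {0..1}" "z \<in> ball (c t) (e t)" for t z
    using eventually_nhds_in_open[OF open_ball that(2)] by eventually_elim (use h(3)[OF that(1)] in blast)
  have cent: "c t \<in> ball (c t) (e t)" if "t \<in> {0..1}" for t using h(2)[OF that] by simp
  define \<Phi> where "\<Phi> t = germ ((slice_emb M \<circ> c) t) (h t)" for t
  have "pathin germ_topology \<Phi>"
    unfolding \<Phi>_def
  proof (rule pathin_germ)
    show "pathin slice_topology (slice_emb M \<circ> c)" by (rule pathin_slice_emb[OF M c(1)])
    fix t :: real assume t: "t \<in> {0..1}"
    show "\<exists>W. slice_regular_on W (h t) \<and> (slice_emb M \<circ> c) t \<in> W"
      using h(1,3)[OF t] cent[OF t] by auto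
    have "\<exists>U. openin G U \<and> \<alpha> i t \<in> U \<and> (\<forall>p'\<in>U. germ_at p' = germ (\<pi> p') (local_rep (\<alpha> i t)))" if "i < d" for i
      using germ_at_locally[OF \<alpha>G[OF that t]] .
    then obtain U where U: "\<And>i. i < d \<Longrightarrow> openin G (U i)" "\<And>i. i < d \<Longrightarrow> \<alpha> i t \<in> U i"
      "\<And>i p'. i < d \<Longrightarrow> p' \<in> U i \<Longrightarrow> germ_at p' = germ (\<pi> p') (local_rep (\<alpha> i t))" by metis
    let ?I = "top_of_set {0..1::real}"
    \<comment> \<open>For s in S the point \<open>c s\<close> lies in the disc where
      \<open>h t\<close> represents \<open>F t\<close>, and each \<open>\<alpha> i s\<close> lies
      where \<open>local_rep (\<alpha> i t)\<close> still represents f. Hence \<open>F s\<close> and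
      \<open>F t\<close> agree near \<open>c s\<close>, and so do the extensions.\<close>
    define S where "S = {s \<in> {0..1}. c s \<in> ball (c t) (e t)} \<inter> ((\<Inter>i<d. {s \<in> {0..1}. \<alpha> i s \<in> U i}) \<inter> {0..1})"
    have "openin ?I {s \<in> {0..1}. c s \<in> ball (c t) (e t)}"
      using openin_continuous_map_preimage[of ?I euclidean c "ball (c t) (e t)"] c(1) by (simp add: path_def)
    moreover have "openin ?I ((\<Inter>i<d. {s \<in> {0..1}. \<alpha> i s \<in> U i}) \<inter> topspace ?I)"
    proof (rule openin_INT)
      fix i assume "i \<in> {..<d}"
      then show "openin ?I {s \<in> {0..1}. \<alpha> i s \<in> U i}"
        using openin_continuous_map_preimage[OF \<alpha>[unfolded pathin_def] U(1), of i i] by simp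
    qed simp
    ultimately have "openin ?I S"
      unfolding S_def topspace_euclidean_subtopology by (rule openin_Int)
    then obtain T where T: "open T" "S = {0..1} \<inter> T" by (auto simp: openin_open)
    have "t \<in> S" unfolding S_def using cent[OF t] t U(2) by blast
    moreover have "germ ((slice_emb M \<circ> c) s) (h s) = germ ((slice_emb M \<circ> c) s) (h t)" if s: "s \<in> T \<inter> {0..1}" for s
    proof -
      have s01: "s \<in> {0..1}" and "s \<in> S" using s T(2) by auto
      then have cs: "c s \<in> ball (c t) (e t)" and \<alpha>s: "\<And>i. i < d \<Longrightarrow> \<alpha> i s \<in> U i" by (auto simp: S_def)
      have "eventually (\<lambda>w. local_rep (\<alpha> i s) (slice_emb (L i) w) = local_rep (\<alpha> i t) (slice_emb (L i) w)) (nhds (c s))"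
        if i: "i < d" for i
        using U(3)[OF i \<alpha>s[OF i]] unfolding germ_at_def \<alpha>\<pi>[OF i s01]
        by (rule germ_eq_slice_eventually[OF L[OF i]])
      then have "eventually (\<lambda>w. \<forall>i\<in>{..<d}. local_rep (\<alpha> i s) (slice_emb (L i) w) = local_rep (\<alpha> i t) (slice_emb (L i) w)) (nhds (c s))"
        by (intro eventually_ball_finite) auto
      then have FF: "eventually (\<lambda>w. F s w = F t w) (nhds (c s))"
        by eventually_elim (auto simp: F_def intro!: sum.cong)
      have "eventually (\<lambda>w. h s (slice_emb M w) = h t (slice_emb M w)) (nhds (c s))"
        using hF[OF s01 cent[OF s01]] hF[OF t cs] FF by eventually_elim simp
      then show ?thesis
        using slice_eventually_imp_germ_eq[OF h(1)[OF s01] h(1)[OF t] M, of "c s"]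
          h(3)[OF s01] h(3)[OF t] cent[OF s01] cs by simp
    qed
    ultimately show "\<exists>T. open T \<and> t \<in> T \<and> (\<forall>s\<in>T \<inter> {0..1}.
        germ ((slice_emb M \<circ> c) s) (h s) = germ ((slice_emb M \<circ> c) s) (h t))"
      using T by blast
  qed
  \<comment> \<open>On the real axis all slice embeddings coincide, so the hypothesis
    \<open>real\<close> identifies \<open>h 0\<close> with the representative at p on an
    interval.\<close>
  moreover have "\<Phi> 0 = germ_at p"
  proof -
    obtain V where V: "slice_regular_on V (local_rep p)" "of_real r \<in> V"
      using local_rep_regular[OF p(1)] p(2) by auto
    have zero: "(0::real) \<in> {0..1}" by simp
    have "eventually (\<lambda>w. w \<in> ball (c 0) (e 0)) (nhds (complex_of_real r))"
      using cent[OF zero] c(2) by (intro eventually_nhds_in_open) auto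
    then have "eventually (\<lambda>s. (of_real s :: complex) \<in> ball (c 0) (e 0)) (nhds r)"
      by (rule eventually_compose_filterlim) (rule tendsto_of_real[OF filterlim_ident])
    with real have "eventually (\<lambda>s. h 0 (of_real s) = local_rep p (of_real s)) (nhds r)"
    proof eventually_elim
      case (elim s)
      have "h 0 (slice_emb M (of_real s)) = F 0 (of_real s)" using bspec[OF h(3)[OF zero] elim(2)] by (rule conjunct2)
      then show ?case using elim(1) by (simp add: F_def)
    qed
    moreover have "of_real r \<in> W 0" using h(3)[of 0] cent[of 0] c(2) by (metis atLeastAtMost_iff order_refl slice_emb_of_real zero_le_one)
    ultimately have "germ (of_real r) (h 0) = germ (of_real r) (local_rep p)"
      using V h(1)[of 0] by (intro real_eventually_imp_germ_eq[of "W 0" _ V]) auto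
    then show ?thesis by (simp add: \<Phi>_def germ_at_def p(2) c(2))
  qed
  ultimately obtain \<beta> where \<beta>: "pathin G \<beta>" "\<beta> 0 = p" "\<And>t. t \<in> {0..1} \<Longrightarrow> germ_at (\<beta> t) = \<Phi> t"
    using germ_path_lifts[OF _ p(1)] by blast
  have \<beta>\<pi>: "\<pi> (\<beta> t) = slice_emb M (c t)" if "t \<in> {0..1}" for t
    using arg_cong[OF \<beta>(3)[OF that], of fst] by (simp add: \<Phi>_def)
  have one: "(1::real) \<in> {0..1}" by simp
  have "germ (slice_emb M (c 1)) (local_rep (\<beta> 1)) = germ (slice_emb M (c 1)) (h 1)"
    using \<beta>(3)[OF one] \<beta>\<pi>[OF one] by (simp add: germ_at_def \<Phi>_def)
  from germ_eq_slice_eventually[OF M this] hF[OF one cent[OF one]]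
  have "eventually (\<lambda>z. local_rep (\<beta> 1) (slice_emb M z) = F 1 z) (nhds (c 1))"
    by eventually_elim simp
  then show ?thesis using \<beta>(1,2) \<beta>\<pi> unfolding F_def by blast
qed

end

section \<open>Lifts of initial segments of a finite-part path\<close>

context regular_slice_function
begin

text \<open>\<open>reaches \<gamma> K n p\<close> means that the first \<open>n\<close> parts of \<open>\<gamma>\<^sup>K\<close> lift to \<open>G\<close> from \<open>x0\<close>, with end point \<open>p\<close>.\<close>

primrec reaches :: "(nat \<Rightarrow> real \<Rightarrow> complex) \<Rightarrow> (nat \<Rightarrow> quat) \<Rightarrow> nat \<Rightarrow> 'a \<Rightarrow> bool" where
  "reaches \<gamma> K 0 p \<longleftrightarrow> p = x0"
| "reaches \<gamma> K (Suc n) p \<longleftrightarrow> (\<exists>p' \<alpha>. reaches \<gamma> K n p' \<and> pathin G \<alpha> \<and> \<alpha> 0 = p' \<and> \<alpha> 1 = p \<and>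
     (\<forall>t\<in>{0..1}. \<pi> (\<alpha> t) = slice_emb (K n) (\<gamma> n t)))"

lemma path_lift_unique:
  assumes "pathin G \<alpha>" "pathin G \<beta>" "\<alpha> 0 = \<beta> 0" "\<And>t. t \<in> {0..1} \<Longrightarrow> \<pi> (\<alpha> t) = \<pi> (\<beta> t)" "t \<in> {0..1}"
  shows "\<alpha> t = \<beta> t"
proof -
  have con: "connected_space (top_of_set {0..1::real})"
    by (simp add: connected_space_subtopology)
  show ?thesis
    by (rule lift_unique[OF con Hausdorff slice_domain_locally_injective[OF slice_domain]
          assms(1,2)[unfolded pathin_def] _ _ assms(3)]) (use assms(4,5) in auto)
qed

lemma reaches_unique: "reaches \<gamma> K n p \<Longrightarrow> reaches \<gamma> K n q \<Longrightarrow> p = q"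
proof (induction n arbitrary: p q)
  case (Suc n)
  obtain \<alpha> where \<alpha>: "reaches \<gamma> K n (\<alpha> 0)" "pathin G \<alpha>" "\<alpha> 1 = p" "\<forall>t\<in>{0..1}. \<pi> (\<alpha> t) = slice_emb (K n) (\<gamma> n t)"
    using Suc.prems(1) by auto
  obtain \<beta> where \<beta>: "reaches \<gamma> K n (\<beta> 0)" "pathin G \<beta>" "\<beta> 1 = q" "\<forall>t\<in>{0..1}. \<pi> (\<beta> t) = slice_emb (K n) (\<gamma> n t)"
    using Suc.prems(2) by auto
  have eq0: "\<alpha> 0 = \<beta> 0" by (rule Suc.IH[OF \<alpha>(1) \<beta>(1)])
  have "\<alpha> 1 = \<beta> 1"
    by (rule path_lift_unique[OF \<alpha>(2) \<beta>(2) eq0]) (use \<alpha>(4) \<beta>(4) in simp_all)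
  then show ?case using \<alpha>(3) \<beta>(3) by simp
qed simp

lemma reaches_prefix: "reaches \<gamma> K N p \<Longrightarrow> n \<le> N \<Longrightarrow> \<exists>q. reaches \<gamma> K n q"
proof (induction N arbitrary: p)
  case (Suc N)
  show ?case
  proof (cases "n = Suc N")
    case True
    then show ?thesis using Suc.prems(1) by blast
  next
    case False
    then have "n \<le> N" using Suc.prems(2) by simp
    then show ?thesis using Suc.IH Suc.prems(1) by auto
  qed
qed auto

lemma reaches_in_topspace:
  assumes "reaches \<gamma> K n p" shows "p \<in> topspace G"
proof (cases n)
  case 0
  then show ?thesis using assms x0 by simp
next
  case (Suc m)
  then obtain \<alpha> where \<alpha>: "pathin G \<alpha>" "\<alpha> 1 = p" using assms by auto
  show ?thesis
    using continuous_map_image_subset_topspace[OF \<alpha>(1)[unfolded pathin_def]] \<alpha>(2) by force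
qed

end

context maximal_slice_function
begin

text \<open>The vector \<open>c\<close> plays the role of \<open>\<M>(J)\<^sup>-\<^sup>1 f(\<gamma>\<^sup>J)\<close>: it does not depend on \<open>K\<close>.  It is needed near
  the end point, and not only at it, to start the continuation along the next part.\<close>

lemma reaches_all_units:
  fixes \<gamma> :: "nat \<Rightarrow> real \<Rightarrow> complex" and J :: "nat \<Rightarrow> nat \<Rightarrow> quat" and r :: real and I0 :: quat
  defines "e \<equiv> \<lambda>n. if n = 0 then of_real r else \<gamma> (n - 1) 1"
    and "u \<equiv> \<lambda>K n. if n = 0 then I0 else K (n - 1)"
  assumes \<gamma>: "\<And>k. k < N \<Longrightarrow> path (\<gamma> k)" "\<And>k. k < N \<Longrightarrow> \<gamma> k 0 = e k" "\<And>k. k < N \<Longrightarrow> e k \<in> \<real>"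
    and start: "\<pi> x0 = of_real r"
    and J: "\<And>i k. i < 2 ^ N \<Longrightarrow> k < N \<Longrightarrow> J i k \<in> \<S>"
    and inv: "\<And>n. 1 \<le> n \<Longrightarrow> n \<le> N \<Longrightarrow> \<exists>B. inverse_word_matrix J n B"
    and rows: "\<And>i. i < 2 ^ N \<Longrightarrow> \<exists>p. reaches \<gamma> (J i) N p"
    and n: "n \<le> N"
  shows "\<exists>c :: complex \<Rightarrow> nat \<Rightarrow> quat. \<forall>K. (\<forall>k<n. K k \<in> \<S>) \<longrightarrow> (\<exists>p. reaches \<gamma> K n p \<and> \<pi> p = slice_emb (u K n) (e n) \<and>
    eventually (\<lambda>z. local_rep p (slice_emb (u K n) z) = (\<Sum>j<2 ^ n. slice_word K n j * c z j)) (nhds (e n)))"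
  using n
proof (induction n)
  case 0
  \<comment> \<open>Before the first part the only word is 1 and the coefficient is f itself. The
    point is real, so any slice, here that of \<open>I0\<close>, will do for all K.\<close>
  show ?case
    by (rule exI[of _ "\<lambda>z j. local_rep x0 (slice_emb I0 z)"]) (simp add: start e_def u_def)
next
  case (Suc n)
  define d :: nat where "d = 2 ^ Suc n"
  have n: "n < N" "n \<le> N" using Suc.prems by auto
  obtain c where c: "\<And>K. \<forall>k<n. K k \<in> \<S> \<Longrightarrow> \<exists>p. reaches \<gamma> K n p \<and> \<pi> p = slice_emb (u K n) (e n) \<and>
    eventually (\<lambda>z. local_rep p (slice_emb (u K n) z) = (\<Sum>j<2 ^ n. slice_word K n j * c z j)) (nhds (e n))"
    using Suc.IH[OF n(2)] by blast
  obtain B where B: "inverse_word_matrix J (Suc n) B" using inv[of "Suc n"] Suc.prems by auto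
  obtain r' where r': "e n = of_real r'" using \<gamma>(3)[OF n(1)] by (auto elim: Reals_cases)
  \<comment> \<open>Padding with zeros rewrites the identity for n units with the words for n + 1
    units. It is restricted to real arguments, where the slice \<open>u K n\<close> is no longer
    visible.\<close>
  define c' where "c' s j = (if j < 2 ^ n then c (of_real s) j else 0)" for s :: real and j
  have dN: "d \<le> 2 ^ N" unfolding d_def using Suc.prems by (intro power_increasing) auto
  have J': "J i k \<in> \<S>" if "i < d" "k < Suc n" for i k using J[of i k] that dN Suc.prems by simp
  have end_real: "\<exists>p. reaches \<gamma> K n p \<and> p \<in> topspace G \<and> \<pi> p = of_real r' \<and>
      eventually (\<lambda>s. local_rep p (of_real s) = (\<Sum>j<d. slice_word K (Suc n) j * c' s j)) (nhds r')"
    if K: "\<forall>k<n. K k \<in> \<S>" for K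
  proof -
    obtain p where p: "reaches \<gamma> K n p" "\<pi> p = slice_emb (u K n) (e n)"
      "eventually (\<lambda>z. local_rep p (slice_emb (u K n) z) = (\<Sum>j<2 ^ n. slice_word K n j * c z j)) (nhds (of_real r'))"
      using c[OF K] r' by auto
    have "eventually (\<lambda>s. local_rep p (slice_emb (u K n) (of_real s)) = (\<Sum>j<2 ^ n. slice_word K n j * c (of_real s) j)) (nhds r')"
      using p(3) by (rule eventually_compose_filterlim) (rule tendsto_of_real[OF filterlim_ident])
    moreover have "(\<Sum>j<d. slice_word K (Suc n) j * c' s j) = (\<Sum>j<2 ^ n. slice_word K n j * c (of_real s) j)" for s
      by (rule sum.mono_neutral_cong_right) (auto simp: c'_def d_def)
    ultimately show ?thesis using p(1,2) reaches_in_topspace[OF p(1)] r' by auto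
  qed
  have "\<exists>\<alpha>. pathin G \<alpha> \<and> reaches \<gamma> (J i) n (\<alpha> 0) \<and> (\<forall>t\<in>{0..1}. \<pi> (\<alpha> t) = slice_emb (J i n) (\<gamma> n t))" if i: "i < d" for i
  proof -
    obtain p where "reaches \<gamma> (J i) N p" using rows[of i] i dN by auto
    from reaches_prefix[OF this Suc.prems] show ?thesis by auto
  qed
  then obtain \<alpha> where \<alpha>: "\<And>i. i < d \<Longrightarrow> pathin G (\<alpha> i)" "\<And>i. i < d \<Longrightarrow> reaches \<gamma> (J i) n (\<alpha> i 0)"
    "\<And>i t. i < d \<Longrightarrow> t \<in> {0..1} \<Longrightarrow> \<pi> (\<alpha> i t) = slice_emb (J i n) (\<gamma> n t)" by metis
  \<comment> \<open>Here the independence of c from K is used: the same \<open>c'\<close> describes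
    f at the joint for K and for every row of J.\<close>
  have start_rows: "eventually (\<lambda>s. local_rep (\<alpha> i 0) (of_real s) = (\<Sum>j<d. slice_word (J i) (Suc n) j * c' s j)) (nhds r')"
    if i: "i < d" for i
    using end_real[of "J i"] J'[OF i] reaches_unique[OF \<alpha>(2)[OF i]] by (metis less_SucI)
  \<comment> \<open>The new coefficient vector is \<open>B F\<close>, with F the germs at the ends
    of the row lifts; K does not enter.\<close>
  define b where "b z j = (\<Sum>i<d. B j i * local_rep (\<alpha> i 1) (slice_emb (J i n) z))" for z j
  show ?case
  proof (intro exI[of _ b] allI impI)
    fix K assume K: "\<forall>k<Suc n. K k \<in> \<S>"
    obtain p where p: "reaches \<gamma> K n p" "p \<in> topspace G" "\<pi> p = of_real r'"
      "eventually (\<lambda>s. local_rep p (of_real s) = (\<Sum>j<d. slice_word K (Suc n) j * c' s j)) (nhds r')"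
      using end_real[of K] K by auto
    define a where "a i = (\<Sum>j<d. slice_word K (Suc n) j * B j i)" for i
    have aM: "(\<Sum>i<d. a i * (\<Sum>k<d. slice_word (J i) (Suc n) k * x k)) = (\<Sum>k<d. slice_word K (Suc n) k * x k)" for x
    proof -
      have "(\<Sum>i<d. a i * (\<Sum>k<d. slice_word (J i) (Suc n) k * x k)) =
          (\<Sum>k<d. (\<Sum>i<d. a i * slice_word (J i) (Suc n) k) * x k)"
        by (simp only: sum_distrib_left sum_distrib_right mult.assoc) (rule sum.swap)
      also have "\<dots> = (\<Sum>k<d. slice_word K (Suc n) k * x k)"
        using word_coefficients_row[OF B] unfolding a_def d_def by (intro sum.cong refl) simp
      finally show ?thesis .
    qed
    have "eventually (\<lambda>s. \<forall>i\<in>{..<d}. local_rep (\<alpha> i 0) (of_real s) = (\<Sum>j<d. slice_word (J i) (Suc n) j * c' s j)) (nhds r')"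
      using start_rows by (intro eventually_ball_finite) auto
    \<comment> \<open>At the joint \<open>F = M c'\<close>, so
      \<open>a F = a M c' = zeta(K) c'\<close>, which is f near p.\<close>
    with p(4) have real: "eventually (\<lambda>s. local_rep p (of_real s) = (\<Sum>i<d. a i * local_rep (\<alpha> i 0) (of_real s))) (nhds r')"
      by eventually_elim (simp only: aM[symmetric] lessThan_iff, intro sum.cong refl, simp)
    have int: "a i * J i n = K n * a i" if "i < d" for i
      using word_coefficients_intertwine[OF B, of K i] J' K that unfolding a_def d_def by blast
    have Kn: "K n \<in> \<S>" using K by simp
    have \<gamma>0: "\<gamma> n 0 = of_real r'" using \<gamma>(2)[OF n(1)] r' by simp
    have Jn: "J i n \<in> \<S>" if "i < d" for i using J'[OF that] by simp
    obtain \<beta> where \<beta>: "pathin G \<beta>" "\<beta> 0 = p" "\<forall>t\<in>{0..1}. \<pi> (\<beta> t) = slice_emb (K n) (\<gamma> n t)"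
      "eventually (\<lambda>z. local_rep (\<beta> 1) (slice_emb (K n) z) = (\<Sum>i<d. a i * local_rep (\<alpha> i 1) (slice_emb (J i n) z))) (nhds (\<gamma> n 1))"
      using combined_continuation[OF \<gamma>(1)[OF n(1)] \<gamma>0 Jn Kn \<alpha>(1,3) int p(2,3) real] by blast
    have sum_eq: "(\<Sum>i<d. a i * local_rep (\<alpha> i 1) (slice_emb (J i n) z)) = (\<Sum>j<d. slice_word K (Suc n) j * b z j)" for z
      by (simp only: a_def b_def sum_distrib_left sum_distrib_right mult.assoc) (rule sum.swap)
    have "reaches \<gamma> K (Suc n) (\<beta> 1)" using \<beta>(1-3) p(1) by auto
    moreover have "\<pi> (\<beta> 1) = slice_emb (K n) (\<gamma> n 1)" using \<beta>(3) by simp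
    moreover have at_end: "u K (Suc n) = K n" "e (Suc n) = \<gamma> n 1" by (simp_all add: u_def e_def)
    ultimately show "\<exists>p. reaches \<gamma> K (Suc n) p \<and> \<pi> p = slice_emb (u K (Suc n)) (e (Suc n)) \<and>
        eventually (\<lambda>z. local_rep p (slice_emb (u K (Suc n)) z) = (\<Sum>j<2 ^ Suc n. slice_word K (Suc n) j * b z j)) (nhds (e (Suc n)))"
      using \<beta>(4) unfolding sum_eq unfolding d_def at_end by (intro exI[of _ "\<beta> 1"] conjI)
  qed
qed

end

section \<open>The representation formula\<close>

lemma rev_upt_Suc: "rev [1..<Suc (Suc n)] = Suc n # rev [1..<Suc n]"
  by simp

text \<open>The factors come in order of decreasing k, so the factor of the top digit stands in
  front, as in the recursion.\<close>

lemma prod_list_eq_slice_word: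
  fixes K :: "nat \<Rightarrow> quat"
  defines "u \<equiv> \<lambda>k. if k = 0 then 1 else K (k - 1)"
  assumes "j < 2 ^ n"
  shows "prod_list (map (\<lambda>k. (u k * u (k - 1)) ^ (j div 2 ^ (k - 1) mod 2)) (rev [1..<Suc n])) = slice_word K n j"
  using assms(2)
proof (induction n arbitrary: j)
  case (Suc n)
  let ?p = "\<lambda>j n. prod_list (map (\<lambda>k. (u k * u (k - 1)) ^ (j div 2 ^ (k - 1) mod 2)) (rev [1..<Suc n]))"
  have step: "?p j (Suc n) = (u (Suc n) * u n) ^ (j div 2 ^ n mod 2) * ?p j n"
    unfolding rev_upt_Suc by simp
  show ?case
  proof (cases "j < 2 ^ n")
    case True
    then show ?thesis unfolding step using Suc.IH[OF True] by simp
  next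
    case False
    define i where "i = j - 2 ^ n"
    have i: "j = 2 ^ n + i" "i < 2 ^ n" using False Suc.prems by (auto simp: i_def)
    have "j div 2 ^ n mod 2 = 1" using i by simp
    moreover have "?p j n = ?p i n"
    proof (intro arg_cong[where f = prod_list] map_cong refl arg_cong2[where f = power])
      fix k assume "k \<in> set (rev [1..<Suc n])"
      then have k: "1 \<le> k" "k \<le> n" by auto
      \<comment> \<open>Dropping the top digit changes \<open>j div 2 ^ (k - 1)\<close> by the even
        number \<open>2 * 2 ^ (n - k)\<close>, so the lower digits stay.\<close>
      have "(2::nat) ^ n = 2 ^ (k - 1) * (2 * 2 ^ (n - k))"
      proof -
        have "n = (k - 1) + Suc (n - k)" using k by simp
        then show ?thesis by (metis power_Suc power_add)
      qed
      then have "j div 2 ^ (k - 1) = 2 * 2 ^ (n - k) + i div 2 ^ (k - 1)" unfolding i(1) by simp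
      then show "j div 2 ^ (k - 1) mod 2 = i div 2 ^ (k - 1) mod 2" by (metis mod_mult_self4)
    qed
    moreover have "u (Suc n) * u n = K n * (if n = 0 then 1 else K (n - 1))" by (simp add: u_def)
    ultimately show ?thesis unfolding step using Suc.IH[OF i(2)] False by (simp add: i_def)
  qed
qed simp

lemma dim_\<zeta> [simp]: "dim_vec (\<zeta> K) = 2 ^ dim_vec K"
  by (simp add: \<zeta>_def)

lemma index_\<zeta>:
  assumes "dim_vec K = n" "j < 2 ^ n" shows "vec_index (\<zeta> K) j = slice_word (vec_index K) n j"
proof -
  have "vec_index (\<zeta> K) j = unit_word K (Suc j)" using assms by (simp add: \<zeta>_def)
  also have "\<dots> = slice_word (vec_index K) n j"
    unfolding unit_word_def unit_entry_def diff_Suc_1 assms(1)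
    by (rule prod_list_eq_slice_word[OF assms(2)])
  finally show ?thesis .
qed

lemma zeta_matrix_upper_left:
  assumes "l \<le> N" "J \<in> carrier_mat (2 ^ N) N"
  shows "zeta_matrix (upper_left J l) = Matrix.mat (2 ^ l) (2 ^ l) (\<lambda>(i, j). slice_word (\<lambda>k. J $$ (i, k)) l j)"
    (is "_ = ?M")
proof (rule eq_matI)
  fix i j assume ij: "i < dim_row ?M" "j < dim_col ?M"
  have "vec_index (Matrix.row (upper_left J l) i) k = J $$ (i, k)" if "k < l" for k
    using that ij by (simp add: upper_left_def)
  then have "slice_word (vec_index (Matrix.row (upper_left J l) i)) l j = slice_word (\<lambda>k. J $$ (i, k)) l j"
    by (rule slice_word_cong)
  moreover have "dim_vec (Matrix.row (upper_left J l) i) = l" by (simp add: upper_left_def)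
  ultimately show "zeta_matrix (upper_left J l) $$ (i, j) = ?M $$ (i, j)"
    using ij by (simp add: zeta_matrix_def mat_of_rows_def upper_left_def index_\<zeta>)
qed (simp_all add: zeta_matrix_def mat_of_rows_def upper_left_def)

lemma upper_left_full: "J \<in> carrier_mat (2 ^ N) N \<Longrightarrow> upper_left J N = J"
  by (intro eq_matI) (auto simp: upper_left_def)

lemma inverts_mat_carrier:
  assumes "A \<in> carrier_mat d d" "inverts_mat A B" "inverts_mat B A" shows "B \<in> carrier_mat d d"
proof -
  have "A * B = 1\<^sub>m d" "B * A = 1\<^sub>m (dim_row B)" using assms by (simp_all add: inverts_mat_def)
  then have "dim_col (A * B) = d" "dim_col (B * A) = dim_row B" by simp_all
  then show ?thesis using assms(1) by (intro carrier_matI) simp_all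
qed

text \<open>A two-sided inverse is unique by associativity, so the description in
  \<open>mat_inv\<close> denotes it.\<close>

lemma mat_inv_eq:
  assumes A: "A \<in> carrier_mat d d" and B: "inverts_mat A B" "inverts_mat B A"
  shows "mat_inv A = B"
  unfolding mat_inv_def
proof (rule the_equality)
  fix C assume C: "inverts_mat A C \<and> inverts_mat C A"
  have cB: "B \<in> carrier_mat d d" and cC: "C \<in> carrier_mat d d"
    using inverts_mat_carrier A B C by blast+
  have "C = C * (A * B)" using B(1) A cC by (simp add: inverts_mat_def)
  also have "\<dots> = (C * A) * B" using A cB cC by (simp add: assoc_mult_mat)
  also have "\<dots> = B" using C cB cC by (simp add: inverts_mat_def)
  finally show "C = B" .
qed (use B in simp)

lemma inverse_word_matrix_exists:
  assumes J: "J \<in> carrier_mat (2 ^ N) N" and rank: "full_slice_rank J" and l: "1 \<le> l" "l \<le> N"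
  shows "\<exists>B. inverse_word_matrix (\<lambda>i k. J $$ (i, k)) l B"
proof -
  let ?M = "Matrix.mat (2 ^ l) (2 ^ l) (\<lambda>(i, j). slice_word (\<lambda>k. J $$ (i, k)) l j)"
  have "invertible_mat ?M"
  proof -
    have "l \<in> {1..dim_col J}" using l J by simp
    then have "invertible_mat (zeta_matrix (upper_left J l))" using rank unfolding full_slice_rank_def by blast
    then show ?thesis unfolding zeta_matrix_upper_left[OF l(2) J] .
  qed
  then obtain B where B: "inverts_mat ?M B" "inverts_mat B ?M" by (auto simp: invertible_mat_def)
  have cB: "B \<in> carrier_mat (2 ^ l) (2 ^ l)" by (rule inverts_mat_carrier[OF _ B]) simp
  have MB: "?M * B = 1\<^sub>m (2 ^ l)" and BM: "B * ?M = 1\<^sub>m (2 ^ l)"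
    using B cB by (simp_all add: inverts_mat_def)
  have "(\<Sum>j<2 ^ l. slice_word (\<lambda>k. J $$ (i, k)) l j * B $$ (j, k)) = (if i = k then 1 else 0)"
    if "i < 2 ^ l" "k < 2 ^ l" for i k
    using arg_cong[OF MB, of "\<lambda>A. A $$ (i, k)"] that cB
    by (simp add: scalar_prod_def atLeast0LessThan)
  moreover have "(\<Sum>i<2 ^ l. B $$ (j, i) * slice_word (\<lambda>k. J $$ (i, k)) l k) = (if j = k then 1 else 0)"
    if "j < 2 ^ l" "k < 2 ^ l" for j k
    using arg_cong[OF BM, of "\<lambda>A. A $$ (j, k)"] that cB
    by (simp add: scalar_prod_def atLeast0LessThan)
  ultimately show ?thesis unfolding inverse_word_matrix_def by (intro exI[of _ "\<lambda>j i. B $$ (j, i)"]) blast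
qed

section \<open>Lifts as lists of paths\<close>

context regular_slice_function
begin

lemma local_rep_projection: "p \<in> topspace G \<Longrightarrow> local_rep p (\<pi> p) = f p"
  using germ_value_germ_at by (simp add: germ_at_def)

text \<open>The recursive form suits the induction over the parts; this one, with all the paths at
  once, matches the lists in \<open>is_lift\<close>.\<close>

lemma reaches_iff:
  "reaches \<gamma> K n p \<longleftrightarrow> (\<exists>A. (\<forall>k<n. pathin G (A k) \<and> (\<forall>t\<in>{0..1}. \<pi> (A k t) = slice_emb (K k) (\<gamma> k t)) \<and>
     A k 0 = (if k = 0 then x0 else A (k - 1) 1)) \<and> p = (if n = 0 then x0 else A (n - 1) 1))"
proof (induction n arbitrary: p)
  case (Suc n)
  let ?P = "\<lambda>A k. pathin G (A k) \<and> (\<forall>t\<in>{0..1}. \<pi> (A k t) = slice_emb (K k) (\<gamma> k t)) \<and>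
     A k 0 = (if k = 0 then x0 else A (k - 1) 1)"
  show ?case
  proof
    assume "reaches \<gamma> K (Suc n) p"
    then obtain \<alpha> where \<alpha>: "reaches \<gamma> K n (\<alpha> 0)" "pathin G \<alpha>" "\<alpha> 1 = p"
      "\<forall>t\<in>{0..1}. \<pi> (\<alpha> t) = slice_emb (K n) (\<gamma> n t)" by auto
    obtain A where A: "\<forall>k<n. ?P A k" "\<alpha> 0 = (if n = 0 then x0 else A (n - 1) 1)"
      using Suc.IH[THEN iffD1, OF \<alpha>(1)] by blast
    have "?P (A(n := \<alpha>)) k" if "k < Suc n" for k
      using that A \<alpha> by (cases "k = n") auto
    then show "\<exists>A. (\<forall>k<Suc n. ?P A k) \<and> p = (if Suc n = 0 then x0 else A (Suc n - 1) 1)"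
      using \<alpha>(3) by (intro exI[of _ "A(n := \<alpha>)"]) auto
  next
    assume "\<exists>A. (\<forall>k<Suc n. ?P A k) \<and> p = (if Suc n = 0 then x0 else A (Suc n - 1) 1)"
    then obtain A where A: "\<forall>k<Suc n. ?P A k" "p = A n 1" by auto
    then have "reaches \<gamma> K n (A n 0)" using Suc.IH[of "A n 0"] by auto
    then show "reaches \<gamma> K (Suc n) p" using A by auto
  qed
qed auto

lemma is_lift_imp_reaches:
  assumes "is_lift (G, \<pi>, x0) (slice_paths \<gamma> K) \<alpha>" "length \<gamma> = N" "N \<ge> 1"
  shows "reaches ((!) \<gamma>) (vec_index K) N (end_point \<alpha>)"
proof -
  have len: "length (slice_paths \<gamma> K) = N" using assms(2) by (simp add: slice_paths_def)
  have dp: "length \<alpha> = N" "\<And>k. k < N \<Longrightarrow> pathin G (\<alpha> ! k)"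
    "\<And>k. Suc k < N \<Longrightarrow> (\<alpha> ! k) 1 = (\<alpha> ! Suc k) 0" and hd: "hd \<alpha> 0 = x0"
    and eq: "\<And>k t. k < N \<Longrightarrow> t \<in> {0..1} \<Longrightarrow> \<pi> ((\<alpha> ! k) t) = (slice_paths \<gamma> K ! k) t"
    using assms(1) len by (auto simp: joined_in_def initial_point_def)
  have "\<alpha> \<noteq> []" using dp(1) assms(3) by auto
  then have ends: "(\<alpha> ! 0) 0 = x0" "end_point \<alpha> = (\<alpha> ! (N - 1)) 1"
    using hd dp(1) by (simp_all add: hd_conv_nth end_point_def last_conv_nth)
  have "(\<alpha> ! k) 0 = (if k = 0 then x0 else (\<alpha> ! (k - 1)) 1)" if "k < N" for k
    using dp(3)[of "k - 1"] that ends(1) by (cases k) auto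
  then show ?thesis
    unfolding reaches_iff using dp eq ends assms(2,3)
    by (intro exI[of _ "(!) \<alpha>"]) (auto simp: slice_paths_def)
qed

lemma reaches_imp_is_lift:
  assumes r: "reaches ((!) \<gamma>) (vec_index K) N p" and \<gamma>: "complex_part_path N \<gamma>" "N \<ge> 1"
    and K: "\<And>k. k < N \<Longrightarrow> vec_index K k \<in> \<S>"
  shows "\<exists>\<alpha>. is_lift (G, \<pi>, x0) (slice_paths \<gamma> K) \<alpha>"
proof -
  obtain A where A: "\<And>k. k < N \<Longrightarrow> pathin G (A k)"
    "\<And>k t. k < N \<Longrightarrow> t \<in> {0..1} \<Longrightarrow> \<pi> (A k t) = slice_emb (vec_index K k) ((\<gamma> ! k) t)"
    "\<And>k. k < N \<Longrightarrow> A k 0 = (if k = 0 then x0 else A (k - 1) 1)"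
    using r unfolding reaches_iff by blast
  have len: "length \<gamma> = N" and joined: "\<And>k. Suc k < N \<Longrightarrow> (\<gamma> ! k) 1 \<in> \<real>"
    using \<gamma> by (auto simp: complex_part_path_def joined_in_def)
  have "slice_preserving (\<pi> \<circ> A k)" if k: "k < N" for k
    unfolding slice_preserving_def
  proof (intro conjI bexI[OF _ K[OF k]])
    show "pathin slice_topology (\<pi> \<circ> A k)" using A(1)[OF k] continuous_map_projection by (rule pathin_compose)
    show "(\<pi> \<circ> A k) ` {0..1} \<subseteq> slice_plane (vec_index K k)" using A(2)[OF k] by auto
  qed
  moreover have "A k 1 \<in> topspace G" if "k < N" for k
    using continuous_map_image_subset_topspace[OF A(1)[OF that, unfolded pathin_def]] by auto
  moreover have "\<pi> (A k 1) \<in> \<real>" if "Suc k < N" for k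
    using A(2)[of k 1] joined[OF that] K[of k] that by (simp add: slice_emb_Reals_iff)
  ultimately have "is_lift (G, \<pi>, x0) (slice_paths \<gamma> K) (map A [0..<N])"
    using A len \<gamma>(2) by (auto simp: slice_paths_def joined_in_def initial_point_def hd_map)
  then show ?thesis by blast
qed

end

lemma quat_part_path_slice_paths:
  assumes "complex_part_path N \<gamma>" "\<And>k. k < N \<Longrightarrow> vec_index K k \<in> \<S>"
  shows "quat_part_path N (slice_paths \<gamma> K)"
proof -
  have len: "length \<gamma> = N" and \<gamma>: "\<And>k. k < N \<Longrightarrow> path (\<gamma> ! k)"
    and joined: "\<And>k. Suc k < N \<Longrightarrow> (\<gamma> ! k) 1 = (\<gamma> ! Suc k) 0 \<and> (\<gamma> ! k) 1 \<in> \<real>"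
    using assms(1) by (auto simp: complex_part_path_def joined_in_def)
  have "slice_preserving (slice_emb (vec_index K k) \<circ> (\<gamma> ! k))" if k: "k < N" for k
    unfolding slice_preserving_def
    using pathin_slice_emb[OF assms(2)[OF k] \<gamma>[OF k]]
    by (intro conjI bexI[OF _ assms(2)[OF k]]) auto
  moreover have "slice_emb (vec_index K k) ((\<gamma> ! k) 1) = slice_emb (vec_index K (Suc k)) ((\<gamma> ! Suc k) 0)"
    "slice_emb (vec_index K k) ((\<gamma> ! k) 1) \<in> \<real>" if "Suc k < N" for k
    using joined[OF that] by (metis Reals_cases Reals_of_real slice_emb_of_real)+
  ultimately show ?thesis
    using len by (auto simp: quat_part_path_def slice_paths_def joined_in_def)
qed

text \<open>The coefficient vector c at the end point satisfies \<open>f = zeta(L) c\<close> for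
  every tuple L. For the rows of J this reads \<open>f(gamma^J) = M(J) c\<close>, which determines
  c; inserting it for K gives the formula.\<close>

lemma (in maximal_slice_function) representation_formula:
  assumes N: "N \<ge> 1" and J: "J \<in> unit_mats (2 ^ N) N" and rank: "full_slice_rank J"
    and real: "\<pi> x0 \<in> \<real>" and \<gamma>: "complex_part_path N \<gamma>"
    and rows: "\<forall>i<2 ^ N. slice_paths \<gamma> (Matrix.row J i) \<prec>\<^sub>p (G, \<pi>, x0)"
    and K: "K \<in> unit_vecs_of N"
  shows "slice_paths \<gamma> K \<prec>\<^sub>p (G, \<pi>, x0)"
    and "f (end_point (path_lift (G, \<pi>, x0) (slice_paths \<gamma> K))) =
          scalar_prod (\<zeta> K) (mat_inv (zeta_matrix J) *\<^sub>v
              Matrix.vec (2 ^ N) (\<lambda>i. f (end_point (path_lift (G, \<pi>, x0) (slice_paths \<gamma> (Matrix.row J i))))))"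
proof -
  have cJ: "J \<in> carrier_mat (2 ^ N) N" using J by (simp add: unit_mats_def)
  have J_units: "J $$ (i, k) \<in> \<S>" if "i < 2 ^ N" "k < N" for i k
    using J elements_matI[OF cJ that refl] by (auto simp: unit_mats_def)
  have row: "vec_index (Matrix.row J i) k = J $$ (i, k)" "dim_vec (Matrix.row J i) = N" if "i < 2 ^ N" "k < N" for i k
    using that cJ by auto
  have len: "length \<gamma> = N" and paths: "\<And>k. k < N \<Longrightarrow> path (\<gamma> ! k)"
    and joined: "\<And>k. Suc k < N \<Longrightarrow> (\<gamma> ! k) 1 = (\<gamma> ! Suc k) 0 \<and> (\<gamma> ! k) 1 \<in> \<real>"
    using \<gamma> by (auto simp: complex_part_path_def joined_in_def)
  have lift_reaches: "reaches ((!) \<gamma>) (vec_index L) N (end_point (path_lift (G, \<pi>, x0) (slice_paths \<gamma> L)))"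
    if "slice_paths \<gamma> L \<prec>\<^sub>p (G, \<pi>, x0)" for L
  proof -
    have "is_lift (G, \<pi>, x0) (slice_paths \<gamma> L) (path_lift (G, \<pi>, x0) (slice_paths \<gamma> L))"
      using that unfolding contained_in_def path_lift_def by (metis someI)
    then show ?thesis using len N by (rule is_lift_imp_reaches)
  qed
  define p where "p i = end_point (path_lift (G, \<pi>, x0) (slice_paths \<gamma> (Matrix.row J i)))" for i
  have reaches_row: "reaches ((!) \<gamma>) (vec_index (Matrix.row J i)) N (p i)" if "i < 2 ^ N" for i
    using lift_reaches rows that by (simp add: p_def)
  have reaches_cong: "reaches g L n q \<longleftrightarrow> reaches g L' n q" if "\<And>k. k < n \<Longrightarrow> L k = L' k" for g L L' n q
    using that by (induction n arbitrary: q) auto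
  have reaches_J: "reaches ((!) \<gamma>) (\<lambda>k. J $$ (i, k)) N (p i)" if "i < 2 ^ N" for i
    using reaches_row[OF that] reaches_cong[of N "vec_index (Matrix.row J i)" "\<lambda>k. J $$ (i, k)"] row that by simp
  \<comment> \<open>A lift of row 0 starts at \<open>x0\<close>, so a real projection of
    \<open>x0\<close> forces the path in the complex plane to start at the same real number.\<close>
  obtain r where r: "(\<gamma> ! 0) 0 = of_real r" "\<pi> x0 = of_real r"
  proof -
    obtain q where "reaches ((!) \<gamma>) (\<lambda>k. J $$ (0, k)) 1 q"
      using reaches_prefix[OF reaches_J[of 0] N] by auto
    then obtain \<alpha> where "\<alpha> 0 = x0" "\<forall>t\<in>{0..1}. \<pi> (\<alpha> t) = slice_emb (J $$ (0, 0)) ((\<gamma> ! 0) t)" by auto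
    then have start: "\<pi> x0 = slice_emb (J $$ (0, 0)) ((\<gamma> ! 0) 0)" by (metis atLeastAtMost_iff order_refl zero_le_one)
    then have "(\<gamma> ! 0) 0 \<in> \<real>" using real J_units[of 0 0] N by (simp add: slice_emb_Reals_iff)
    then show ?thesis using that start by (auto elim!: Reals_cases)
  qed
  define e where "e n = (if n = 0 then of_real r else (\<gamma> ! (n - 1)) 1)" for n
  have e0: "(\<gamma> ! k) 0 = e k" "e k \<in> \<real>" if "k < N" for k
    using joined[of "k - 1"] r(1) that by (auto simp: e_def)
  obtain I0 where "I0 \<in> \<S>" by (rule exists_imag_unit)
  have rows_ex: "\<exists>q. reaches ((!) \<gamma>) (\<lambda>k. J $$ (i, k)) N q" if "i < 2 ^ N" for i
    using reaches_J[OF that] by blast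
  have "\<exists>c :: complex \<Rightarrow> nat \<Rightarrow> quat. \<forall>L. (\<forall>k<N. L k \<in> \<S>) \<longrightarrow> (\<exists>q. reaches ((!) \<gamma>) L N q \<and>
    \<pi> q = slice_emb (if N = 0 then I0 else L (N - 1)) (if N = 0 then of_real r else (\<gamma> ! (N - 1)) 1) \<and>
    eventually (\<lambda>z. local_rep q (slice_emb (if N = 0 then I0 else L (N - 1)) z) = (\<Sum>j<2 ^ N. slice_word L N j * c z j))
      (nhds (if N = 0 then of_real r else (\<gamma> ! (N - 1)) 1)))"
    by (rule reaches_all_units[where J = "\<lambda>i k. J $$ (i, k)" and N = N, OF paths e0[unfolded e_def] r(2)
          J_units inverse_word_matrix_exists[OF cJ rank] rows_ex order_refl])
  moreover have "(N = 0) = False" using N by simp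
  ultimately obtain c where c: "\<forall>L. (\<forall>k<N. L k \<in> \<S>) \<longrightarrow> (\<exists>q. reaches ((!) \<gamma>) L N q \<and>
    \<pi> q = slice_emb (L (N - 1)) ((\<gamma> ! (N - 1)) 1) \<and>
    eventually (\<lambda>z. local_rep q (slice_emb (L (N - 1)) z) = (\<Sum>j<2 ^ N. slice_word L N j * c z j)) (nhds ((\<gamma> ! (N - 1)) 1)))"
    by (simp only: if_False) blast
  define z1 where "z1 = (\<gamma> ! (N - 1)) 1"
  have value_eq: "f q = (\<Sum>j<2 ^ N. slice_word L N j * c z1 j)"
    if L: "\<forall>k<N. L k \<in> \<S>" and q: "reaches ((!) \<gamma>) L N q" for L q
  proof -
    obtain q' where q': "reaches ((!) \<gamma>) L N q'" "\<pi> q' = slice_emb (L (N - 1)) z1"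
      "eventually (\<lambda>z. local_rep q' (slice_emb (L (N - 1)) z) = (\<Sum>j<2 ^ N. slice_word L N j * c z j)) (nhds z1)"
      using c[rule_format, of L] L unfolding z1_def by blast
    \<comment> \<open>The filter \<open>nhds z1\<close> includes the point \<open>z1\<close> itself,
      so the identity near it can be evaluated there.\<close>
    have "local_rep q' (\<pi> q') = (\<Sum>j<2 ^ N. slice_word L N j * c z1 j)"
      unfolding q'(2) using q'(3) by (rule eventually_nhds_x_imp_x)
    then show ?thesis
      using local_rep_projection[OF reaches_in_topspace[OF q'(1)]] reaches_unique[OF q q'(1)] by simp
  qed
  have K_units: "\<forall>k<N. vec_index K k \<in> \<S>" and dK: "dim_vec K = N"
    using K by (auto simp: unit_vecs_of_def)
  obtain q where q: "reaches ((!) \<gamma>) (vec_index K) N q" using c[rule_format, of "vec_index K"] K_units by blast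
  show K_contained: "slice_paths \<gamma> K \<prec>\<^sub>p (G, \<pi>, x0)"
    unfolding contained_in_def
  proof
    have "length (slice_paths \<gamma> K) = N" by (simp add: slice_paths_def len)
    then show "quat_part_path (length (slice_paths \<gamma> K)) (slice_paths \<gamma> K)"
      using quat_part_path_slice_paths[OF \<gamma>, of K] K_units by simp
    show "\<exists>\<alpha>. is_lift (G, \<pi>, x0) (slice_paths \<gamma> K) \<alpha>"
      using reaches_imp_is_lift[OF q \<gamma> N] K_units by blast
  qed
  define cv where "cv = Matrix.vec (2 ^ N) (c z1)"
  define M where "M = Matrix.mat (2 ^ N) (2 ^ N) (\<lambda>(i, j). slice_word (\<lambda>k. J $$ (i, k)) N j)"
  have M: "zeta_matrix J = M" "M \<in> carrier_mat (2 ^ N) (2 ^ N)"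
    using zeta_matrix_upper_left[OF order_refl cJ] upper_left_full[OF cJ] by (simp_all add: M_def)
  have "invertible_mat M"
    using rank N cJ upper_left_full[OF cJ] M(1) by (auto simp: full_slice_rank_def dest!: bspec[of _ _ N])
  then obtain B where B: "inverts_mat M B" "inverts_mat B M" by (auto simp: invertible_mat_def)
  have cB: "B \<in> carrier_mat (2 ^ N) (2 ^ N)" by (rule inverts_mat_carrier[OF M(2) B])
  have "Matrix.vec (2 ^ N) (\<lambda>i. f (p i)) = M *\<^sub>v cv"
  proof (rule eq_vecI)
    fix i assume "i < dim_vec (M *\<^sub>v cv)"
    then have i: "i < 2 ^ N" by (simp add: M_def)
    then show "vec_index (Matrix.vec (2 ^ N) (\<lambda>i. f (p i))) i = vec_index (M *\<^sub>v cv) i"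
      using value_eq[OF _ reaches_J[OF i]] J_units
      by (simp add: M_def cv_def scalar_prod_def atLeast0LessThan)
  qed (simp add: M_def)
  then have "B *\<^sub>v Matrix.vec (2 ^ N) (\<lambda>i. f (p i)) = (B * M) *\<^sub>v cv"
    using M(2) cB by (simp add: cv_def assoc_mult_mat_vec)
  also have "\<dots> = cv" using B(2) cB by (simp add: inverts_mat_def cv_def)
  finally have "mat_inv (zeta_matrix J) *\<^sub>v Matrix.vec (2 ^ N) (\<lambda>i. f (p i)) = cv"
    using mat_inv_eq[OF M(2) B] M(1) by simp
  moreover have "f (end_point (path_lift (G, \<pi>, x0) (slice_paths \<gamma> K))) = scalar_prod (\<zeta> K) cv"
    using value_eq[OF K_units lift_reaches[OF K_contained]] index_\<zeta>[OF dK]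
    by (simp add: cv_def scalar_prod_def atLeast0LessThan)
  ultimately show "f (end_point (path_lift (G, \<pi>, x0) (slice_paths \<gamma> K))) =
      scalar_prod (\<zeta> K) (mat_inv (zeta_matrix J) *\<^sub>v
        Matrix.vec (2 ^ N) (\<lambda>i. f (end_point (path_lift (G, \<pi>, x0) (slice_paths \<gamma> (Matrix.row J i))))))"
    by (simp add: p_def)
qed

theorem theorem11p1:
  fixes N :: nat and J :: "quat mat" and \<gamma> :: "(real \<Rightarrow> complex) list"
    and G :: "'a topology" and \<pi> :: "'a \<Rightarrow> quat" and x0 :: 'a
  assumes "N \<ge> 1"
    and "J \<in> unit_mats (2 ^ N) N"
    and "full_slice_rank J"
    and "domain_of_regularity (G, \<pi>, x0)"
    and "\<pi> x0 \<in> \<real>"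
    and "complex_part_path N \<gamma>"
    and "\<forall>i<2 ^ N. slice_paths \<gamma> (Matrix.row J i) \<prec>\<^sub>p (G, \<pi>, x0)"
  shows "(\<forall>K\<in>unit_vecs_of N. slice_paths \<gamma> K \<prec>\<^sub>p (G, \<pi>, x0)) \<and>
    (\<forall>f. slice_regular (G, \<pi>, x0) f \<and> domain_of_existence (G, \<pi>, x0) f (G, \<pi>, x0) \<longrightarrow>
      (\<forall>K\<in>unit_vecs_of N.
        f (end_point (path_lift (G, \<pi>, x0) (slice_paths \<gamma> K))) =
          scalar_prod (\<zeta> K)
            (mat_inv (zeta_matrix J) *\<^sub>v
              Matrix.vec (2 ^ N) (\<lambda>i. f (end_point
                (path_lift (G, \<pi>, x0) (slice_paths \<gamma> (Matrix.row J i))))))))"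
proof -
  obtain f where "maximal_slice_function G \<pi> x0 f"
    using assms(4) by (auto simp: domain_of_regularity_def maximal_slice_function_def
      maximal_slice_function_axioms_def regular_slice_function_def)
  then have "\<forall>K\<in>unit_vecs_of N. slice_paths \<gamma> K \<prec>\<^sub>p (G, \<pi>, x0)"
    by (intro ballI maximal_slice_function.representation_formula(1)[OF _ assms(1-3,5-7)])
  moreover have "f (end_point (path_lift (G, \<pi>, x0) (slice_paths \<gamma> K))) =
          scalar_prod (\<zeta> K)
            (mat_inv (zeta_matrix J) *\<^sub>v
              Matrix.vec (2 ^ N) (\<lambda>i. f (end_point
                (path_lift (G, \<pi>, x0) (slice_paths \<gamma> (Matrix.row J i))))))"
    if "slice_regular (G, \<pi>, x0) f" "domain_of_existence (G, \<pi>, x0) f (G, \<pi>, x0)" "K \<in> unit_vecs_of N" for f K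
  proof -
    have "maximal_slice_function G \<pi> x0 f"
      using assms(4) that by (simp add: domain_of_regularity_def maximal_slice_function_def
        maximal_slice_function_axioms_def regular_slice_function_def)
    then show ?thesis
      by (rule maximal_slice_function.representation_formula(2)[OF _ assms(1-3,5-7) that(3)])
  qed
  ultimately show ?thesis by blast
qed

end
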